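(* Let $(E,\tau,M,\rho)$ be a Lie algebroid on a smooth manifold $M$. For each smooth section $V\in A^1(M,E)$ of the vector bundle $(E,\tau,M)$, there exists a unique $\mathbb{R}$-linear graded endomorphism of degree $0$ of $\Omega(M,E)$, called the Lie derivative with respect to $V$ and denoted by $\mathcal{L}_\rho(V)$, which satisfies the following properties: (i) For a smooth function $f\in\Omega^0(M,E)=C^\infty(M,\mathbb{R})$, $$\mathcal{L}_\rho(V)f=i(\rho\circ V)df=\mathcal{L}(\rho\circ V)f,$$ where $\mathcal{L}(\rho\circ V)$ denotes the usual Lie derivative with respect to the vector field $\rho\circ V$ on $M$. (ii) For a form $\eta\in\Omega^p(M,E)$ of degree $p>0$, $\mathcal{L}_\rho(V)\eta$ is the form given, for all smooth sections $V_1,\ldots,V_p$ of $(E,\tau,M)$, by $$\bigl(\mathcal{L}_\rho(V)\eta\bigr)(V_1,\ldots,V_p)=\mathcal{L}_\rho(V)\bigl(\eta(V_1,\ldots,V_p)\bigr)-\sum_{i=1}^p\eta(V_1,\ldots,V_{i-1},\{V,V_i\},V_{i+1},\ldots,V_p).$$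
   Context: A Lie algebroid $(E,\tau,M,\rho)$ is a smooth real vector bundle $(E,\tau,M)$ of finite rank over a smooth manifold $M$ (with projection $\tau:E\to M$), equipped with a Lie algebra bracket $(s_1,s_2)\mapsto\{s_1,s_2\}$ on the space of smooth sections of $\tau$ and a smooth vector bundle map $\rho:E\to TM$ (the anchor), such that $s\mapsto\rho\circ s$ is a Lie algebra homomorphism into the Lie algebra of smooth vector fields on $M$, and $\{s_1,fs_2\}=f\{s_1,s_2\}+\bigl(i(\rho\circ s_1)df\bigr)s_2$ for all smooth sections $s_1,s_2$ and all $f\in C^\infty(M,\mathbb{R})$, where $i(\rho\circ s_1)df=\langle df,\rho\circ s_1\rangle$. $(E^*,\pi,M)$ is the dual bundle. For $p\in\mathbb{Z}$, $A^p(M,E)$ is the space of smooth sections of $\bigwedge^pE$ (multivectors) and $\Omega^p(M,E)$ the space of smooth sections of $\bigwedge^pE^*$ (forms), with $\bigwedge^0E=\bigwedge^0E^*=M\times\mathbb{R}$, and both zero for $p<0$; $A(M,E)=\oplus_pA^p(M,E)$, $\Omega(M,E)=\oplus_p\Omega^p(M,E)$. An element of $\Omega^p(M,E)$ is identified with a skew-symmetric $C^\infty(M,\mathbb{R})$-multilinear map from $A^1(M,E)^p$ to $C^\infty(M,\mathbb{R})$. A linear endomorphism of a $\mathbb{Z}$-graded vector space is graded (homogeneous) of degree $d$ if it maps degree-$p$ elements to degree-$(p+d)$ elements for every $p$. *)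

theory Defs
  imports "HOL-Analysis.Analysis"
begin

section \<open>Real vector spaces and Lie algebras with explicit carriers\<close>

record 'a vec_struct =
  vcar :: "'a set"
  vadd :: "'a \<Rightarrow> 'a \<Rightarrow> 'a"
  vzero :: "'a"
  vscale :: "real \<Rightarrow> 'a \<Rightarrow> 'a"

definition real_vs :: "'a vec_struct \<Rightarrow> bool" where
  "real_vs W \<longleftrightarrow>
     vzero W \<in> vcar W \<and>
     (\<forall>u\<in>vcar W. \<forall>v\<in>vcar W. vadd W u v \<in> vcar W \<and> vadd W u v = vadd W v u) \<and>
     (\<forall>u\<in>vcar W. \<forall>v\<in>vcar W. \<forall>w\<in>vcar W. vadd W (vadd W u v) w = vadd W u (vadd W v w)) \<and>
     (\<forall>u\<in>vcar W. vadd W (vzero W) u = u \<and> (\<exists>v\<in>vcar W. vadd W u v = vzero W)) \<and>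
     (\<forall>a. \<forall>u\<in>vcar W. vscale W a u \<in> vcar W) \<and>
     (\<forall>a. \<forall>u\<in>vcar W. \<forall>v\<in>vcar W.
        vscale W a (vadd W u v) = vadd W (vscale W a u) (vscale W a v)) \<and>
     (\<forall>a b. \<forall>u\<in>vcar W.
        vscale W (a + b) u = vadd W (vscale W a u) (vscale W b u) \<and>
        vscale W (a * b) u = vscale W a (vscale W b u)) \<and>
     (\<forall>u\<in>vcar W. vscale W 1 u = u)"

definition vs_linear :: "'a vec_struct \<Rightarrow> 'b vec_struct \<Rightarrow> ('a \<Rightarrow> 'b) \<Rightarrow> bool" where
  "vs_linear W W' f \<longleftrightarrow>
     f \<in> vcar W \<rightarrow> vcar W' \<and>
     (\<forall>u\<in>vcar W. \<forall>v\<in>vcar W. f (vadd W u v) = vadd W' (f u) (f v)) \<and>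
     (\<forall>a. \<forall>u\<in>vcar W. f (vscale W a u) = vscale W' a (f u))"

definition vs_of_type :: "'a::real_vector vec_struct" where
  "vs_of_type = \<lparr>vcar = UNIV, vadd = (+), vzero = 0, vscale = (*\<^sub>R)\<rparr>"

definition lie_algebra :: "'a vec_struct \<Rightarrow> ('a \<Rightarrow> 'a \<Rightarrow> 'a) \<Rightarrow> bool" where
  "lie_algebra W br \<longleftrightarrow>
     real_vs W \<and>
     (\<forall>x\<in>vcar W. vs_linear W W (\<lambda>y. br x y)) \<and>
     (\<forall>y\<in>vcar W. vs_linear W W (\<lambda>x. br x y)) \<and>
     (\<forall>x\<in>vcar W. br x x = vzero W) \<and>
     (\<forall>x\<in>vcar W. \<forall>y\<in>vcar W. \<forall>z\<in>vcar W.
        vadd W (br x (br y z)) (vadd W (br y (br z x)) (br z (br x y))) = vzero W)"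

definition lie_hom ::
  "'a vec_struct \<Rightarrow> ('a \<Rightarrow> 'a \<Rightarrow> 'a) \<Rightarrow> 'b vec_struct \<Rightarrow> ('b \<Rightarrow> 'b \<Rightarrow> 'b) \<Rightarrow> ('a \<Rightarrow> 'b) \<Rightarrow> bool" where
  "lie_hom W br W' br' f \<longleftrightarrow>
     vs_linear W W' f \<and> (\<forall>x\<in>vcar W. \<forall>y\<in>vcar W. f (br x y) = br' (f x) (f y))"


section \<open>Smooth maps between open subsets of Euclidean spaces\<close>

text \<open>
  Model spaces are types of class \<open>real_inner\<close> that are spanned by a finite set (this is part
  of \<open>smooth_manifold\<close> below). The class \<open>euclidean_space\<close> is not used because it excludes
  dimension 0, and with it Lie algebras (Lie algebroids over a point) and bundles of rank 0.
\<close>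

primrec Ck_on ::
  "nat \<Rightarrow> 'a::real_normed_vector set \<Rightarrow> ('a \<Rightarrow> 'b::real_normed_vector) \<Rightarrow> bool" where
  "Ck_on 0 S f \<longleftrightarrow> continuous_on S f"
| "Ck_on (Suc k) S f \<longleftrightarrow>
     (\<forall>x\<in>S. f differentiable (at x)) \<and>
     (\<forall>v. Ck_on k S (\<lambda>x. frechet_derivative f (at x) v))"

text \<open>Only used for open sets \<open>S\<close> of finite-dimensional spaces.\<close>

definition smooth_on ::
  "'a::real_normed_vector set \<Rightarrow> ('a \<Rightarrow> 'b::real_normed_vector) \<Rightarrow> bool" where
  "smooth_on S f \<longleftrightarrow> (\<forall>k. Ck_on k S f)"


section \<open>Smooth manifolds\<close>

text \<open>
  A chart is a pair \<open>(U, \<phi>)\<close> of its domain and its coordinate map; the values of \<open>\<phi>\<close> outside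
  \<open>U\<close> are irrelevant. The atlas is not required to be maximal.
\<close>

type_synonym ('m, 'e) chart = "'m set \<times> ('m \<Rightarrow> 'e)"

record ('m, 'e) manifold =
  mtop :: "'m topology"
  charts :: "('m, 'e) chart set"

abbreviation pts :: "('m, 'e) manifold \<Rightarrow> 'm set" where
  "pts M \<equiv> topspace (mtop M)"

definition charts_at :: "('m, 'e) manifold \<Rightarrow> 'm \<Rightarrow> ('m, 'e) chart set" where
  "charts_at M x = {c \<in> charts M. x \<in> fst c}"

definition smooth_manifold :: "('m, 'e::real_inner) manifold \<Rightarrow> bool" where
  "smooth_manifold M \<longleftrightarrow>
     (\<exists>S::'e set. finite S \<and> span S = UNIV) \<and>
     Hausdorff_space (mtop M) \<and> second_countable (mtop M) \<and>
     (\<forall>(U, \<phi>)\<in>charts M.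
        openin (mtop M) U \<and> open (\<phi> ` U) \<and>
        homeomorphic_map (subtopology (mtop M) U) (top_of_set (\<phi> ` U)) \<phi>) \<and>
     (\<Union>(U, \<phi>)\<in>charts M. U) = pts M \<and>
     (\<forall>(U, \<phi>)\<in>charts M. \<forall>(V, \<psi>)\<in>charts M. smooth_on (\<phi> ` (U \<inter> V)) (\<psi> \<circ> inv_into U \<phi>))"

definition smooth_map ::
  "('m, 'e::real_inner) manifold \<Rightarrow> ('n, 'd::real_inner) manifold \<Rightarrow> ('m \<Rightarrow> 'n) \<Rightarrow> bool" where
  "smooth_map M N f \<longleftrightarrow>
     continuous_map (mtop M) (mtop N) f \<and>
     (\<forall>(U, \<phi>)\<in>charts M. \<forall>(V, \<psi>)\<in>charts N.
        smooth_on (\<phi> ` (U \<inter> f -` V)) (\<psi> \<circ> f \<circ> inv_into U \<phi>))"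

definition diffeomorphism ::
  "('m, 'e::real_inner) manifold \<Rightarrow> ('n, 'd::real_inner) manifold \<Rightarrow> ('m \<Rightarrow> 'n) \<Rightarrow> bool" where
  "diffeomorphism M N f \<longleftrightarrow>
     bij_betw f (pts M) (pts N) \<and> smooth_map M N f \<and> smooth_map N M (inv_into (pts M) f)"

definition open_submanifold :: "('m, 'e) manifold \<Rightarrow> 'm set \<Rightarrow> ('m, 'e) manifold" where
  "open_submanifold M U =
     \<lparr>mtop = subtopology (mtop M) U, charts = (\<lambda>(W, \<phi>). (W \<inter> U, \<phi>)) ` charts M\<rparr>"

definition prod_manifold ::
  "('m, 'e) manifold \<Rightarrow> ('n, 'd) manifold \<Rightarrow> ('m \<times> 'n, 'e \<times> 'd) manifold" where
  "prod_manifold M N =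
     \<lparr>mtop = prod_topology (mtop M) (mtop N),
      charts = (\<lambda>((U, \<phi>), (V, \<psi>)). (U \<times> V, map_prod \<phi> \<psi>)) ` (charts M \<times> charts N)\<rparr>"

definition euclidean_manifold :: "('e::real_inner, 'e) manifold" where
  "euclidean_manifold = \<lparr>mtop = euclidean, charts = {(UNIV, id)}\<rparr>"

definition smooth_functions :: "('m, 'e::real_inner) manifold \<Rightarrow> ('m \<Rightarrow> real) set" where
  "smooth_functions M = {f. smooth_map M euclidean_manifold f}"


section \<open>Smooth vector bundles and their sections\<close>

text \<open>
  The field \<open>trivs\<close> is a family of local trivialisations \<open>(U, \<Phi>)\<close> covering the base, where
  \<open>\<Phi>\<close> is only the fibre component: the trivialisation itself is the map
  \<open>a \<mapsto> (proj a, \<Phi> a)\<close> from the part of the bundle over \<open>U\<close> to \<open>U \<times> 'f\<close>.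
\<close>

record ('m, 'v, 'e, 'f, 'g) vbundle =
  base :: "('m, 'e) manifold"
  total :: "('v, 'g) manifold"
  proj :: "'v \<Rightarrow> 'm"
  fib :: "'m \<Rightarrow> 'v vec_struct"
  trivs :: "('m set \<times> ('v \<Rightarrow> 'f)) set"

definition local_trivialisation ::
  "('m, 'v, 'e::real_inner, 'f::real_inner, 'g::real_inner) vbundle \<Rightarrow>
   'm set \<Rightarrow> ('v \<Rightarrow> 'f) \<Rightarrow> bool" where
  "local_trivialisation B U \<Phi> \<longleftrightarrow>
     openin (mtop (base B)) U \<and>
     diffeomorphism
       (open_submanifold (total B) {a \<in> pts (total B). proj B a \<in> U})
       (prod_manifold (open_submanifold (base B) U) euclidean_manifold)
       (\<lambda>a. (proj B a, \<Phi> a)) \<and>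
     (\<forall>x\<in>U. vs_linear (fib B x) vs_of_type \<Phi>)"

definition vector_bundle ::
  "('m, 'v, 'e::real_inner, 'f::real_inner, 'g::real_inner) vbundle \<Rightarrow> bool" where
  "vector_bundle B \<longleftrightarrow>
     (\<exists>S::'f set. finite S \<and> span S = UNIV) \<and>
     smooth_manifold (base B) \<and> smooth_manifold (total B) \<and>
     smooth_map (total B) (base B) (proj B) \<and>
     (\<forall>x\<in>pts (base B).
        real_vs (fib B x) \<and> vcar (fib B x) = {a \<in> pts (total B). proj B a = x}) \<and>
     (\<forall>(U, \<Phi>)\<in>trivs B. local_trivialisation B U \<Phi>) \<and>
     (\<Union>(U, \<Phi>)\<in>trivs B. U) = pts (base B)"

text \<open>
  Sections are functions on the whole type that are \<open>undefined\<close> outside the base, so that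
  equality of sections is equality of functions.
\<close>

definition section_space ::
  "('m, 'v, 'e::real_inner, 'f::real_inner, 'g::real_inner) vbundle \<Rightarrow> ('m \<Rightarrow> 'v) vec_struct" where
  "section_space B =
     \<lparr>vcar = {s \<in> extensional (pts (base B)).
               smooth_map (base B) (total B) s \<and> (\<forall>x\<in>pts (base B). proj B (s x) = x)},
      vadd = (\<lambda>s t. \<lambda>x\<in>pts (base B). vadd (fib B x) (s x) (t x)),
      vzero = (\<lambda>x\<in>pts (base B). vzero (fib B x)),
      vscale = (\<lambda>a s. \<lambda>x\<in>pts (base B). vscale (fib B x) a (s x))\<rparr>"

abbreviation sections ::
  "('m, 'v, 'e::real_inner, 'f::real_inner, 'g::real_inner) vbundle \<Rightarrow> ('m \<Rightarrow> 'v) set" where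
  "sections B \<equiv> vcar (section_space B)"

definition fun_mult ::
  "('m, 'v, 'e::real_inner, 'f::real_inner, 'g::real_inner) vbundle \<Rightarrow>
   ('m \<Rightarrow> real) \<Rightarrow> ('m \<Rightarrow> 'v) \<Rightarrow> 'm \<Rightarrow> 'v" where
  "fun_mult B f s = (\<lambda>x\<in>pts (base B). vscale (fib B x) (f x) (s x))"


section \<open>The tangent bundle\<close>

text \<open>
  A tangent vector at \<open>x\<close> is given by its components with respect to all charts around \<open>x\<close>,
  which transform by the derivatives of the coordinate changes.
\<close>

type_synonym ('m, 'e) tangent = "'m \<times> (('m, 'e) chart \<Rightarrow> 'e)"

definition tangent_space ::
  "('m, 'e::real_inner) manifold \<Rightarrow> 'm \<Rightarrow> ('m, 'e) tangent vec_struct" where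
  "tangent_space M x =
     \<lparr>vcar = {x} \<times> {w \<in> extensional (charts_at M x).
        \<forall>(U, \<phi>)\<in>charts_at M x. \<forall>(V, \<psi>)\<in>charts_at M x.
          w (V, \<psi>) = frechet_derivative (\<psi> \<circ> inv_into U \<phi>) (at (\<phi> x)) (w (U, \<phi>))},
      vadd = (\<lambda>v w. (x, \<lambda>c\<in>charts_at M x. snd v c + snd w c)),
      vzero = (x, \<lambda>c\<in>charts_at M x. 0),
      vscale = (\<lambda>a v. (x, \<lambda>c\<in>charts_at M x. a *\<^sub>R snd v c))\<rparr>"

definition tangent_over ::
  "('m, 'e::real_inner) manifold \<Rightarrow> 'm set \<Rightarrow> ('m, 'e) tangent set" where
  "tangent_over M U = (\<Union>x\<in>U. vcar (tangent_space M x))"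

definition tangent_chart :: "('m, 'e) chart \<Rightarrow> ('m, 'e) tangent \<Rightarrow> 'e \<times> 'e" where
  "tangent_chart c v = (snd c (fst v), snd v c)"

definition tangent_manifold ::
  "('m, 'e::real_inner) manifold \<Rightarrow> (('m, 'e) tangent, 'e \<times> 'e) manifold" where
  "tangent_manifold M =
     \<lparr>mtop = topology_generated_by
        {{v \<in> tangent_over M (fst c). tangent_chart c v \<in> O'} | c O'. c \<in> charts M \<and> open O'},
      charts = (\<lambda>c. (tangent_over M (fst c), tangent_chart c)) ` charts M\<rparr>"

definition tangent_bundle ::
  "('m, 'e::real_inner) manifold \<Rightarrow> ('m, ('m, 'e) tangent, 'e, 'e, 'e \<times> 'e) vbundle" where
  "tangent_bundle M =
     \<lparr>base = M, total = tangent_manifold M, proj = fst, fib = tangent_space M,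
      trivs = (\<lambda>c. (fst c, \<lambda>v. snd v c)) ` charts M\<rparr>"

text \<open>In every chart, \<open>[X, Y] = DY X - DX Y\<close>.\<close>

definition vf_bracket ::
  "('m, 'e::real_inner) manifold \<Rightarrow> ('m \<Rightarrow> ('m, 'e) tangent) \<Rightarrow> ('m \<Rightarrow> ('m, 'e) tangent) \<Rightarrow>
   'm \<Rightarrow> ('m, 'e) tangent" where
  "vf_bracket M X Y = (\<lambda>x\<in>pts M. (x, \<lambda>(U, \<phi>)\<in>charts_at M x.
     frechet_derivative (\<lambda>z. snd (Y (inv_into U \<phi> z)) (U, \<phi>)) (at (\<phi> x)) (snd (X x) (U, \<phi>)) -
     frechet_derivative (\<lambda>z. snd (X (inv_into U \<phi> z)) (U, \<phi>)) (at (\<phi> x)) (snd (Y x) (U, \<phi>))))"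

text \<open>
  The value of \<open>df\<close> on a tangent vector, computed in some chart around its base point (the
  result does not depend on the chart).
\<close>

definition differential ::
  "('m, 'e::real_inner) manifold \<Rightarrow> ('m \<Rightarrow> real) \<Rightarrow> ('m, 'e) tangent \<Rightarrow> real" where
  "differential M f v =
     (let c = SOME c. c \<in> charts_at M (fst v)
      in frechet_derivative (f \<circ> inv_into (fst c) (snd c)) (at (snd c (fst v))) (snd v c))"

definition contract_d ::
  "('m, 'e::real_inner) manifold \<Rightarrow> ('m \<Rightarrow> ('m, 'e) tangent) \<Rightarrow> ('m \<Rightarrow> real) \<Rightarrow> 'm \<Rightarrow> real" where
  "contract_d M X f = (\<lambda>x. differential M f (X x))"

text \<open>
  The usual Lie derivative of a function along a vector field is its derivative along the flow
  of the field, i.e. at \<open>x\<close> along an integral curve starting in \<open>x\<close>.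
\<close>

definition integral_curve ::
  "('m, 'e::real_inner) manifold \<Rightarrow> ('m \<Rightarrow> ('m, 'e) tangent) \<Rightarrow> real \<Rightarrow> (real \<Rightarrow> 'm) \<Rightarrow> bool" where
  "integral_curve M X \<epsilon> \<gamma> \<longleftrightarrow>
     continuous_map (top_of_set {-\<epsilon><..<\<epsilon>}) (mtop M) \<gamma> \<and>
     (\<forall>t\<in>{-\<epsilon><..<\<epsilon>}. \<forall>(U, \<phi>)\<in>charts_at M (\<gamma> t).
        ((\<phi> \<circ> \<gamma>) has_vector_derivative snd (X (\<gamma> t)) (U, \<phi>)) (at t))"

definition lie_derivative_fun ::
  "('m, 'e::real_inner) manifold \<Rightarrow> ('m \<Rightarrow> ('m, 'e) tangent) \<Rightarrow> ('m \<Rightarrow> real) \<Rightarrow> 'm \<Rightarrow> real" where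
  "lie_derivative_fun M X f x =
     (THE d. \<exists>\<epsilon> \<gamma>. 0 < \<epsilon> \<and> \<gamma> 0 = x \<and> integral_curve M X \<epsilon> \<gamma> \<and>
        ((f \<circ> \<gamma>) has_real_derivative d) (at 0))"


section \<open>Lie algebroids\<close>

definition lie_algebroid ::
  "('m, 'v, 'e::real_inner, 'f::real_inner, 'g::real_inner) vbundle \<Rightarrow>
   ('v \<Rightarrow> ('m, 'e) tangent) \<Rightarrow> (('m \<Rightarrow> 'v) \<Rightarrow> ('m \<Rightarrow> 'v) \<Rightarrow> 'm \<Rightarrow> 'v) \<Rightarrow> bool" where
  "lie_algebroid B \<rho> br \<longleftrightarrow>
     vector_bundle B \<and>
     lie_algebra (section_space B) br \<and>
     smooth_map (total B) (tangent_manifold (base B)) \<rho> \<and>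
     (\<forall>x\<in>pts (base B). vs_linear (fib B x) (tangent_space (base B) x) \<rho>) \<and>
     lie_hom (section_space B) br
       (section_space (tangent_bundle (base B))) (vf_bracket (base B))
       (compose (pts (base B)) \<rho>) \<and>
     (\<forall>s\<in>sections B. \<forall>t\<in>sections B. \<forall>f\<in>smooth_functions (base B).
        br s (fun_mult B f t) =
        vadd (section_space B) (fun_mult B f (br s t))
          (fun_mult B (contract_d (base B) (compose (pts (base B)) \<rho> s) f) t))"


section \<open>Forms\<close>

text \<open>
  Elements of the \<open>p\<close>-th exterior power of the dual of \<open>W\<close>, as skew-symmetric \<open>p\<close>-linear
  functions of the list of their \<open>p\<close> arguments, extended by 0 to all other lists.
\<close>

definition alt_form :: "'a vec_struct \<Rightarrow> nat \<Rightarrow> ('a list \<Rightarrow> real) \<Rightarrow> bool" where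
  "alt_form W p \<omega> \<longleftrightarrow>
     (\<forall>vs. \<not> (length vs = p \<and> set vs \<subseteq> vcar W) \<longrightarrow> \<omega> vs = 0) \<and>
     (\<forall>vs. length vs = p \<and> set vs \<subseteq> vcar W \<longrightarrow>
        (\<forall>i<p. vs_linear W vs_of_type (\<lambda>u. \<omega> (vs[i := u]))) \<and>
        (\<forall>i<p. \<forall>j<p. i \<noteq> j \<longrightarrow> \<omega> (vs[i := vs ! j, j := vs ! i]) = - \<omega> vs))"

text \<open>
  Smooth sections of the \<open>p\<close>-th exterior power of the dual bundle. Smoothness is tested on the
  coefficient functions in the local trivialisations induced by those of \<open>B\<close>; the function
  \<open>inv_into (vcar (fib B x)) \<Phi>\<close> is the inverse of the trivialisation on the fibre over \<open>x\<close>.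
\<close>

definition forms ::
  "('m, 'v, 'e::real_inner, 'f::real_inner, 'g::real_inner) vbundle \<Rightarrow> int \<Rightarrow>
   ('m \<Rightarrow> 'v list \<Rightarrow> real) set" where
  "forms B p =
     (if p < 0 then {\<lambda>x vs. 0}
      else {\<eta>. (\<forall>x\<in>pts (base B). alt_form (fib B x) (nat p) (\<eta> x)) \<and>
               (\<forall>x. x \<notin> pts (base B) \<longrightarrow> \<eta> x = (\<lambda>vs. 0)) \<and>
               (\<forall>(U, \<Phi>)\<in>trivs B. \<forall>ws. length ws = nat p \<longrightarrow>
                  (\<lambda>x. \<eta> x (map (inv_into (vcar (fib B x)) \<Phi>) ws))
                    \<in> smooth_functions (open_submanifold (base B) U))})"

definition eval_form :: "('m \<Rightarrow> 'v list \<Rightarrow> real) \<Rightarrow> ('m \<Rightarrow> 'v) list \<Rightarrow> 'm \<Rightarrow> real" where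
  "eval_form \<eta> Vs = (\<lambda>x. \<eta> x (map (\<lambda>W. W x) Vs))"

text \<open>A function as a form of degree 0: its value at \<open>x\<close> is attached to the empty list.\<close>

definition fun_form ::
  "('m, 'v, 'e, 'f, 'g) vbundle \<Rightarrow> ('m \<Rightarrow> real) \<Rightarrow> 'm \<Rightarrow> 'v list \<Rightarrow> real" where
  "fun_form B f = (\<lambda>x vs. if x \<in> pts (base B) \<and> vs = [] then f x else 0)"

definition form_space ::
  "('m, 'v, 'e::real_inner, 'f::real_inner, 'g::real_inner) vbundle \<Rightarrow>
   (int \<Rightarrow> 'm \<Rightarrow> 'v list \<Rightarrow> real) vec_struct" where
  "form_space B =
     \<lparr>vcar = {\<omega>. (\<forall>p. \<omega> p \<in> forms B p) \<and> finite {p. \<omega> p \<noteq> (\<lambda>x vs. 0)}},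
      vadd = (\<lambda>\<omega> \<omega>' p x vs. \<omega> p x vs + \<omega>' p x vs),
      vzero = (\<lambda>p x vs. 0),
      vscale = (\<lambda>a \<omega> p x vs. a * \<omega> p x vs)\<rparr>"

definition in_degree ::
  "int \<Rightarrow> ('m \<Rightarrow> 'v list \<Rightarrow> real) \<Rightarrow> int \<Rightarrow> 'm \<Rightarrow> 'v list \<Rightarrow> real" where
  "in_degree p \<eta> = (\<lambda>q. if q = p then \<eta> else (\<lambda>x vs. 0))"

text \<open>
  Endomorphisms are \<open>undefined\<close> outside the space of forms, so that unique existence is meant
  with respect to maps on that space.
\<close>

definition graded_endomorphism ::
  "('m, 'v, 'e::real_inner, 'f::real_inner, 'g::real_inner) vbundle \<Rightarrow> int \<Rightarrow>
   ((int \<Rightarrow> 'm \<Rightarrow> 'v list \<Rightarrow> real) \<Rightarrow> int \<Rightarrow> 'm \<Rightarrow> 'v list \<Rightarrow> real) \<Rightarrow> bool" where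
  "graded_endomorphism B d L \<longleftrightarrow>
     L \<in> extensional (vcar (form_space B)) \<and>
     vs_linear (form_space B) (form_space B) L \<and>
     (\<forall>p. L ` in_degree p ` forms B p \<subseteq> in_degree (p + d) ` forms B (p + d))"

end

theory Submission
  imports Defs "HOL-Real_Asymp.Real_Asymp"
begin

text \<open>
  The formula in (ii) is \<open>C\<^sup>\<infinity>\<close>-linear in every argument: the Leibniz rule of the bracket produces
  exactly the term \<open>(\<rho>(V)f) \<eta>(V\<^sub>1, \<dots>, V\<^sub>p)\<close> that the derivation \<open>\<rho>(V)\<close> produces with the opposite sign.
  Hence its value at \<open>x\<close> depends only on the values of the sections at \<open>x\<close>, and since every vector of a
  fibre is the value of a global section (bump functions), it defines a form; the same extension
  property gives uniqueness. The derivative along the flow in (i) requires an integral curve through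
  every point, which comes from the Picard-Lindeloef theorem in a chart.
\<close>

section \<open>Finite-dimensional inner product spaces\<close>

text \<open>The model spaces are only known to be spanned by finite sets, so neither completeness
  nor compactness of balls comes with their types. The expansion of a vector in a
  \<open>parseval_frame\<close> replaces coordinates throughout; it also reduces a derivative in a
  varying direction to derivatives in fixed ones, which are all that \<open>Ck_on\<close> speaks
  about. A form is here a family of alternating functions on the fibres, not a multilinear map on
  sections. Passing from the formula in (ii) to such a family takes two kinds of sections:
  extensions of single vectors, chosen point by point and in no smooth way
  (\<open>section_at\<close>), for the values, and sections with constant coefficients in a
  trivialisation, on a neighbourhood common to all coefficients
  (\<open>local_constant_sections\<close>), for the smoothness. In both cases the extension by zero
  stays smooth because the cut-off lives in a compact set, which is closed in a Hausdorff
  space.\<close>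

definition parseval_frame :: "'a::real_inner set \<Rightarrow> bool" where
  "parseval_frame S \<longleftrightarrow> finite S \<and> (\<forall>v. (\<Sum>b\<in>S. (v \<bullet> b) *\<^sub>R b) = v)"

lemma parseval_frame_sum: "parseval_frame S \<Longrightarrow> (\<Sum>b\<in>S. (v \<bullet> b) *\<^sub>R b) = v"
  by (simp add: parseval_frame_def)

lemma parseval_frame_finite: "parseval_frame S \<Longrightarrow> finite S"
  by (simp add: parseval_frame_def)

text \<open>An orthogonal spanning set comes from Gram-Schmidt; it may contain 0, which has to be
  dropped before normalising. The expansion holds on the vectors of the set by orthonormality and
  extends to the span by linearity. In dimension 0 the frame is empty.\<close>

lemma parseval_frame_exists:
  assumes "\<exists>S::'a::real_inner set. finite S \<and> span S = UNIV"
  obtains S :: "'a::real_inner set" where "parseval_frame S"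
proof -
  obtain T :: "'a set" where "finite T" "span T = UNIV"
    using assms by blast
  then obtain C :: "'a set" where C: "finite C" "span C = UNIV" "pairwise orthogonal C"
    using basis_orthogonal[of T] by auto
  define e where "e c = c /\<^sub>R norm c" for c :: 'a
  define D where "D = C - {0}"
  have fin: "finite D" and spanD: "span D = UNIV"
    using C by (auto simp: D_def)
  have norm1: "norm (e c) = 1" if "c \<in> D" for c
    using that by (simp add: e_def D_def)
  have orth: "e c \<bullet> e d = (if c = d then 1 else 0)" if "c \<in> D" "d \<in> D" for c d
  proof (cases "c = d")
    case True
    then show ?thesis using norm1[OF that(1)] by (simp add: dot_square_norm)
  next
    case False
    then have "c \<bullet> d = 0"
      using C(3) that by (auto simp: D_def pairwise_def orthogonal_def)
    then show ?thesis using False by (simp add: e_def)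
  qed
  have inj: "inj_on e D"
    by (rule inj_onI) (metis orth zero_neq_one)
  have "(\<Sum>b\<in>e ` D. (v \<bullet> b) *\<^sub>R b) = v" for v
  proof -
    have "(\<Sum>c\<in>D. (v \<bullet> e c) *\<^sub>R e c) = v"
    proof (rule span_induct[where S = D and P = "\<lambda>v. (\<Sum>c\<in>D. (v \<bullet> e c) *\<^sub>R e c) = v"])
      show "v \<in> span D" by (simp add: spanD)
      have "0 \<in> {x. (\<Sum>c\<in>D. (x \<bullet> e c) *\<^sub>R e c) = x}" by simp
      then show "subspace {x. (\<Sum>c\<in>D. (x \<bullet> e c) *\<^sub>R e c) = x}"
        by (auto simp: subspace_def inner_add_left scaleR_add_left sum.distrib
            scaleR_scaleR[symmetric] scaleR_sum_right[symmetric] simp del: scaleR_scaleR)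
      fix d assume d: "d \<in> D"
      have dd: "d = norm d *\<^sub>R e d"
        using d by (simp add: e_def D_def)
      have "(d \<bullet> e c) *\<^sub>R e c = (if c = d then d else 0)" if "c \<in> D" for c
        using orth[OF d that] dd by (metis inner_scaleR_left mult.right_neutral mult_zero_right scaleR_zero_left)
      then have "(\<Sum>c\<in>D. (d \<bullet> e c) *\<^sub>R e c) = (\<Sum>c\<in>D. if c = d then d else 0)"
        by (rule sum.cong[OF refl])
      then show "(\<Sum>c\<in>D. (d \<bullet> e c) *\<^sub>R e c) = d"
        using d fin by simp
    qed
    then show ?thesis using inj by (simp add: sum.reindex)
  qed
  then have "parseval_frame (e ` D)"
    using fin by (simp add: parseval_frame_def)
  then show thesis by (rule that)
qed

lemma parseval_frame_prod:
  assumes "parseval_frame (S :: 'a::real_inner set)" "parseval_frame (T :: 'b::real_inner set)"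
  shows "\<exists>R :: ('a::real_inner \<times> 'b::real_inner) set. parseval_frame R"
proof -
  have S: "finite S" "\<And>v. (\<Sum>b\<in>S. (v \<bullet> b) *\<^sub>R b) = v" 
    and T: "finite T" "\<And>v. (\<Sum>b\<in>T. (v \<bullet> b) *\<^sub>R b) = v"
    using assms by (auto simp: parseval_frame_def)
  \<comment> \<open>A frame may contain 0; without removing it from \<open>S\<close>, the pair (0,
    0) could lie in both sets and the union would not be disjoint.\<close>
  define S' T' :: "('a \<times> 'b) set" where "S' = (\<lambda>b. (b, 0)) ` (S - {0})" and "T' = (\<lambda>b. (0, b)) ` T"
  have disj: "S' \<inter> T' = {}" by (auto simp: S'_def T'_def)
  have injS: "inj_on (\<lambda>b::'a. (b, 0::'b)) (S - {0})" and injT: "inj_on (\<lambda>b::'b. (0::'a, b)) T"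
    by (auto intro: inj_onI)
  have "(\<Sum>b\<in>S' \<union> T'. (v \<bullet> b) *\<^sub>R b) = v" for v
  proof -
    obtain x y where v: "v = (x, y)" by (cases v)
    have "(\<Sum>b\<in>S' \<union> T'. (v \<bullet> b) *\<^sub>R b) = (\<Sum>b\<in>S'. (v \<bullet> b) *\<^sub>R b) + (\<Sum>b\<in>T'. (v \<bullet> b) *\<^sub>R b)"
      using S T disj by (intro sum.union_disjoint) (auto simp: S'_def T'_def)
    also have "(\<Sum>b\<in>S'. (v \<bullet> b) *\<^sub>R b) = (\<Sum>b\<in>S - {0}. ((x \<bullet> b) *\<^sub>R b, 0))"
      unfolding S'_def sum.reindex[OF injS] by (simp add: v)
    also have "\<dots> = (\<Sum>b\<in>S. ((x \<bullet> b) *\<^sub>R b, 0))"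
      using S(1) by (intro sum.mono_neutral_left) (auto simp: zero_prod_def)
    also have "\<dots> = (x, 0)"
      using S by (simp add: prod_eq_iff fst_sum snd_sum)
    also have "(\<Sum>b\<in>T'. (v \<bullet> b) *\<^sub>R b) = (\<Sum>b\<in>T. (0, (y \<bullet> b) *\<^sub>R b))"
      unfolding T'_def sum.reindex[OF injT] by (simp add: v)
    also have "\<dots> = (0, y)"
      using T by (simp add: prod_eq_iff fst_sum snd_sum)
    finally show ?thesis by (simp add: v)
  qed
  moreover have "finite (S' \<union> T')" using S T by (simp add: S'_def T'_def)
  ultimately show ?thesis unfolding parseval_frame_def by blast
qed

text \<open>The ball is a closed subset of the set of all combinations of the frame with bounded
  coefficients. That set is compact by induction on the frame: each new vector contributes the image
  of a compact interval times the previous set.\<close>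

lemma compact_cball_parseval:
  assumes "parseval_frame (S :: 'a::real_inner set)"
  shows "compact (cball (x::'a::real_inner) r)"
proof -
  have fin: "finite S" and sum: "\<And>v. (\<Sum>b\<in>S. (v \<bullet> b) *\<^sub>R b) = v"
    using assms by (auto simp: parseval_frame_def)
  \<comment> \<open>Bounds the coefficient \<open>y \<bullet> b\<close> of a point \<open>y\<close>
    of the ball: \<open>norm y\<close> is at most \<open>norm x + r\<close>, and Cauchy-Schwarz does
    the rest.\<close>
  define R where "R b = (norm x + r) * norm b" for b :: 'a
  have "compact ((\<lambda>c. \<Sum>b\<in>A. c b *\<^sub>R b) ` {c. \<forall>b\<in>A. \<bar>c b\<bar> \<le> R b})" if "finite A" for A :: "'a set"
    using that
  proof induction
    case (insert a A)
    let ?K = "(\<lambda>c. \<Sum>b\<in>A. c b *\<^sub>R b) ` {c. \<forall>b\<in>A. \<bar>c b\<bar> \<le> R b}"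
    have "compact ((\<lambda>(t, k). t *\<^sub>R a + k) ` ({-R a..R a} \<times> ?K))"
      by (intro compact_continuous_image compact_Times compact_Icc insert.IH)
        (auto intro!: continuous_intros simp: case_prod_unfold)
    also have "(\<lambda>(t, k). t *\<^sub>R a + k) ` ({-R a..R a} \<times> ?K) =
        (\<lambda>c. \<Sum>b\<in>insert a A. c b *\<^sub>R b) ` {c. \<forall>b\<in>insert a A. \<bar>c b\<bar> \<le> R b}" (is "?l = ?r")
    proof (intro equalityI subsetI)
      fix y assume "y \<in> ?l"
      then obtain p where p: "p \<in> {-R a..R a} \<times> ?K" "y = (case p of (t, k) \<Rightarrow> t *\<^sub>R a + k)"
        by (rule imageE)
      define t k where "t = fst p" and "k = snd p"
      have t: "t \<in> {-R a..R a}" and k: "k \<in> ?K" and y: "y = t *\<^sub>R a + k"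
        using p by (simp_all only: t_def k_def mem_Times_iff case_prod_unfold)
      from k obtain c where c: "\<forall>b\<in>A. \<bar>c b\<bar> \<le> R b" and kc: "k = (\<Sum>b\<in>A. c b *\<^sub>R b)"
        by blast
      have "(\<Sum>b\<in>A. c b *\<^sub>R b) = (\<Sum>b\<in>A. (c(a := t)) b *\<^sub>R b)"
        using insert.hyps by (intro sum.cong) auto
      then have "y = (\<Sum>b\<in>insert a A. (c(a := t)) b *\<^sub>R b)"
        using insert.hyps by (simp add: y kc)
      moreover have "\<forall>b\<in>insert a A. \<bar>(c(a := t)) b\<bar> \<le> R b"
        using t c by (auto simp: abs_le_iff)
      ultimately show "y \<in> ?r" by blast
    next
      fix y assume "y \<in> ?r"
      then obtain c where c: "\<forall>b\<in>insert a A. \<bar>c b\<bar> \<le> R b" and "y = (\<Sum>b\<in>insert a A. c b *\<^sub>R b)"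
        by blast
      then have "y = c a *\<^sub>R a + (\<Sum>b\<in>A. c b *\<^sub>R b)" using insert.hyps by simp
      moreover have "c a \<in> {-R a..R a}" using c by (auto simp: abs_le_iff)
      moreover have "(\<Sum>b\<in>A. c b *\<^sub>R b) \<in> ?K" using c by blast
      ultimately show "y \<in> ?l" by (auto intro!: image_eqI[where x = "(c a, \<Sum>b\<in>A. c b *\<^sub>R b)"])
    qed
    finally show ?case .
  qed auto
  from this[OF fin] have "compact ((\<lambda>c. \<Sum>b\<in>S. c b *\<^sub>R b) ` {c. \<forall>b\<in>S. \<bar>c b\<bar> \<le> R b})" (is "compact ?C") .
  moreover have "cball x r \<subseteq> ?C"
  proof
    fix y assume "y \<in> cball x r"
    then have "norm y \<le> norm x + r"
      using norm_triangle_ineq2[of y x] by (simp add: dist_norm norm_minus_commute)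
    then have "\<bar>y \<bullet> b\<bar> \<le> R b" for b
      unfolding R_def using mult_right_mono[OF _ norm_ge_zero[of b]]
      by (intro order_trans[OF Cauchy_Schwarz_ineq2]) auto
    then show "y \<in> ?C"
      using sum[of y] by (intro image_eqI[where x = "\<lambda>b. y \<bullet> b"]) auto
  qed
  ultimately show ?thesis
    using compact_Int_closed[OF _ closed_cball, of ?C x r] by (simp only: Int_absorb1)
qed


section \<open>Calculus of smooth maps\<close>

lemma Ck_on_cong:
  assumes "open S" "\<And>x. x \<in> S \<Longrightarrow> f x = g x"
  shows "Ck_on k S f \<longleftrightarrow> Ck_on k S g"
  using assms(2)
proof (induction k arbitrary: f g)
  case 0
  then show ?case by (simp cong: continuous_on_cong)
next
  case (Suc k)
  have imp: "g differentiable (at x)" if "x \<in> S" "f differentiable (at x)" "\<And>x. x \<in> S \<Longrightarrow> f x = g x"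
    for x and f g :: "'a \<Rightarrow> 'b"
  proof -
    from that(2) obtain D where "(f has_derivative D) (at x)" by (auto simp: differentiable_def)
    then have "(g has_derivative D) (at x)"
      using assms(1) that(1) that(3) by (rule has_derivative_transform_within_open)
    then show ?thesis by (auto simp: differentiable_def)
  qed
  have "f differentiable (at x) \<longleftrightarrow> g differentiable (at x)" if "x \<in> S" for x
    using imp[OF that, of f g] imp[OF that, of g f] Suc.prems by auto
  moreover have "Ck_on k S (\<lambda>x. frechet_derivative f (at x) v) \<longleftrightarrow> Ck_on k S (\<lambda>x. frechet_derivative g (at x) v)"
    if "\<forall>x\<in>S. f differentiable (at x)" for v
  proof (rule Suc.IH)
    fix x assume x: "x \<in> S"
    then have "f differentiable (at x)" using that by blast
    from frechet_derivative_transform_within_open[OF this assms(1) x Suc.prems]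
    show "frechet_derivative f (at x) v = frechet_derivative g (at x) v" by simp
  qed
  ultimately show ?case by auto
qed

lemma Ck_on_subset: "Ck_on k S f \<Longrightarrow> T \<subseteq> S \<Longrightarrow> Ck_on k T f"
  by (induction k arbitrary: f) (auto intro: continuous_on_subset)

lemma Ck_on_local:
  assumes "\<And>x. x \<in> S \<Longrightarrow> \<exists>T. open T \<and> x \<in> T \<and> Ck_on k T f"
  shows "Ck_on k S f"
  using assms
proof (induction k arbitrary: f)
  case 0
  then have "isCont f x" if "x \<in> S" for x
    using that continuous_on_eq_continuous_at by (metis Ck_on.simps(1))
  then show ?case by (simp add: continuous_at_imp_continuous_on)
next
  case (Suc k)
  then show ?case by (auto; meson)
qed

lemma Ck_on_Suc_imp: "Ck_on (Suc k) S f \<Longrightarrow> Ck_on k S f"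
proof (induction k arbitrary: f)
  case 0
  then show ?case
    by (auto intro!: continuous_at_imp_continuous_on differentiable_imp_continuous_within)
qed auto

lemma Ck_on_const [simp]: "Ck_on k S (\<lambda>x. c)"
  by (induction k arbitrary: c) auto

lemma Ck_on_bounded_linear:
  assumes "bounded_linear f"
  shows "Ck_on k S f"
proof (cases k)
  case 0
  then show ?thesis using assms by (simp add: linear_continuous_on)
next
  case (Suc l)
  have "(f has_derivative f) (at x)" for x
    by (simp add: assms bounded_linear_imp_has_derivative)
  then have "f differentiable (at x)" "frechet_derivative f (at x) = f" for x
    by (auto simp: differentiable_def frechet_derivative_at[symmetric])
  then show ?thesis by (simp add: Suc)
qed

text \<open>\<open>Ck_on\<close> mentions \<open>frechet_derivative\<close>, a choice; on an open
  set any known derivative can stand in for it. This is how the product and chain rules enter the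
  inductions below.\<close>

lemma Ck_on_SucI:
  assumes "open S" "\<And>x. x \<in> S \<Longrightarrow> (f has_derivative f' x) (at x)"
    and "\<And>v. Ck_on k S (\<lambda>x. f' x v)"
  shows "Ck_on (Suc k) S f"
proof -
  have "frechet_derivative f (at x) = f' x" if "x \<in> S" for x
    using assms(2)[OF that] by (metis frechet_derivative_at)
  then have "Ck_on k S (\<lambda>x. frechet_derivative f (at x) v)" for v
    using assms(3)[of v] by (subst Ck_on_cong[OF assms(1)]) auto
  then show ?thesis using assms(2) by (auto simp: differentiable_def)
qed

lemma Ck_on_Suc_has_derivative:
  "Ck_on (Suc k) S f \<Longrightarrow> x \<in> S \<Longrightarrow> (f has_derivative frechet_derivative f (at x)) (at x)"
  by (auto simp: frechet_derivative_works)

lemma Ck_on_add: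
  assumes "open S" "Ck_on k S f" "Ck_on k S g"
  shows "Ck_on k S (\<lambda>x. f x + g x)"
  using assms(2,3)
proof (induction k arbitrary: f g)
  case 0
  then show ?case by (auto intro: continuous_on_add)
next
  case (Suc k)
  show ?case
    by (rule Ck_on_SucI[OF assms(1) has_derivative_add[OF Ck_on_Suc_has_derivative Ck_on_Suc_has_derivative]])
      (use Suc in auto)
qed

lemma Ck_on_sum:
  assumes "open S" "\<And>i. i \<in> I \<Longrightarrow> Ck_on k S (f i)"
  shows "Ck_on k S (\<lambda>x. \<Sum>i\<in>I. f i x)"
  using assms(2) by (induction I rule: infinite_finite_induct) (auto intro: Ck_on_add[OF assms(1)])

text \<open>Both factors are generalised in the induction because the product rule pairs
  \<open>f\<close> with a derivative of \<open>g\<close> and conversely.\<close>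

lemma Ck_on_bilinear:
  assumes "bounded_bilinear m" "open S" "Ck_on k S f" "Ck_on k S g"
  shows "Ck_on k S (\<lambda>x. m (f x) (g x))"
  using assms(3,4)
proof (induction k arbitrary: f g)
  case 0
  then show ?case by (auto intro: bounded_bilinear.continuous_on[OF assms(1)])
next
  case (Suc k)
  have "Ck_on k S f" "Ck_on k S g" using Suc.prems by (blast intro: Ck_on_Suc_imp)+
  then have "Ck_on k S (\<lambda>x. m (f x) (frechet_derivative g (at x) v) + m (frechet_derivative f (at x) v) (g x))" for v
    using Suc.prems by (intro Ck_on_add assms(2) Suc.IH) auto
  then show ?case
    using Suc.prems by (intro Ck_on_SucI[OF assms(2)
          bounded_bilinear.FDERIV[OF assms(1) Ck_on_Suc_has_derivative Ck_on_Suc_has_derivative]])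
qed

text \<open>The chain rule evaluates the derivative of \<open>g\<close> in the direction
  \<open>?f x v\<close>, which moves with \<open>x\<close>, while \<open>Ck_on\<close> controls only
  fixed directions. Expanding this direction in the frame gives a sum of scalar coefficients times
  directional derivatives of \<open>g\<close> composed with \<open>f\<close>, and the induction
  hypothesis applies to the latter. This is why the middle space needs a frame.\<close>

lemma Ck_on_compose:
  fixes f :: "'a::real_normed_vector \<Rightarrow> 'b::real_inner" and g :: "'b \<Rightarrow> 'c::real_normed_vector"
  assumes P: "parseval_frame (P :: 'b set)" and "open S" "Ck_on k S f" "Ck_on k T g" "f ` S \<subseteq> T"
  shows "Ck_on k S (\<lambda>x. g (f x))"
  using assms(3,4)
proof (induction k arbitrary: g)
  case 0
  then show ?case using assms(5) by (auto intro: continuous_on_compose2)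
next
  case (Suc k)
  let ?f = "\<lambda>x. frechet_derivative f (at x)" and ?g = "\<lambda>y. frechet_derivative g (at y)"
  have g: "(g has_derivative ?g (f x)) (at (f x))" if "x \<in> S" for x
    using Ck_on_Suc_has_derivative[OF Suc.prems(2)] assms(5) that by auto
  have "((\<lambda>x. g (f x)) has_derivative (\<lambda>v. ?g (f x) (?f x v))) (at x)" if "x \<in> S" for x
    using has_derivative_compose[OF Ck_on_Suc_has_derivative[OF Suc.prems(1) that] g[OF that]] .
  moreover have "Ck_on k S (\<lambda>x. ?g (f x) (?f x v))" for v
  proof -
    have "?g (f x) (?f x v) = (\<Sum>b\<in>P. (?f x v \<bullet> b) *\<^sub>R ?g (f x) b)" if "x \<in> S" for x
    proof -
      have lin: "linear (?g (f x))"
        using g[OF that] by (rule has_derivative_linear)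
      have "?g (f x) (?f x v) = ?g (f x) (\<Sum>b\<in>P. (?f x v \<bullet> b) *\<^sub>R b)"
        by (simp only: parseval_frame_sum[OF P])
      also have "\<dots> = (\<Sum>b\<in>P. (?f x v \<bullet> b) *\<^sub>R ?g (f x) b)"
        by (simp add: linear_sum[OF lin] linear_scale[OF lin])
      finally show ?thesis .
    qed
    moreover have "Ck_on k S (\<lambda>x. \<Sum>b\<in>P. (?f x v \<bullet> b) *\<^sub>R ?g (f x) b)"
      using Suc Ck_on_Suc_imp[OF Suc.prems(1)]
      by (intro Ck_on_sum Ck_on_bilinear[OF bounded_bilinear_scaleR]
          Ck_on_bilinear[OF bounded_bilinear_inner] assms(2) Suc.IH) auto
    ultimately show ?thesis by (subst Ck_on_cong[OF assms(2)]) auto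
  qed
  ultimately show ?case by (rule Ck_on_SucI[OF assms(2)])
qed

lemma smooth_on_subset: "smooth_on S f \<Longrightarrow> T \<subseteq> S \<Longrightarrow> smooth_on T f"
  by (auto simp: smooth_on_def intro: Ck_on_subset)

lemma smooth_on_cong:
  "open S \<Longrightarrow> (\<And>x. x \<in> S \<Longrightarrow> f x = g x) \<Longrightarrow> smooth_on S f \<longleftrightarrow> smooth_on S g"
  unfolding smooth_on_def using Ck_on_cong by metis

lemma smooth_on_local:
  assumes "\<And>x. x \<in> S \<Longrightarrow> \<exists>T. open T \<and> x \<in> T \<and> smooth_on T f"
  shows "smooth_on S f"
  unfolding smooth_on_def
proof
  fix k show "Ck_on k S f"
    by (rule Ck_on_local) (use assms in \<open>auto simp: smooth_on_def\<close>)
qed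

lemma smooth_on_const [simp]: "smooth_on S (\<lambda>x. c)"
  by (simp add: smooth_on_def)

lemma smooth_on_bounded_linear: "bounded_linear f \<Longrightarrow> smooth_on S f"
  by (simp add: smooth_on_def Ck_on_bounded_linear)

lemma smooth_on_add:
  "open S \<Longrightarrow> smooth_on S f \<Longrightarrow> smooth_on S g \<Longrightarrow> smooth_on S (\<lambda>x. f x + g x)"
  by (simp add: smooth_on_def Ck_on_add)

lemma smooth_on_bilinear:
  "bounded_bilinear m \<Longrightarrow> open S \<Longrightarrow> smooth_on S f \<Longrightarrow> smooth_on S g \<Longrightarrow> smooth_on S (\<lambda>x. m (f x) (g x))"
  by (simp add: smooth_on_def Ck_on_bilinear)

lemma smooth_on_compose:
  fixes f :: "'a::real_normed_vector \<Rightarrow> 'b::real_inner" and g :: "'b \<Rightarrow> 'c::real_normed_vector"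
  assumes "parseval_frame (P :: 'b set)" "open S" "smooth_on S f" "smooth_on T g" "f ` S \<subseteq> T"
  shows "smooth_on S (\<lambda>x. g (f x))"
  using assms Ck_on_compose unfolding smooth_on_def by metis

lemma smooth_on_continuous_on: "smooth_on S f \<Longrightarrow> continuous_on S f"
  by (metis Ck_on.simps(1) smooth_on_def)

lemma smooth_on_has_derivative:
  "smooth_on S f \<Longrightarrow> x \<in> S \<Longrightarrow> (f has_derivative frechet_derivative f (at x)) (at x)"
  unfolding smooth_on_def using Ck_on_Suc_has_derivative by blast

lemma smooth_on_frechet_derivative:
  "smooth_on S f \<Longrightarrow> smooth_on S (\<lambda>x. frechet_derivative f (at x) v)"
  unfolding smooth_on_def by (metis Ck_on.simps(2))

text \<open>Embedding a component into the product is linear; written as multiplication by the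
  constant scalar 1 it becomes an instance of the product rule. In contrast to
  \<open>smooth_on_compose\<close> this asks for no frame of the component's space.\<close>

lemma smooth_on_Pair:
  assumes "open S" "smooth_on S f" "smooth_on S g"
  shows "smooth_on S (\<lambda>x. (f x, g x))"
proof -
  have "bounded_linear (\<lambda>u. (u, 0))" "bounded_linear (\<lambda>u. (0, u))"
    by (auto intro!: bounded_linear_Pair bounded_linear_ident bounded_linear_zero)
  have 1: "smooth_on S (\<lambda>x. (f x, 0 :: 'c))"
  proof -
    have "bounded_bilinear (\<lambda>(t::real) u. t *\<^sub>R (u :: 'b, 0::'c))"
      by (rule bounded_bilinear.comp[OF bounded_bilinear_scaleR bounded_linear_ident])
        (auto intro!: bounded_linear_Pair bounded_linear_ident bounded_linear_zero)
    from smooth_on_bilinear[OF this assms(1) smooth_on_const[of S 1] assms(2)] show ?thesis by simp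
  qed
  have 2: "smooth_on S (\<lambda>x. (0 :: 'b, g x))"
  proof -
    have "bounded_bilinear (\<lambda>(t::real) u. t *\<^sub>R (0 :: 'b, u::'c))"
      by (rule bounded_bilinear.comp[OF bounded_bilinear_scaleR bounded_linear_ident])
        (auto intro!: bounded_linear_Pair bounded_linear_ident bounded_linear_zero)
    from smooth_on_bilinear[OF this assms(1) smooth_on_const[of S 1] assms(3)] show ?thesis by simp
  qed
  show ?thesis using smooth_on_add[OF assms(1) 1 2] by simp
qed

lemma smooth_on_linear_image:
  assumes "bounded_linear h" "open S" "smooth_on S f"
  shows "smooth_on S (\<lambda>x. h (f x))"
proof -
  have "bounded_bilinear (\<lambda>(t::real) u. t *\<^sub>R h u)"
    by (rule bounded_bilinear.comp[OF bounded_bilinear_scaleR bounded_linear_ident assms(1)])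
  from smooth_on_bilinear[OF this assms(2) smooth_on_const[of S 1] assms(3)] show ?thesis by simp
qed

section \<open>Smooth cut-off functions on the model space\<close>

lemma parseval_frame_real: "parseval_frame {1::real}"
  by (simp add: parseval_frame_def)

text \<open>The derivative of the inverse is bilinear in the inverse itself, so regularity of order
  \<open>k\<close> yields order \<open>Suc k\<close>.\<close>

lemma smooth_on_inverse: "smooth_on (- {0::real}) inverse"
proof -
  have op: "open (- {0::real})" by (simp add: open_Compl)
  have "Ck_on k (- {0::real}) inverse" for k
  proof (induction k)
    case 0
    then show ?case by (auto intro!: continuous_intros)
  next
    case (Suc k)
    have "((inverse :: real \<Rightarrow> real) has_derivative (\<lambda>h. - (inverse x * h * inverse x))) (at x)"
      if "x \<in> - {0}" for x
      using that by (intro has_derivative_inverse') auto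
    moreover have "Ck_on k (- {0}) (\<lambda>x::real. - (inverse x * v * inverse x))" for v
    proof -
      have "bounded_bilinear (\<lambda>x y::real. - (x * v * y))"
        by (rule bounded_bilinear.comp[OF bounded_bilinear_mult, where f = "\<lambda>x. - (x * v)" and g = id, simplified])
          (auto intro!: bounded_linear_minus bounded_linear_mult_left bounded_linear_ident simp: id_def)
      from Ck_on_bilinear[OF this op Suc Suc] show ?thesis .
    qed
    ultimately show ?case by (rule Ck_on_SucI[OF op])
  qed
  then show ?thesis by (simp add: smooth_on_def)
qed

text \<open>The power of \<open>t\<close> makes the family \<open>flat_exp n\<close> closed under differentiation up to linear combinations.\<close>

definition flat_exp :: "nat \<Rightarrow> real \<Rightarrow> real" where
  "flat_exp n t = (if t > 0 then exp (- 1 / t) / t ^ n else 0)"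

text \<open>For positive \<open>t\<close> this is the quotient rule. At 0 the right difference
  quotient tends to 0 since \<open>exp (- 1 / t)\<close> beats every power of \<open>t\<close>, and
  to the left the function vanishes.\<close>

lemma flat_exp_deriv:
  "(flat_exp n has_field_derivative (flat_exp (n + 2) t - real n * flat_exp (n + 1) t)) (at t)"
proof -
  consider "t > 0" | "t < 0" | "t = 0" by linarith
  then show ?thesis
  proof cases
    case 1
    have "((\<lambda>t. exp (- 1 / t) / t ^ n) has_field_derivative
        (exp (- 1 / t) * (1 / t\<^sup>2) * t ^ n - exp (- 1 / t) * (real n * t ^ (n - 1))) / (t ^ n * t ^ n)) (at t)"
      using 1 by (auto intro!: derivative_eq_intros simp: power2_eq_square)
    also have "(exp (- 1 / t) * (1 / t\<^sup>2) * t ^ n - exp (- 1 / t) * (real n * t ^ (n - 1))) / (t ^ n * t ^ n)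
        = flat_exp (n + 2) t - real n * flat_exp (n + 1) t"
      using 1 by (cases n) (auto simp: flat_exp_def field_simps power2_eq_square power_add)
    finally show ?thesis
      by (rule DERIV_cong_ev[THEN iffD1, OF refl _ refl, rotated])
        (use eventually_nhds_in_open[of "{0<..}" t] 1 in \<open>auto elim!: eventually_mono simp: flat_exp_def\<close>)
  next
    case 2
    have "((\<lambda>t. 0) has_field_derivative 0) (at t)" by simp
    then have "(flat_exp n has_field_derivative 0) (at t)"
      by (rule DERIV_cong_ev[THEN iffD1, OF refl _ refl, rotated])
        (use eventually_nhds_in_open[of "{..<0}" t] 2 in \<open>auto elim!: eventually_mono simp: flat_exp_def\<close>)
    then show ?thesis using 2 by (simp add: flat_exp_def)
  next
    case 3
    have "((\<lambda>h. flat_exp n h / h) \<longlongrightarrow> 0) (at_right 0)"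
    proof -
      have "((\<lambda>h::real. exp (- 1 / h) / h ^ n / h) \<longlongrightarrow> 0) (at_right 0)"
        by real_asymp
      then show ?thesis
        by (rule Lim_transform_eventually)
          (use eventually_at_right_less[of "0::real"] in \<open>auto elim!: eventually_mono simp: flat_exp_def\<close>)
    qed
    moreover have "((\<lambda>h. flat_exp n h / h) \<longlongrightarrow> 0) (at_left 0)"
      by (rule Lim_transform_eventually[OF tendsto_const])
        (auto simp: flat_exp_def eventually_at_filter)
    ultimately have "((\<lambda>h. flat_exp n h / h) \<longlongrightarrow> 0) (at 0)"
      by (simp add: filterlim_at_split)
    then show ?thesis
      using 3 by (simp add: has_field_derivative_iff flat_exp_def)
  qed
qed

lemma smooth_on_flat_exp: "smooth_on UNIV (flat_exp n)"
proof -
  have "Ck_on k UNIV (flat_exp n)" for k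
  proof (induction k arbitrary: n)
    case 0
    then show ?case
      using flat_exp_deriv[THEN DERIV_isCont] by (simp add: continuous_at_imp_continuous_on)
  next
    case (Suc k)
    show ?case
    proof (rule Ck_on_SucI[OF open_UNIV])
      show "(flat_exp n has_derivative (\<lambda>v. (flat_exp (n + 2) x - real n * flat_exp (n + 1) x) * v)) (at x)" for x
        using flat_exp_deriv[of n x] by (simp add: has_field_derivative_def)
      fix v
      have "Ck_on k UNIV (\<lambda>x. v * flat_exp (n + 2) x + (- v * real n) * flat_exp (n + 1) x)"
        by (intro Ck_on_add Ck_on_bilinear[OF bounded_bilinear_mult] Suc) auto
      then show "Ck_on k UNIV (\<lambda>x. (flat_exp (n + 2) x - real n * flat_exp (n + 1) x) * v)"
        by (simp add: algebra_simps)
    qed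
  qed
  then show ?thesis by (simp add: smooth_on_def)
qed

text \<open>The quotient f / (f + g), where \<open>f\<close> vanishes outside the ball of radius r
  and \<open>g\<close> inside the ball of radius r / 2; they have no common zero, so the denominator
  is positive. Both are functions of the squared distance, because the distance itself need not be
  smooth at \<open>z\<close>.\<close>

lemma bump_exists:
  fixes z :: "'a::real_inner"
  assumes "0 < r"
  obtains h :: "'a \<Rightarrow> real" where "smooth_on UNIV h" "\<And>y. dist z y \<le> r / 2 \<Longrightarrow> h y = 1"
    "\<And>y. dist z y \<ge> r \<Longrightarrow> h y = 0"
proof -
  define q where "q y = (y - z) \<bullet> (y - z)" for y
  have q: "q y = (dist z y)\<^sup>2" for y
    by (simp add: q_def dot_square_norm dist_norm norm_minus_commute)
  have lin: "smooth_on UNIV (\<lambda>y::'a. y + (- z))"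
    by (intro smooth_on_add smooth_on_const smooth_on_bounded_linear[OF bounded_linear_ident]) auto
  have qs: "smooth_on UNIV q"
    using smooth_on_bilinear[OF bounded_bilinear_inner open_UNIV lin lin] by (simp add: q_def[abs_def])
  have qm: "smooth_on UNIV (\<lambda>y. - q y)"
    using smooth_on_linear_image[OF bounded_linear_minus[OF bounded_linear_ident] open_UNIV qs] .
  define f g where "f y = flat_exp 0 (r\<^sup>2 - q y)" and "g y = flat_exp 0 (q y - r\<^sup>2 / 4)" for y
  have f: "smooth_on UNIV f"
    unfolding f_def[abs_def]
    using smooth_on_compose[OF parseval_frame_real open_UNIV smooth_on_add[OF open_UNIV smooth_on_const[of _ "r\<^sup>2"] qm]
        smooth_on_flat_exp[of 0]] by simp
  have g: "smooth_on UNIV g"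
    unfolding g_def[abs_def]
    using smooth_on_compose[OF parseval_frame_real open_UNIV smooth_on_add[OF open_UNIV qs smooth_on_const[of _ "- r\<^sup>2/4"]]
        smooth_on_flat_exp[of 0]] by simp
  have nonneg: "f y \<ge> 0" "g y \<ge> 0" for y by (auto simp: f_def g_def flat_exp_def)
  have pos: "f y + g y > 0" for y
  proof (cases "q y < r\<^sup>2")
    case True
    then have "f y > 0" by (simp add: f_def flat_exp_def)
    then show ?thesis using nonneg[of y] by linarith
  next
    case False
    then have "q y > r\<^sup>2 / 4" using zero_less_power[OF assms, of 2] by linarith
    then have "g y > 0" by (simp add: g_def flat_exp_def)
    then show ?thesis using nonneg[of y] by linarith
  qed
  have "smooth_on UNIV (\<lambda>y. inverse (f y + g y))"
    by (rule smooth_on_compose[OF parseval_frame_real open_UNIV smooth_on_add[OF open_UNIV f g] smooth_on_inverse])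
      (use pos in \<open>auto simp: less_le\<close>)
  from smooth_on_bilinear[OF bounded_bilinear_mult open_UNIV f this]
  have "smooth_on UNIV (\<lambda>y. f y * inverse (f y + g y))" .
  then show thesis
  proof (rule that)
    fix y assume "dist z y \<le> r / 2"
    then have "q y \<le> (r / 2)\<^sup>2" unfolding q by (rule power_mono) simp
    then have "g y = 0" by (simp add: g_def flat_exp_def power_divide)
    then show "f y * inverse (f y + g y) = 1" using pos[of y] by simp
  next
    fix y assume "dist z y \<ge> r"
    then have "q y \<ge> r\<^sup>2" unfolding q using assms by (intro power_mono) auto
    then show "f y * inverse (f y + g y) = 0" by (simp add: f_def flat_exp_def)
  qed
qed


section \<open>Local existence of integral curves\<close>

text \<open>Banach's fixed point theorem for the integral equation, on bounded continuous functions
  with values in the closed ball. These live on the whole line, so time is clamped by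
  \<open>cl\<close> to the interval from -e to e, and the equation is used only there.\<close>

lemma picard_lindelof:
  fixes G :: "'a::banach \<Rightarrow> 'a"
  assumes r: "0 < r"
    and lip: "\<And>x y. x \<in> cball x0 r \<Longrightarrow> y \<in> cball x0 r \<Longrightarrow> norm (G x - G y) \<le> L * norm (x - y)"
  obtains e c where "0 < e" "c 0 = x0"
    "\<And>t. t \<in> {-e<..<e} \<Longrightarrow> c t \<in> cball x0 r \<and> (c has_vector_derivative G (c t)) (at t)"
proof -
  \<comment> \<open>At least 1, so that \<open>e\<close> below may be defined by dividing by
    it.\<close>
  define L' where "L' = max L 1"
  have L': "L' > 0" by (simp add: L'_def)
  have lip': "norm (G x - G y) \<le> L' * norm (x - y)" if "x \<in> cball x0 r" "y \<in> cball x0 r" for x y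
    using lip[OF that] by (rule order_trans) (simp add: L'_def mult_right_mono)
  define K where "K = norm (G x0) + L' * r + 1"
  have K: "K > 0" using L' r by (simp add: K_def add_nonneg_pos)
  have bound: "norm (G x) \<le> K" if "x \<in> cball x0 r" for x
  proof -
    have "norm (G x) \<le> norm (G x0) + norm (G x - G x0)" by (rule norm_triangle_sub)
    also have "norm (G x - G x0) \<le> L' * norm (x - x0)" using that r by (intro lip') auto
    also have "\<dots> \<le> L' * r" using that L' by (auto simp: dist_norm norm_minus_commute)
    finally show ?thesis by (simp add: K_def)
  qed
  have contG: "continuous_on (cball x0 r) G"
  proof (rule lipschitz_on_continuous_on)
    show "L'-lipschitz_on (cball x0 r) G"
      using lip' L' by (intro lipschitz_onI) (auto simp: dist_norm)
  qed
  \<comment> \<open>Each of the two integrals in \<open>Q\<close> runs over a length of at most 2 e.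
    The first bound therefore keeps \<open>Q\<close> in the ball, and the second leaves a
    contraction factor \<open>4 * e * L'\<close> of at most 1 / 2.\<close>
  define e where "e = min (r / (4 * K)) (1 / (8 * L'))"
  have e: "e > 0" using r K L' by (simp add: e_def)
  have eK: "4 * e * K \<le> r" using K by (simp add: e_def min_def field_simps split: if_splits)
  have eL: "4 * e * L' \<le> 1 / 2" using L' by (simp add: e_def min_def field_simps split: if_splits)
  define cl where "cl t = max (- e) (min e t)" for t :: real
  have cl: "cl t \<in> {-e..e}" for t using e by (auto simp: cl_def)
  have cl0: "cl t = t" if "t \<in> {-e..e}" for t using that by (auto simp: cl_def)
  define I where "I g t = integral {-e..t} (\<lambda>s. G (g s))" for g t
  define C where "C = PiC UNIV (\<lambda>_::real. cball x0 r)"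
  have C: "g \<in> C \<longleftrightarrow> (\<forall>t. apply_bcontfun g t \<in> cball x0 r)" for g
    by (auto simp: C_def mem_PiC_iff)
  have cont: "continuous_on A (\<lambda>s. G (apply_bcontfun g s))" if "g \<in> C" for g A
    using that contG by (intro continuous_on_compose2[OF contG]) (auto simp: C)
  have int: "(\<lambda>s. G (apply_bcontfun g s)) integrable_on {-e..t}" if "g \<in> C" for g t
    using cont[OF that] by (rule integrable_continuous_real)
  have Ibound: "norm (I g t - I h t) \<le> 2 * e * B"
    if "g \<in> C" "h \<in> C" "t \<in> {-e..e}" "\<And>s. norm (G (g s) - G (h s)) \<le> B" for g h t B
  proof -
    have "I g t - I h t = integral {-e..t} (\<lambda>s. G (g s) - G (h s))"
      unfolding I_def using that int by (intro integral_diff[symmetric]) auto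
    also have "norm \<dots> \<le> B * (t - - e)"
      using that by (intro integral_bound continuous_on_diff cont) auto
    also have "\<dots> \<le> B * (2 * e)"
      using that(3) order_trans[OF norm_ge_zero that(4)[of 0]] by (intro mult_left_mono) auto
    finally show ?thesis by (simp add: mult_ac)
  qed
  have Inorm: "norm (I g t) \<le> 2 * e * K" if "g \<in> C" "t \<in> {-e..e}" for g t
  proof -
    have "norm (I g t) \<le> K * (t - - e)"
      unfolding I_def using that bound by (intro integral_bound cont) (auto simp: C)
    also have "\<dots> \<le> K * (2 * e)" using that(2) K by (intro mult_left_mono) auto
    finally show ?thesis by (simp add: mult_ac)
  qed
  \<comment> \<open>The integral over \<open>[0, t]\<close> is a difference of integrals from \<open>-e\<close>, so that no sign convention is needed.\<close>
  define Q where "Q g t = x0 + (I g (cl t) - I g 0)" for g t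
  have zero: "0 \<in> {-e..e}" using e by simp
  have Qball: "Q g t \<in> cball x0 r" if "g \<in> C" for g t
  proof -
    have "norm (I g (cl t) - I g 0) \<le> 4 * e * K"
      using norm_triangle_ineq4[of "I g (cl t)" "I g 0"] Inorm[OF that cl[of t]] Inorm[OF that zero] by linarith
    then show ?thesis using eK by (simp add: Q_def dist_norm norm_minus_commute)
  qed
  have Qcont: "(\<lambda>t. Q g t) \<in> bcontfun" if "g \<in> C" for g
  proof (rule bcontfun_normI)
    have "continuous_on {-e..e} (I g)"
      unfolding I_def using int[OF that] by (rule indefinite_integral_continuous_1)
    then show "continuous_on UNIV (\<lambda>t. Q g t)"
      unfolding Q_def using cl
      by (intro continuous_intros continuous_on_compose2[where f = cl and g = "I g"])
        (auto simp: cl_def[abs_def] intro!: continuous_intros)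
    show "norm (Q g t) \<le> norm x0 + r" for t
      using Qball[OF that, of t] norm_triangle_sub[of "Q g t" x0]
      by (simp add: dist_norm norm_minus_commute)
  qed
  define T where "T g = Bcontfun (\<lambda>t. Q g t)" for g :: "real \<Rightarrow>\<^sub>C 'a"
  have T: "apply_bcontfun (T g) t = Q g t" if "g \<in> C" for g t
    using Qcont[OF that] by (simp add: T_def Bcontfun_inverse)
  have "\<exists>!g\<in>C. T g = g"
  proof (rule Banach_fix)
    show "complete C" unfolding C_def
      by (simp add: complete_eq_closed closed_PiC)
    have "const_bcontfun x0 \<in> C" using r by (auto simp: C)
    then show "C \<noteq> {}" by blast
    show "T ` C \<subseteq> C" using Qball by (auto simp: C T)
    show "(0::real) \<le> 1 / 2" "1 / 2 < (1::real)" by auto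
    fix g h assume gC: "g \<in> C" and hC: "h \<in> C"
    note gh = gC hC
    have B: "norm (G (g s) - G (h s)) \<le> L' * dist g h" for s
      using lip'[of "g s" "h s"] gh dist_bounded[of g s h] L'
      by (smt (verit) C dist_norm mult_left_mono)
    show "dist (T g) (T h) \<le> 1 / 2 * dist g h"
    proof (rule dist_bound)
      fix t
      have "dist (T g t) (T h t) = norm ((I g (cl t) - I h (cl t)) - (I g 0 - I h 0))"
        using gh by (simp add: T Q_def dist_norm algebra_simps)
      also have "\<dots> \<le> 2 * (2 * e * (L' * dist g h))"
        using norm_triangle_ineq4[of "I g (cl t) - I h (cl t)" "I g 0 - I h 0"] 
          Ibound[of g h "cl t", OF _ _ cl B] Ibound[of g h 0, OF _ _ zero B] gh by linarith
      also have "\<dots> = (4 * e * L') * dist g h" by simp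
      also have "\<dots> \<le> 1 / 2 * dist g h" using eL by (intro mult_right_mono) auto
      finally show "dist (T g t) (T h t) \<le> 1 / 2 * dist g h" .
    qed
  qed
  then obtain g where g: "g \<in> C" "T g = g" by blast
  have gQ: "apply_bcontfun g t = x0 + (I g (cl t) - I g 0)" for t
    using T[OF g(1)] g(2) by (simp add: Q_def)
  show thesis
  proof (rule that[OF e, of "apply_bcontfun g"])
    show "g 0 = x0" by (subst gQ) (simp add: cl0[OF zero])
    fix t assume t: "t \<in> {-e<..<e}"
    then have t': "t \<in> {-e..e}" by auto
    have "(I g has_vector_derivative G (g t)) (at t within {-e..e})"
      unfolding I_def using integral_has_vector_derivative[OF cont[OF g(1)] t'] by simp
    then have "(I g has_vector_derivative G (g t)) (at t within {-e<..<e})"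
      by (rule has_vector_derivative_within_subset) auto
    then have "(I g has_vector_derivative G (g t)) (at t)"
      using t at_within_open[of t "{-e<..<e}"] by auto
    then have "((\<lambda>s. (x0 - I g 0) + I g s) has_vector_derivative 0 + G (g t)) (at t)"
      by (intro has_vector_derivative_add has_vector_derivative_const)
    then have "((\<lambda>s. (x0 - I g 0) + I g s) has_vector_derivative G (g t)) (at t)" by simp
    moreover have "open {-e<..<e}" by simp
    moreover note t
    moreover have "(x0 - I g 0) + I g s = g s" if "s \<in> {-e<..<e}" for s
      using that by (subst gQ) (simp add: cl0)
    ultimately have "(apply_bcontfun g has_vector_derivative G (g t)) (at t)"
      by (rule has_vector_derivative_transform_within_open)
    then show "g t \<in> cball x0 r \<and> (apply_bcontfun g has_vector_derivative G (g t)) (at t)"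
      using g(1) by (auto simp: C)
  qed
qed

text \<open>The mean value inequality on a ball needs a bound for the operator norm of the
  derivative. Continuity is known only for derivatives in fixed directions, so the derivative along
  each frame vector is bounded near \<open>z\<close> and the finitely many bounds are
  combined.\<close>

lemma smooth_on_locally_lipschitz:
  fixes F :: "'a::real_inner \<Rightarrow> 'b::real_normed_vector"
  assumes P: "parseval_frame (P :: 'a set)" and S: "open S" "z \<in> S" and F: "smooth_on S F"
  obtains r L where "0 < r" "cball z r \<subseteq> S"
    "\<And>x y. x \<in> cball z r \<Longrightarrow> y \<in> cball z r \<Longrightarrow> norm (F x - F y) \<le> L * norm (x - y)"
proof -
  let ?D = "\<lambda>x. frechet_derivative F (at x)"
  have "\<exists>U. open U \<and> z \<in> U \<and> (\<forall>b\<in>A. \<forall>x\<in>U \<inter> S. norm (?D x b) < norm (?D z b) + 1)" if "finite A" for A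
    using that
  proof induction
    case (insert a A)
    then obtain U where U: "open U" "z \<in> U" "\<forall>b\<in>A. \<forall>x\<in>U \<inter> S. norm (?D x b) < norm (?D z b) + 1" by blast
    have "continuous_on S (\<lambda>x. norm (?D x a))"
      by (intro continuous_on_norm smooth_on_continuous_on smooth_on_frechet_derivative F)
    then have "open {x\<in>S. norm (?D x a) < norm (?D z a) + 1}"
      using continuous_open_preimage[of S "\<lambda>x. norm (?D x a)" "{..<norm (?D z a) + 1}"] S
      by (simp add: vimage_def Int_def)
    then show ?case using U S
      by (intro exI[of _ "U \<inter> {x\<in>S. norm (?D x a) < norm (?D z a) + 1}"]) auto
  qed auto
  from this[OF parseval_frame_finite[OF P]] obtain U where U: "open U" "z \<in> U"
    "\<And>b x. b \<in> P \<Longrightarrow> x \<in> U \<inter> S \<Longrightarrow> norm (?D x b) < norm (?D z b) + 1" by blast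
  obtain r where r: "0 < r" "cball z r \<subseteq> U \<inter> S"
    using open_contains_cball[of "U \<inter> S"] U S by (metis IntI open_Int)
  \<comment> \<open>In the frame expansion of a vector \<open>v\<close> each coefficient is at most
    \<open>norm v * norm b\<close>, and the derivative along \<open>b\<close> stays below its norm
    at \<open>z\<close> plus 1.\<close>
  define L where "L = (\<Sum>b\<in>P. norm b * (norm (?D z b) + 1))"
  show thesis
  proof (rule that[OF r(1), of L])
    show "cball z r \<subseteq> S" using r by auto
    fix x y assume xy: "x \<in> cball z r" "y \<in> cball z r"
    show "norm (F x - F y) \<le> L * norm (x - y)"
    proof (rule differentiable_bound[OF convex_cball _ _ xy])
      fix u assume u: "u \<in> cball z r"
      then have uS: "u \<in> U \<inter> S" using r by auto
      then have D: "(F has_derivative ?D u) (at u)" using smooth_on_has_derivative[OF F] by blast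
      then show "(F has_derivative ?D u) (at u within cball z r)" by (rule has_derivative_at_withinI)
      show "onorm (?D u) \<le> L"
      proof (rule onorm_bound)
        show "0 \<le> L" by (auto simp: L_def intro!: sum_nonneg)
        fix v
        have lin: "linear (?D u)" using D by (rule has_derivative_linear)
        have "?D u v = ?D u (\<Sum>b\<in>P. (v \<bullet> b) *\<^sub>R b)" by (simp only: parseval_frame_sum[OF P])
        also have "\<dots> = (\<Sum>b\<in>P. (v \<bullet> b) *\<^sub>R ?D u b)"
          by (simp add: linear_sum[OF lin] linear_scale[OF lin])
        also have "norm \<dots> \<le> (\<Sum>b\<in>P. norm v * (norm b * (norm (?D z b) + 1)))"
        proof (rule sum_norm_le)
          fix b assume b: "b \<in> P"
          have "norm ((v \<bullet> b) *\<^sub>R ?D u b) = \<bar>v \<bullet> b\<bar> * norm (?D u b)" by simp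
          also have "\<dots> \<le> (norm v * norm b) * (norm (?D z b) + 1)"
            using U(3)[OF b uS] by (intro mult_mono Cauchy_Schwarz_ineq2) auto
          finally show "norm ((v \<bullet> b) *\<^sub>R ?D u b) \<le> norm v * (norm b * (norm (?D z b) + 1))"
            by (simp add: mult.assoc)
        qed
        finally show "norm (?D u v) \<le> L * norm v" by (simp add: L_def sum_distrib_left mult.commute)
      qed
    qed
  qed
qed

text \<open>
  The inner product embeds a finite-dimensional space into its dual, which is a Banach space
  by its type; this makes \<open>picard_lindelof\<close> applicable although the model space itself is not
  known to be complete.
\<close>

lemma integral_curve_exists_parseval:
  fixes F :: "'a::real_inner \<Rightarrow> 'a"
  assumes P: "parseval_frame (P :: 'a set)" and S: "open S" "z \<in> S" and F: "smooth_on S F"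
  obtains e c where "0 < e" "c 0 = z"
    "\<And>t. t \<in> {-e<..<e} \<Longrightarrow> c t \<in> S \<and> (c has_vector_derivative F (c t)) (at t)"
proof -
  obtain r L where r: "0 < r" "cball z r \<subseteq> S" and
    lip: "\<And>x y. x \<in> cball z r \<Longrightarrow> y \<in> cball z r \<Longrightarrow> norm (F x - F y) \<le> L * norm (x - y)"
    using smooth_on_locally_lipschitz[OF assms] by blast
  define L' where "L' = max L 0"
  have lip': "norm (F x - F y) \<le> L' * norm (x - y)" if "x \<in> cball z r" "y \<in> cball z r" for x y
    using lip[OF that] by (rule order_trans) (simp add: L'_def mult_right_mono)
  \<comment> \<open>A left inverse of the embedding \<open>?J\<close>: evaluating the functional
    \<open>?J v\<close> on the frame returns the coefficients of \<open>v\<close>.\<close>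
  define I :: "('a \<Rightarrow>\<^sub>L real) \<Rightarrow> 'a" where "I k = (\<Sum>b\<in>P. blinfun_apply k b *\<^sub>R b)" for k
  have I: "bounded_linear I"
    unfolding I_def by (intro bounded_linear_sum bounded_linear_scaleR_const
        bounded_bilinear.bounded_linear_left[OF bounded_bilinear_blinfun_apply])
  let ?J = "blinfun_inner_left :: 'a \<Rightarrow> _"
  have IJ: "I (?J v) = v" for v
    using parseval_frame_sum[OF P, of v] by (simp add: I_def inner_commute)
  obtain C where C: "C > 0" "\<And>k. norm (I k) \<le> norm k * C"
    using bounded_linear.pos_bounded[OF I] by blast
  obtain D where D: "D > 0" "\<And>v. norm (?J v) \<le> norm v * D"
    using bounded_linear.pos_bounded[OF bounded_linear_blinfun_inner_left] by blast
  \<comment> \<open>\<open>C\<close> bounds the operator norm of \<open>I\<close>, and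
    \<open>I (?J z) = z\<close>; hence radius r / C in the dual space corresponds to radius r around
    \<open>z\<close>.\<close>
  have Ib: "I k \<in> cball z r" if "k \<in> cball (?J z) (r / C)" for k
  proof -
    have "norm (I (k - ?J z)) \<le> norm (k - ?J z) * C" by (rule C)
    also have "norm (k - ?J z) \<le> r / C"
      using that by (simp add: dist_norm norm_minus_commute)
    also have "r / C * C = r" using C by simp
    finally show ?thesis
      using C(1) by (simp add: linear_diff[OF bounded_linear.linear[OF I]] IJ dist_norm norm_minus_commute)
  qed
  \<comment> \<open>The field on the dual is \<open>F\<close> conjugated by \<open>I\<close> and
    \<open>?J\<close>. A solution \<open>c\<close> of it projects to a solution for
    \<open>F\<close>, because the projected velocity is
    \<open>I (?J (F (I (c t)))) = F (I (c t))\<close>.\<close>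
  have "norm (?J (F (I k)) - ?J (F (I l))) \<le> (L' * C * D) * norm (k - l)"
    if "k \<in> cball (?J z) (r / C)" "l \<in> cball (?J z) (r / C)" for k l
  proof -
    have "norm (?J (F (I k)) - ?J (F (I l))) = norm (?J (F (I k) - F (I l)))"
      by (simp add: linear_diff[OF bounded_linear.linear[OF bounded_linear_blinfun_inner_left]])
    also have "\<dots> \<le> norm (F (I k) - F (I l)) * D" by (rule D)
    also have "\<dots> \<le> (L' * norm (I k - I l)) * D"
      using D lip'[OF Ib[OF that(1)] Ib[OF that(2)]] by simp
    also have "\<dots> \<le> (L' * (norm (k - l) * C)) * D"
      using D(1) C(2)[of "k - l"]
      by (intro mult_right_mono mult_left_mono)
        (auto simp: L'_def linear_diff[OF bounded_linear.linear[OF I]])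
    finally show ?thesis by (simp add: mult_ac)
  qed
  then obtain e c where e: "0 < e" and c: "c 0 = ?J z"
    and ct: "\<And>t. t \<in> {-e<..<e} \<Longrightarrow>
      c t \<in> cball (?J z) (r / C) \<and> (c has_vector_derivative ?J (F (I (c t)))) (at t)"
    using picard_lindelof[of "r / C" "?J z" "\<lambda>k. ?J (F (I k))" "L' * C * D"] r C by (metis divide_pos_pos)
  show thesis
  proof (rule that[OF e, of "\<lambda>t. I (c t)"])
    show "I (c 0) = z" by (simp add: c IJ)
    fix t assume t: "t \<in> {-e<..<e}"
    show "I (c t) \<in> S \<and> ((\<lambda>t. I (c t)) has_vector_derivative F (I (c t))) (at t)"
      using bounded_linear.has_vector_derivative[OF I, of c _ "at t"] ct[OF t] Ib r IJ by fastforce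
  qed
qed


section \<open>Germs of smooth functions on manifolds\<close>

text \<open>The conditions that \<open>smooth_manifold\<close> puts on a single chart, without
  compatibility. They pass to open parts and products directly, so the charts of a product can be
  used without verifying that the product is a manifold.\<close>

definition chart_of :: "('m, 'e::real_inner) manifold \<Rightarrow> 'm set \<Rightarrow> ('m \<Rightarrow> 'e) \<Rightarrow> bool" where
  "chart_of M U \<phi> \<longleftrightarrow> openin (mtop M) U \<and> open (\<phi> ` U) \<and>
     homeomorphic_map (subtopology (mtop M) U) (top_of_set (\<phi> ` U)) \<phi>"

text \<open>Smoothness of the germ: it is required on a neighbourhood in one chart, hence holds at
  all nearby points too, and \<open>smooth_atE\<close> transfers it to any other chart. Gluing and
  cutting off thus become local arguments.\<close>

definition smooth_at ::
  "('m, 'e::real_inner) manifold \<Rightarrow> ('m \<Rightarrow> 'b::real_normed_vector) \<Rightarrow> 'm \<Rightarrow> bool" where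
  "smooth_at M f x \<longleftrightarrow>
     (\<exists>(U, \<phi>)\<in>charts_at M x. \<exists>S. open S \<and> \<phi> x \<in> S \<and> S \<subseteq> \<phi> ` U \<and> smooth_on S (f \<circ> inv_into U \<phi>))"

lemma smooth_atI:
  "(U, \<phi>) \<in> charts M \<Longrightarrow> x \<in> U \<Longrightarrow> open S \<Longrightarrow> \<phi> x \<in> S \<Longrightarrow> S \<subseteq> \<phi> ` U \<Longrightarrow> smooth_on S (f \<circ> inv_into U \<phi>)
    \<Longrightarrow> smooth_at M f x"
  unfolding smooth_at_def charts_at_def by force

lemma chart_of_subset: "chart_of M U \<phi> \<Longrightarrow> U \<subseteq> pts M"
  by (simp add: chart_of_def openin_subset)

lemma chart_of_inj: "chart_of M U \<phi> \<Longrightarrow> inj_on \<phi> U"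
  using chart_of_subset[of M U \<phi>]
  by (auto simp: chart_of_def Int_absorb1 dest!: homeomorphic_imp_injective_map)

lemma chart_of_inv: "chart_of M U \<phi> \<Longrightarrow> x \<in> U \<Longrightarrow> inv_into U \<phi> (\<phi> x) = x"
  by (simp add: chart_of_inj)

lemma chart_of_open_image:
  assumes "chart_of M U \<phi>" "openin (mtop M) W"
  shows "open (\<phi> ` (U \<inter> W))"
proof -
  have "openin (subtopology (mtop M) U) (U \<inter> W)"
    using assms(2) by (auto simp: openin_subtopology)
  then have "openin (top_of_set (\<phi> ` U)) (\<phi> ` (U \<inter> W))"
    using assms(1) homeomorphic_imp_open_map unfolding chart_of_def open_map_def by blast
  then show ?thesis
    using assms(1) by (simp add: chart_of_def openin_open_eq)
qed

lemma chart_of_open_preimage: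
  assumes "chart_of M U \<phi>" "open S"
  shows "openin (mtop M) {x \<in> U. \<phi> x \<in> S}"
proof -
  have "continuous_map (subtopology (mtop M) U) (top_of_set (\<phi> ` U)) \<phi>"
    using assms(1) homeomorphic_imp_continuous_map unfolding chart_of_def by blast
  then have "continuous_map (subtopology (mtop M) U) euclidean \<phi>"
    by (simp add: continuous_map_in_subtopology)
  then have "openin (subtopology (mtop M) U) {x \<in> topspace (subtopology (mtop M) U). \<phi> x \<in> S}"
    using assms(2) by (simp add: continuous_map_def)
  moreover have "topspace (subtopology (mtop M) U) = U"
    using chart_of_subset[OF assms(1)] by auto
  ultimately have "openin (subtopology (mtop M) U) {x \<in> U. \<phi> x \<in> S}" by (simp only:)
  then show ?thesis
    using assms(1) by (auto simp: chart_of_def dest: openin_trans_full)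
qed

lemma chart_of_inv_continuous:
  assumes "chart_of M U \<phi>"
  shows "continuous_map (top_of_set (\<phi> ` U)) (mtop M) (inv_into U \<phi>)"
proof (unfold continuous_map_def, intro conjI allI impI)
  show "inv_into U \<phi> \<in> topspace (top_of_set (\<phi> ` U)) \<rightarrow> pts M"
    using chart_of_subset[OF assms] chart_of_inv[OF assms] by auto
  fix W assume W: "openin (mtop M) W"
  have "{z \<in> topspace (top_of_set (\<phi> ` U)). inv_into U \<phi> z \<in> W} = \<phi> ` (U \<inter> W)"
  proof (intro equalityI subsetI)
    fix z assume "z \<in> {z \<in> topspace (top_of_set (\<phi> ` U)). inv_into U \<phi> z \<in> W}"
    then have "z \<in> \<phi> ` U" "inv_into U \<phi> z \<in> W" by auto
    then show "z \<in> \<phi> ` (U \<inter> W)" 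
      by (intro image_eqI[of z \<phi> "inv_into U \<phi> z"]) (simp_all add: f_inv_into_f inv_into_into)
  qed (auto simp: chart_of_inv[OF assms])
  then show "openin (top_of_set (\<phi> ` U)) {z \<in> topspace (top_of_set (\<phi> ` U)). inv_into U \<phi> z \<in> W}"
    using chart_of_open_image[OF assms W] by (auto simp: openin_open intro!: exI[of _ "\<phi> ` (U \<inter> W)"])
qed

lemma chart_of_open_submanifold:
  assumes "chart_of M U \<phi>" "openin (mtop M) W"
  shows "chart_of (open_submanifold M W) (U \<inter> W) \<phi>"
proof -
  have U: "openin (mtop M) U" using assms(1) by (simp add: chart_of_def)
  have "homeomorphic_map (subtopology (subtopology (mtop M) U) (U \<inter> W))
      (subtopology (top_of_set (\<phi> ` U)) (\<phi> ` (U \<inter> W))) \<phi>"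
  proof (rule homeomorphic_map_subtopologies)
    show "homeomorphic_map (subtopology (mtop M) U) (top_of_set (\<phi> ` U)) \<phi>"
      using assms(1) by (simp add: chart_of_def)
    show "\<phi> ` (topspace (subtopology (mtop M) U) \<inter> (U \<inter> W)) = topspace (top_of_set (\<phi> ` U)) \<inter> \<phi> ` (U \<inter> W)"
      using chart_of_subset[OF assms(1)] by auto
  qed
  then have "homeomorphic_map (subtopology (subtopology (mtop M) W) (U \<inter> W))
      (top_of_set (\<phi> ` (U \<inter> W))) \<phi>"
    by (simp add: subtopology_subtopology Int_ac Int_absorb1 image_mono)
  then show ?thesis
    using chart_of_open_image[OF assms] U
    by (auto simp: chart_of_def open_submanifold_def openin_subtopology)
qed

text \<open>The assumptions concern the two charts involved instead of \<open>M\<close> and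
  \<open>N\<close> as a whole, so that the lemma applies to maps from and into the product of an
  open part of the base with the fibre.\<close>

lemma smooth_map_smooth_at:
  assumes "smooth_map M N f" and "(U, \<phi>) \<in> charts M" "x \<in> U" "chart_of M U \<phi>"
    and "(V, \<psi>) \<in> charts N" "openin (mtop N) V" "f x \<in> V"
  shows "smooth_at M (\<lambda>y. \<psi> (f y)) x"
proof (rule smooth_atI[OF assms(2,3)])
  have "continuous_map (mtop M) (mtop N) f" using assms(1) by (simp add: smooth_map_def)
  then have op: "openin (mtop M) {y \<in> pts M. f y \<in> V}"
    using assms(6) by (simp add: continuous_map_def)
  have "U \<inter> f -` V = U \<inter> {y \<in> pts M. f y \<in> V}"
    using chart_of_subset[OF assms(4)] by auto
  then show "open (\<phi> ` (U \<inter> f -` V))"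
    using chart_of_open_image[OF assms(4) op] by simp
  show "\<phi> x \<in> \<phi> ` (U \<inter> f -` V)" "\<phi> ` (U \<inter> f -` V) \<subseteq> \<phi> ` U"
    using assms by auto
  have "smooth_on (\<phi> ` (U \<inter> f -` V)) (\<psi> \<circ> f \<circ> inv_into U \<phi>)"
    using assms(1,2,5) unfolding smooth_map_def by fast
  then show "smooth_on (\<phi> ` (U \<inter> f -` V)) ((\<lambda>y. \<psi> (f y)) \<circ> inv_into U \<phi>)"
    by (simp add: comp_def)
qed

locale smooth_mfd =
  fixes M :: "('m, 'e::real_inner) manifold"
  assumes mfd: "smooth_manifold M"
begin

lemma charts_chart_of: "(U, \<phi>) \<in> charts M \<Longrightarrow> chart_of M U \<phi>"
proof -
  have "\<forall>(U, \<phi>)\<in>charts M. chart_of M U \<phi>"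
    using mfd unfolding smooth_manifold_def chart_of_def by (elim conjE)
  then show "(U, \<phi>) \<in> charts M \<Longrightarrow> chart_of M U \<phi>" by blast
qed

lemma charts_atD: "(U, \<phi>) \<in> charts_at M x \<Longrightarrow> (U, \<phi>) \<in> charts M \<and> x \<in> U \<and> chart_of M U \<phi>"
  by (auto simp: charts_at_def charts_chart_of)

lemma charts_at_inv: "(U, \<phi>) \<in> charts_at M x \<Longrightarrow> y \<in> U \<Longrightarrow> inv_into U \<phi> (\<phi> y) = y"
  by (rule chart_of_inv[of M]) (auto dest: charts_atD)

lemma charts_at_pts: "(U, \<phi>) \<in> charts_at M x \<Longrightarrow> x \<in> pts M"
  using charts_atD chart_of_subset by blast

lemma charts_at_exists:
  assumes "x \<in> pts M"
  obtains U \<phi> where "(U, \<phi>) \<in> charts_at M x"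
proof -
  have "x \<in> (\<Union>(U, \<phi>)\<in>charts M. U)" using assms mfd by (simp add: smooth_manifold_def)
  then show thesis using that by (auto simp: charts_at_def)
qed

lemma transition_smooth:
  "(U, \<phi>) \<in> charts M \<Longrightarrow> (V, \<psi>) \<in> charts M \<Longrightarrow> smooth_on (\<phi> ` (U \<inter> V)) (\<psi> \<circ> inv_into U \<phi>)"
proof -
  have "\<forall>(U, \<phi>)\<in>charts M. \<forall>(V, \<psi>)\<in>charts M. smooth_on (\<phi> ` (U \<inter> V)) (\<psi> \<circ> inv_into U \<phi>)"
    using mfd unfolding smooth_manifold_def by (elim conjE)
  then show "(U, \<phi>) \<in> charts M \<Longrightarrow> (V, \<psi>) \<in> charts M \<Longrightarrow> smooth_on (\<phi> ` (U \<inter> V)) (\<psi> \<circ> inv_into U \<phi>)"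
    by blast
qed

lemma model_frame:
  obtains P :: "'e set" where "parseval_frame P"
proof -
  have "\<exists>S::'e set. finite S \<and> span S = UNIV"
    using mfd unfolding smooth_manifold_def by (elim conjE)
  then show thesis by (rule parseval_frame_exists) (rule that)
qed

lemma smooth_at_pts: "smooth_at M f x \<Longrightarrow> x \<in> pts M"
  unfolding smooth_at_def using charts_at_pts by blast

text \<open>In the chart \<open>\<psi>\<close> the function is its known smooth expression composed
  with the transition map, on the image of the part of both domains where that expression is
  smooth.\<close>

lemma smooth_atE:
  assumes "smooth_at M f x" "(V, \<psi>) \<in> charts_at M x"
  obtains S where "open S" "\<psi> x \<in> S" "S \<subseteq> \<psi> ` V" "smooth_on S (f \<circ> inv_into V \<psi>)"
proof -
  obtain U \<phi> S where U: "(U, \<phi>) \<in> charts_at M x" and S: "open S" "\<phi> x \<in> S" "S \<subseteq> \<phi> ` U"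
    "smooth_on S (f \<circ> inv_into U \<phi>)"
    using assms(1) unfolding smooth_at_def by blast
  note U' = charts_atD[OF U] and V' = charts_atD[OF assms(2)]
  obtain P :: "'e set" where P: "parseval_frame P" by (rule model_frame)
  define T where "T = \<psi> ` (V \<inter> {y \<in> U. \<phi> y \<in> S})"
  have oT: "open T"
    unfolding T_def using chart_of_open_image chart_of_open_preimage U' V' S(1) by blast
  have sub: "T \<subseteq> \<psi> ` (V \<inter> U)" unfolding T_def by blast
  have tr: "smooth_on T (\<phi> \<circ> inv_into V \<psi>)"
    using smooth_on_subset[OF transition_smooth sub] U' V' by blast
  have img: "(\<phi> \<circ> inv_into V \<psi>) ` T \<subseteq> S"
    unfolding T_def using V' by (auto simp: chart_of_inv)
  have "smooth_on T (\<lambda>z. (f \<circ> inv_into U \<phi>) ((\<phi> \<circ> inv_into V \<psi>) z))"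
    by (rule smooth_on_compose[OF P oT tr S(4) img])
  moreover have "(f \<circ> inv_into U \<phi>) ((\<phi> \<circ> inv_into V \<psi>) z) = (f \<circ> inv_into V \<psi>) z" if "z \<in> T" for z
    using that U' V' by (auto simp: T_def chart_of_inv)
  ultimately have "smooth_on T (f \<circ> inv_into V \<psi>)"
    using smooth_on_cong[OF oT] by metis
  moreover have "\<psi> x \<in> T" unfolding T_def using U' V' S by blast
  ultimately show thesis using that oT sub by blast
qed

lemma smooth_at_cong:
  assumes "smooth_at M f x" "openin (mtop M) W" "x \<in> W" "\<And>y. y \<in> W \<Longrightarrow> f y = g y"
  shows "smooth_at M g x"
proof -
  obtain U \<phi> where U: "(U, \<phi>) \<in> charts_at M x"
    using charts_at_exists smooth_at_pts[OF assms(1)] by blast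
  note U' = charts_atD[OF U]
  obtain S where S: "open S" "\<phi> x \<in> S" "S \<subseteq> \<phi> ` U" "smooth_on S (f \<circ> inv_into U \<phi>)"
    using smooth_atE[OF assms(1) U] .
  define T where "T = S \<inter> \<phi> ` (U \<inter> W)"
  have oT: "open T" unfolding T_def using S(1) chart_of_open_image U' assms(2) by blast
  have "smooth_on T (f \<circ> inv_into U \<phi>)" using S(4) by (rule smooth_on_subset) (auto simp: T_def)
  moreover have "(f \<circ> inv_into U \<phi>) z = (g \<circ> inv_into U \<phi>) z" if "z \<in> T" for z
    using that U' assms(4) by (auto simp: T_def chart_of_inv)
  ultimately have "smooth_on T (g \<circ> inv_into U \<phi>)"
    using smooth_on_cong[OF oT] by metis
  then show ?thesis using U' oT S assms(3) by (intro smooth_atI[of U \<phi> M x T]) (auto simp: T_def)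
qed

lemma smooth_at_const [simp]: "x \<in> pts M \<Longrightarrow> smooth_at M (\<lambda>y. c) x"
proof -
  assume "x \<in> pts M"
  then obtain U \<phi> where "(U, \<phi>) \<in> charts_at M x" by (rule charts_at_exists)
  then show ?thesis
    by (intro smooth_atI[of U \<phi> M x "\<phi> ` U"]) (auto dest!: charts_atD simp: comp_def chart_of_def)
qed

lemma smooth_at_chart:
  assumes "(U, \<phi>) \<in> charts_at M x"
  shows "smooth_at M \<phi> x"
proof (rule smooth_atI)
  note U' = charts_atD[OF assms]
  show o: "open (\<phi> ` U)" using U' by (simp add: chart_of_def)
  have "smooth_on (\<phi> ` U) (\<lambda>z. z)" by (rule smooth_on_bounded_linear) (rule bounded_linear_ident)
  then show "smooth_on (\<phi> ` U) (\<phi> \<circ> inv_into U \<phi>)"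
    by (subst smooth_on_cong[OF o, where g = "\<lambda>z. z"]) (auto simp: f_inv_into_f)
qed (use charts_atD[OF assms] in auto)

lemma smooth_at_bilinear:
  assumes "bounded_bilinear m" "smooth_at M f x" "smooth_at M g x"
  shows "smooth_at M (\<lambda>y. m (f y) (g y)) x"
proof -
  obtain U \<phi> where U: "(U, \<phi>) \<in> charts_at M x"
    using charts_at_exists smooth_at_pts[OF assms(2)] by blast
  obtain S where S: "open S" "\<phi> x \<in> S" "S \<subseteq> \<phi> ` U" "smooth_on S (f \<circ> inv_into U \<phi>)"
    using smooth_atE[OF assms(2) U] .
  obtain T where T: "open T" "\<phi> x \<in> T" "T \<subseteq> \<phi> ` U" "smooth_on T (g \<circ> inv_into U \<phi>)"
    using smooth_atE[OF assms(3) U] .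
  have "smooth_on (S \<inter> T) (\<lambda>z. m ((f \<circ> inv_into U \<phi>) z) ((g \<circ> inv_into U \<phi>) z))"
    by (intro smooth_on_bilinear[OF assms(1)] open_Int S(1) T(1)
        smooth_on_subset[OF S(4)] smooth_on_subset[OF T(4)] Int_lower1 Int_lower2)
  then show ?thesis using S T charts_atD[OF U]
    by (intro smooth_atI[of U \<phi> M x "S \<inter> T"]) (auto simp: comp_def)
qed

lemma smooth_at_linear_image:
  assumes "bounded_linear h" "smooth_at M f x"
  shows "smooth_at M (\<lambda>y. h (f y)) x"
proof -
  have "bounded_bilinear (\<lambda>(t::real) u. t *\<^sub>R h u)"
    by (rule bounded_bilinear.comp[OF bounded_bilinear_scaleR bounded_linear_ident assms(1)])
  from smooth_at_bilinear[OF this smooth_at_const[OF smooth_at_pts[OF assms(2)], of 1] assms(2)]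
  show ?thesis by simp
qed

lemma smooth_at_mult:
  fixes f g :: "'m \<Rightarrow> real"
  shows "smooth_at M f x \<Longrightarrow> smooth_at M g x \<Longrightarrow> smooth_at M (\<lambda>y. f y * g y) x"
  by (rule smooth_at_bilinear[OF bounded_bilinear_mult])

lemma smooth_at_scaleR:
  "smooth_at M f x \<Longrightarrow> smooth_at M g x \<Longrightarrow> smooth_at M (\<lambda>y. f y *\<^sub>R g y) x"
  by (rule smooth_at_bilinear[OF bounded_bilinear_scaleR])

lemma smooth_at_inner_left: "smooth_at M f x \<Longrightarrow> smooth_at M (\<lambda>y. f y \<bullet> b) x"
  by (rule smooth_at_linear_image[OF bounded_linear_inner_left])

lemma smooth_at_Pair:
  assumes "smooth_at M f x" "smooth_at M g x"
  shows "smooth_at M (\<lambda>y. (f y, g y)) x"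
proof -
  obtain U \<phi> where U: "(U, \<phi>) \<in> charts_at M x"
    using charts_at_exists smooth_at_pts[OF assms(1)] by blast
  obtain S where S: "open S" "\<phi> x \<in> S" "S \<subseteq> \<phi> ` U" "smooth_on S (f \<circ> inv_into U \<phi>)"
    using smooth_atE[OF assms(1) U] .
  obtain T where T: "open T" "\<phi> x \<in> T" "T \<subseteq> \<phi> ` U" "smooth_on T (g \<circ> inv_into U \<phi>)"
    using smooth_atE[OF assms(2) U] .
  have "smooth_on (S \<inter> T) (\<lambda>z. ((f \<circ> inv_into U \<phi>) z, (g \<circ> inv_into U \<phi>) z))"
    by (intro smooth_on_Pair open_Int S(1) T(1)
        smooth_on_subset[OF S(4)] smooth_on_subset[OF T(4)] Int_lower1 Int_lower2)
  then show ?thesis using S T charts_atD[OF U]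
    by (intro smooth_atI[of U \<phi> M x "S \<inter> T"]) (auto simp: comp_def)
qed

lemma smooth_at_add:
  assumes "smooth_at M f x" "smooth_at M g x"
  shows "smooth_at M (\<lambda>y. f y + g y) x"
  using smooth_at_linear_image[OF bounded_linear_add[OF bounded_linear_fst bounded_linear_snd]
      smooth_at_Pair[OF assms]] by simp

lemma smooth_at_diff:
  assumes "smooth_at M f x" "smooth_at M g x"
  shows "smooth_at M (\<lambda>y. f y - g y) x"
  using smooth_at_linear_image[OF bounded_linear_sub[OF bounded_linear_fst bounded_linear_snd]
      smooth_at_Pair[OF assms]] by simp

lemma smooth_at_sum:
  assumes "x \<in> pts M" "\<And>i. i \<in> I \<Longrightarrow> smooth_at M (f i) x"
  shows "smooth_at M (\<lambda>y. \<Sum>i\<in>I. f i y) x"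
  using assms(2) by (induction I rule: infinite_finite_induct) (auto intro: smooth_at_add simp: assms(1))

lemma smooth_at_continuous:
  assumes "smooth_at M f x" "open T" "f x \<in> T"
  obtains W where "openin (mtop M) W" "x \<in> W" "f ` W \<subseteq> T"
proof -
  obtain U \<phi> where U: "(U, \<phi>) \<in> charts_at M x"
    using charts_at_exists smooth_at_pts[OF assms(1)] by blast
  note U' = charts_atD[OF U]
  obtain S where S: "open S" "\<phi> x \<in> S" "S \<subseteq> \<phi> ` U" "smooth_on S (f \<circ> inv_into U \<phi>)"
    using smooth_atE[OF assms(1) U] .
  define S' where "S' = S \<inter> (f \<circ> inv_into U \<phi>) -` T"
  have oS': "open S'"
    unfolding S'_def by (rule continuous_open_preimage[OF smooth_on_continuous_on[OF S(4)] S(1) assms(2)])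
  show thesis
  proof (rule that)
    show "openin (mtop M) {y \<in> U. \<phi> y \<in> S'}" using chart_of_open_preimage U' oS' by blast
  qed (use U' S assms in \<open>auto simp: S'_def chart_of_inv\<close>)
qed

lemma smooth_at_compose:
  fixes f :: "'m \<Rightarrow> 'b::real_inner" and g :: "'b \<Rightarrow> 'c::real_normed_vector"
  assumes "parseval_frame (P :: 'b set)" "smooth_at M f x" "open T" "f x \<in> T" "smooth_on T g"
  shows "smooth_at M (\<lambda>y. g (f y)) x"
proof -
  obtain U \<phi> where U: "(U, \<phi>) \<in> charts_at M x"
    using charts_at_exists smooth_at_pts[OF assms(2)] by blast
  note U' = charts_atD[OF U]
  obtain S where S: "open S" "\<phi> x \<in> S" "S \<subseteq> \<phi> ` U" "smooth_on S (f \<circ> inv_into U \<phi>)"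
    using smooth_atE[OF assms(2) U] .
  define S' where "S' = S \<inter> (f \<circ> inv_into U \<phi>) -` T"
  have oS': "open S'"
    unfolding S'_def by (rule continuous_open_preimage[OF smooth_on_continuous_on[OF S(4)] S(1) assms(3)])
  have "smooth_on S' (f \<circ> inv_into U \<phi>)" using S(4) by (rule smooth_on_subset) (simp add: S'_def)
  then have "smooth_on S' (\<lambda>z. g ((f \<circ> inv_into U \<phi>) z))"
    by (rule smooth_on_compose[OF assms(1) oS' _ assms(5)]) (auto simp: S'_def)
  then show ?thesis using S U' assms(4) oS'
    by (intro smooth_atI[of U \<phi> M x S']) (auto simp: comp_def S'_def chart_of_inv)
qed

lemma smooth_functions_iff: "f \<in> smooth_functions M \<longleftrightarrow> (\<forall>x\<in>pts M. smooth_at M f x)"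
proof
  assume f: "f \<in> smooth_functions M"
  show "\<forall>x\<in>pts M. smooth_at M f x"
  proof
    fix x assume x: "x \<in> pts M"
    then obtain U \<phi> where U: "(U, \<phi>) \<in> charts_at M x" by (rule charts_at_exists)
    note U' = charts_atD[OF U]
    have sm: "smooth_map M euclidean_manifold f" using f by (simp add: smooth_functions_def)
    have "smooth_at M (\<lambda>y. id (f y)) x"
      by (rule smooth_map_smooth_at[OF sm]) (use U' in \<open>auto simp: euclidean_manifold_def\<close>)
    then show "smooth_at M f x" by simp
  qed
next
  assume f: "\<forall>x\<in>pts M. smooth_at M f x"
  have "smooth_on (\<phi> ` U) (f \<circ> inv_into U \<phi>)" if U: "(U, \<phi>) \<in> charts M" for U \<phi>
  proof (rule smooth_on_local)
    fix z assume "z \<in> \<phi> ` U"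
    then obtain y where y: "y \<in> U" "z = \<phi> y" by blast
    then have "y \<in> pts M" using charts_chart_of[OF U] chart_of_subset by blast
    then have "smooth_at M f y" using f by blast
    from smooth_atE[OF this, of U \<phi>] U y show "\<exists>T. open T \<and> z \<in> T \<and> smooth_on T (f \<circ> inv_into U \<phi>)"
      by (metis (mono_tags, lifting) charts_at_def fst_conv mem_Collect_eq)
  qed
  moreover have "continuous_map (mtop M) euclidean f"
    unfolding continuous_map_eq_topcontinuous_at
  proof
    fix x assume x: "x \<in> pts M"
    have "\<exists>W. openin (mtop M) W \<and> x \<in> W \<and> (\<forall>y\<in>W. f y \<in> T)" if "open T" "f x \<in> T" for T
      using smooth_at_continuous[of f x T] f x that by (metis image_subset_iff)
    then show "topcontinuous_at (mtop M) euclidean f x" using x by (simp add: topcontinuous_at_def)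
  qed
  ultimately show "f \<in> smooth_functions M"
    by (auto simp: smooth_functions_def smooth_map_def euclidean_manifold_def)
qed

section \<open>Restriction to open sets and cut-off functions on manifolds\<close>

lemma smooth_at_open_submanifold:
  assumes "openin (mtop M) W" "x \<in> W"
  shows "smooth_at (open_submanifold M W) f x \<longleftrightarrow> smooth_at M f x"
proof
  assume "smooth_at (open_submanifold M W) f x"
  then obtain U' \<phi> S where U': "(U', \<phi>) \<in> charts_at (open_submanifold M W) x"
    and S': "open S" "\<phi> x \<in> S" "S \<subseteq> \<phi> ` U'" "smooth_on S (f \<circ> inv_into U' \<phi>)"
    unfolding smooth_at_def by blast
  then obtain U where U: "(U, \<phi>) \<in> charts M" "x \<in> U" "U' = U \<inter> W"
    by (auto simp: charts_at_def open_submanifold_def)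
  note S = S'[unfolded U(3)]
  \<comment> \<open>Restricting a chart keeps \<open>\<phi>\<close> but changes the domain of
    \<open>inv_into\<close>; by injectivity both inverses agree on the image of
    \<open>U \<inter> W\<close>.\<close>
  have "(f \<circ> inv_into (U \<inter> W) \<phi>) z = (f \<circ> inv_into U \<phi>) z" if "z \<in> S" for z
  proof -
    from that S(3) have "z \<in> \<phi> ` (U \<inter> W)" by (rule subsetD[rotated])
    then obtain y where "y \<in> U \<inter> W" "z = \<phi> y" by blast
    then show ?thesis
      using chart_of_inv[OF charts_chart_of[OF U(1)]]
        chart_of_inv[OF chart_of_open_submanifold[OF charts_chart_of[OF U(1)] assms(1)]] by simp
  qed
  then have "smooth_on S (f \<circ> inv_into U \<phi>)" using S(4) smooth_on_cong[OF S(1)] by metis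
  then show "smooth_at M f x" using U S by (intro smooth_atI[of U \<phi> M x S]) auto
next
  assume "smooth_at M f x"
  obtain U \<phi> where U: "(U, \<phi>) \<in> charts_at M x"
    using charts_at_exists smooth_at_pts[OF \<open>smooth_at M f x\<close>] by blast
  note U' = charts_atD[OF U]
  obtain S where S: "open S" "\<phi> x \<in> S" "S \<subseteq> \<phi> ` U" "smooth_on S (f \<circ> inv_into U \<phi>)"
    using smooth_atE[OF \<open>smooth_at M f x\<close> U] .
  define T where "T = S \<inter> \<phi> ` (U \<inter> W)"
  have oT: "open T" unfolding T_def using S(1) chart_of_open_image U' assms(1) by blast
  have "smooth_on T (f \<circ> inv_into U \<phi>)" using S(4) by (rule smooth_on_subset) (auto simp: T_def)
  moreover have "(f \<circ> inv_into U \<phi>) z = (f \<circ> inv_into (U \<inter> W) \<phi>) z" if "z \<in> T" for z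
  proof -
    from that have "z \<in> \<phi> ` (U \<inter> W)" by (simp add: T_def)
    then obtain y where "y \<in> U \<inter> W" "z = \<phi> y" by blast
    moreover have "chart_of (open_submanifold M W) (U \<inter> W) \<phi>"
      using chart_of_open_submanifold U' assms(1) by blast
    ultimately show ?thesis using chart_of_inv U' by (metis Int_iff comp_apply)
  qed
  ultimately have "smooth_on T (f \<circ> inv_into (U \<inter> W) \<phi>)"
    using smooth_on_cong[OF oT] by metis
  moreover have "(U \<inter> W, \<phi>) \<in> charts (open_submanifold M W)"
    using U' by (auto simp: open_submanifold_def)
  ultimately show "smooth_at (open_submanifold M W) f x"
    using U' S assms oT by (intro smooth_atI[of "U \<inter> W" \<phi> _ x T]) (auto simp: T_def)
qed

lemma smooth_manifold_open_submanifold: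
  assumes "openin (mtop M) W"
  shows "smooth_manifold (open_submanifold M W)"
proof -
  have "smooth_on (\<phi> ` (U \<inter> W \<inter> (V \<inter> W))) (\<psi> \<circ> inv_into (U \<inter> W) \<phi>)"
    if U: "(U, \<phi>) \<in> charts M" and V: "(V, \<psi>) \<in> charts M" for U \<phi> V \<psi>
  proof -
    note cU = charts_chart_of[OF U]
    have eq: "U \<inter> W \<inter> (V \<inter> W) = U \<inter> (V \<inter> W)" by blast
    have "openin (mtop M) (V \<inter> W)"
      using charts_chart_of[OF V] assms by (simp add: chart_of_def openin_Int)
    then have op: "open (\<phi> ` (U \<inter> (V \<inter> W)))" by (rule chart_of_open_image[OF cU])
    have "smooth_on (\<phi> ` (U \<inter> (V \<inter> W))) (\<psi> \<circ> inv_into U \<phi>)"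
      by (rule smooth_on_subset[OF transition_smooth[OF U V]]) blast
    moreover have "inv_into (U \<inter> W) \<phi> z = inv_into U \<phi> z" if "z \<in> \<phi> ` (U \<inter> (V \<inter> W))" for z
      using that chart_of_inv[OF cU] chart_of_inv[OF chart_of_open_submanifold[OF cU assms]] by auto
    ultimately show ?thesis unfolding eq using smooth_on_cong[OF op] by (metis comp_apply)
  qed
  moreover have "\<exists>S::'e set. finite S \<and> span S = UNIV"
    using mfd unfolding smooth_manifold_def by (elim conjE)
  moreover have "Hausdorff_space (mtop M)" "second_countable (mtop M)"
    and cov: "(\<Union>(U, \<phi>)\<in>charts M. U) = pts M"
    using mfd by (simp_all add: smooth_manifold_def)
  moreover have "chart_of (open_submanifold M W) U \<phi>"
    if "(U, \<phi>) \<in> charts (open_submanifold M W)" for U \<phi>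
    using that chart_of_open_submanifold[OF charts_chart_of assms]
    by (auto simp: open_submanifold_def)
  moreover have "(\<Union>(U, \<phi>)\<in>charts (open_submanifold M W). U) = pts (open_submanifold M W)"
    using cov by (auto simp: open_submanifold_def)
  moreover have "mtop (open_submanifold M W) = subtopology (mtop M) W"
    by (simp add: open_submanifold_def)
  ultimately show ?thesis
    unfolding smooth_manifold_def chart_of_def
    by (auto simp: Hausdorff_space_subtopology second_countable_subtopology)
      (auto simp: open_submanifold_def)
qed

lemma smooth_functions_open_submanifold_iff:
  assumes "openin (mtop M) W"
  shows "f \<in> smooth_functions (open_submanifold M W) \<longleftrightarrow> (\<forall>x\<in>W. smooth_at M f x)"
proof -
  interpret S: smooth_mfd "open_submanifold M W"
    by unfold_locales (rule smooth_manifold_open_submanifold[OF assms])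
  have "pts (open_submanifold M W) = W"
    using openin_subset[OF assms] by (auto simp: open_submanifold_def)
  then show ?thesis
    by (simp add: S.smooth_functions_iff smooth_at_open_submanifold[OF assms])
qed

text \<open>A bump function of the model space, read in a chart and extended by 0. Smoothness
  outside \<open>U\<close> holds because \<open>C\<close>, the image of a compact ball, is compact
  and hence closed in a Hausdorff space: its complement is an open set on which the function is 0.
  \<open>C\<close> is part of the conclusion because later extensions by zero repeat this
  argument.\<close>

lemma bump_function:
  assumes "openin (mtop M) W" "x \<in> W"
  obtains \<theta> C N where "\<And>y. y \<in> pts M \<Longrightarrow> smooth_at M \<theta> y" "closedin (mtop M) C" "C \<subseteq> W"
    "\<And>y. y \<notin> C \<Longrightarrow> \<theta> y = (0::real)" "openin (mtop M) N" "x \<in> N" "N \<subseteq> W" "\<And>y. y \<in> N \<Longrightarrow> \<theta> y = 1"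
proof -
  obtain P :: "'e set" where P: "parseval_frame P" by (rule model_frame)
  have "x \<in> pts M" using assms openin_subset by blast
  then obtain U \<phi> where U: "(U, \<phi>) \<in> charts_at M x" by (rule charts_at_exists)
  note U' = charts_atD[OF U]
  then have cU: "chart_of M U \<phi>" by blast
  have "open (\<phi> ` (U \<inter> W))" "\<phi> x \<in> \<phi> ` (U \<inter> W)"
    using chart_of_open_image[OF cU assms(1)] U' assms(2) by auto
  then obtain r where r: "r > 0" "cball (\<phi> x) r \<subseteq> \<phi> ` (U \<inter> W)"
    using open_contains_cball by metis
  obtain h :: "'e \<Rightarrow> real" where h: "smooth_on UNIV h" "\<And>z. dist (\<phi> x) z \<le> r / 2 \<Longrightarrow> h z = 1"
    "\<And>z. dist (\<phi> x) z \<ge> r \<Longrightarrow> h z = 0" using bump_exists[OF r(1)] by metis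
  define \<theta> where "\<theta> y = (if y \<in> U then h (\<phi> y) else 0)" for y
  define C where "C = inv_into U \<phi> ` cball (\<phi> x) r"
  have inC: "y \<in> C \<longleftrightarrow> y \<in> U \<and> \<phi> y \<in> cball (\<phi> x) r" for y
  proof
    assume "y \<in> C"
    then show "y \<in> U \<and> \<phi> y \<in> cball (\<phi> x) r"
      using r(2) chart_of_inv[OF cU] unfolding C_def by (auto simp: subset_iff image_iff; metis mem_cball)
  next
    assume "y \<in> U \<and> \<phi> y \<in> cball (\<phi> x) r"
    then show "y \<in> C" unfolding C_def using chart_of_inv[OF cU] by (metis image_eqI)
  qed
  have "compactin (top_of_set (\<phi> ` U)) (cball (\<phi> x) r)"
    using compact_cball_parseval[OF P] r(2) by (auto simp: compactin_subtopology)
  then have "compactin (mtop M) C"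
    unfolding C_def using chart_of_inv_continuous[OF cU] by (rule image_compactin)
  moreover have "Hausdorff_space (mtop M)" using mfd by (simp add: smooth_manifold_def)
  ultimately have clC: "closedin (mtop M) C" by (metis compactin_imp_closedin)
  have zero: "\<theta> y = 0" if "y \<notin> C" for y
    using that h(3) by (auto simp: \<theta>_def inC)
  show thesis
  proof (rule that[of \<theta> C "{y \<in> U. \<phi> y \<in> ball (\<phi> x) (r / 2)}"])
    fix y assume y: "y \<in> pts M"
    show "smooth_at M \<theta> y"
    proof (cases "y \<in> U")
      case True
      then have "(U, \<phi>) \<in> charts_at M y" using U' by (simp add: charts_at_def)
      from smooth_at_compose[OF P smooth_at_chart[OF this] open_UNIV UNIV_I h(1)]
      show ?thesis
        by (rule smooth_at_cong[where W = U]) (use True cU in \<open>auto simp: \<theta>_def chart_of_def\<close>)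
    next
      case False
      have "openin (mtop M) (pts M - C)" using clC by blast
      from smooth_at_cong[OF smooth_at_const[OF y, of 0] this] show ?thesis
        using False y zero inC by auto
    qed
  next
    show "C \<subseteq> W"
    proof
      fix y assume "y \<in> C"
      then have y: "y \<in> U" "\<phi> y \<in> \<phi> ` (U \<inter> W)" using inC r(2) by auto
      then show "y \<in> W" using chart_of_inj[OF cU] by (auto dest: inj_onD)
    qed
    then show "{y \<in> U. \<phi> y \<in> ball (\<phi> x) (r / 2)} \<subseteq> W"
      using inC r(1) by (fastforce simp: subset_iff)
    show "openin (mtop M) {y \<in> U. \<phi> y \<in> ball (\<phi> x) (r / 2)}"
      by (rule chart_of_open_preimage[OF cU open_ball])
  qed (use clC zero U' r h in \<open>auto simp: \<theta>_def\<close>)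
qed

lemma smooth_at_pullback:
  fixes N :: "('n, 'd::real_inner) manifold"
  assumes "smooth_mfd N" "smooth_map M N s" "x \<in> pts M" "smooth_at N h (s x)"
  shows "smooth_at M (\<lambda>y. h (s y)) x"
proof -
  interpret N: smooth_mfd N by fact
  obtain P :: "'d set" where P: "parseval_frame P" by (rule N.model_frame)
  obtain V \<psi> where V: "(V, \<psi>) \<in> charts_at N (s x)"
    using N.charts_at_exists N.smooth_at_pts[OF assms(4)] by blast
  note V' = N.charts_atD[OF V]
  obtain S where S: "open S" "\<psi> (s x) \<in> S" "S \<subseteq> \<psi> ` V" "smooth_on S (h \<circ> inv_into V \<psi>)"
    using N.smooth_atE[OF assms(4) V] .
  obtain U \<phi> where U: "(U, \<phi>) \<in> charts_at M x" using charts_at_exists[OF assms(3)] .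
  note U' = charts_atD[OF U]
  have oV: "openin (mtop N) V" using V' by (simp add: chart_of_def)
  have "smooth_at M (\<lambda>y. \<psi> (s y)) x"
    using smooth_map_smooth_at[OF assms(2)] U' V' oV by blast
  from smooth_at_compose[OF P this S(1,2,4)]
  have "smooth_at M (\<lambda>y. (h \<circ> inv_into V \<psi>) (\<psi> (s y))) x" .
  moreover have "openin (mtop M) {y \<in> pts M. s y \<in> V}"
    using assms(2) oV by (simp add: smooth_map_def continuous_map_def)
  ultimately show ?thesis
    by (rule smooth_at_cong) (use V' assms(3) in \<open>auto simp: chart_of_inv\<close>)
qed

end


section \<open>Vector fields as derivations\<close>

context smooth_mfd
begin

lemma smooth_at_has_derivative:
  assumes "smooth_at M f x" "(U, \<phi>) \<in> charts_at M x"
  shows "((f \<circ> inv_into U \<phi>) has_derivative frechet_derivative (f \<circ> inv_into U \<phi>) (at (\<phi> x))) (at (\<phi> x))"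
  by (rule smooth_atE[OF assms]) (rule smooth_on_has_derivative)

lemma frechet_derivative_chart_change:
  assumes f: "smooth_at M f x" and U: "(U, \<phi>) \<in> charts_at M x" and V: "(V, \<psi>) \<in> charts_at M x"
  shows "frechet_derivative (f \<circ> inv_into V \<psi>) (at (\<psi> x)) =
    frechet_derivative (f \<circ> inv_into U \<phi>) (at (\<phi> x)) \<circ> frechet_derivative (\<phi> \<circ> inv_into V \<psi>) (at (\<psi> x))"
proof -
  note U' = charts_atD[OF U] and V' = charts_atD[OF V]
  let ?D = "frechet_derivative (f \<circ> inv_into U \<phi>) (at (\<phi> x))"
    and ?T = "frechet_derivative (\<phi> \<circ> inv_into V \<psi>) (at (\<psi> x))"
  have "(\<phi> \<circ> inv_into V \<psi>) (\<psi> x) = \<phi> x" using V' by (simp add: charts_at_inv[OF V])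
  then have "((f \<circ> inv_into U \<phi>) has_derivative ?D) (at ((\<phi> \<circ> inv_into V \<psi>) (\<psi> x)))"
    using smooth_at_has_derivative[OF f U] by simp
  from diff_chain_at[OF smooth_at_has_derivative[OF smooth_at_chart[OF U] V] this]
  have "((f \<circ> inv_into U \<phi>) \<circ> (\<phi> \<circ> inv_into V \<psi>) has_derivative ?D \<circ> ?T) (at (\<psi> x))" .
  moreover have "open (\<psi> ` (V \<inter> U))"
    using chart_of_open_image V' U' by (auto simp: chart_of_def)
  moreover have "\<psi> x \<in> \<psi> ` (V \<inter> U)" using U' V' by blast
  moreover have "((f \<circ> inv_into U \<phi>) \<circ> (\<phi> \<circ> inv_into V \<psi>)) z = (f \<circ> inv_into V \<psi>) z" if "z \<in> \<psi> ` (V \<inter> U)" for z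
    using that U' V' by (auto simp: chart_of_inv)
  ultimately have "(f \<circ> inv_into V \<psi> has_derivative ?D \<circ> ?T) (at (\<psi> x))"
    by (rule has_derivative_transform_within_open)
  then show ?thesis by (rule frechet_derivative_at[symmetric])
qed

lemma tangent_space_chart_change:
  assumes "v \<in> vcar (tangent_space M x)" "(U, \<phi>) \<in> charts_at M x" "(V, \<psi>) \<in> charts_at M x"
  shows "snd v (V, \<psi>) = frechet_derivative (\<psi> \<circ> inv_into U \<phi>) (at (\<phi> x)) (snd v (U, \<phi>))"
  using assms unfolding tangent_space_def by fastforce

text \<open>This removes the arbitrary chart from \<open>differential\<close>: the chain rule for
  \<open>f\<close> and the transformation law of \<open>v\<close> involve the same transition
  derivative.\<close>

lemma differential_chart:
  assumes f: "smooth_at M f x" and v: "v \<in> vcar (tangent_space M x)" and U: "(U, \<phi>) \<in> charts_at M x"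
  shows "differential M f v = frechet_derivative (f \<circ> inv_into U \<phi>) (at (\<phi> x)) (snd v (U, \<phi>))"
proof -
  have x: "fst v = x" using v by (auto simp: tangent_space_def)
  define c where "c = (SOME c. c \<in> charts_at M x)"
  have "c \<in> charts_at M x" unfolding c_def using U by (rule someI)
  then obtain V \<psi> where c: "c = (V, \<psi>)" and V: "(V, \<psi>) \<in> charts_at M x" by (cases c) auto
  have "differential M f v = frechet_derivative (f \<circ> inv_into V \<psi>) (at (\<psi> x)) (snd v (V, \<psi>))"
    by (simp add: differential_def x c_def[symmetric] c)
  also have "\<dots> = frechet_derivative (f \<circ> inv_into U \<phi>) (at (\<phi> x)) (snd v (U, \<phi>))"
    by (simp add: frechet_derivative_chart_change[OF f U V] tangent_space_chart_change[OF v V U])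
  finally show ?thesis .
qed

end

text \<open>What the calculations use of a vector field, stated in components;
  \<open>smooth_vector_field_section\<close> derives it for sections of the tangent bundle.\<close>

locale smooth_vector_field = smooth_mfd M for M :: "('m, 'e::real_inner) manifold" +
  fixes X :: "'m \<Rightarrow> ('m, 'e) tangent"
  assumes X_tangent: "x \<in> pts M \<Longrightarrow> X x \<in> vcar (tangent_space M x)"
    and X_smooth: "c \<in> charts_at M x \<Longrightarrow> smooth_at M (\<lambda>y. snd (X y) c) x"
begin

lemma contract_d_chart:
  assumes "smooth_at M f x" "(U, \<phi>) \<in> charts_at M x"
  shows "contract_d M X f x = frechet_derivative (f \<circ> inv_into U \<phi>) (at (\<phi> x)) (snd (X x) (U, \<phi>))"
  unfolding contract_d_def
  by (rule differential_chart[OF assms(1) X_tangent[OF smooth_at_pts[OF assms(1)]] assms(2)])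

lemma contract_d_eqI:
  assumes "smooth_at M f x" "(U, \<phi>) \<in> charts_at M x" "((f \<circ> inv_into U \<phi>) has_derivative D) (at (\<phi> x))"
  shows "contract_d M X f x = D (snd (X x) (U, \<phi>))"
  using contract_d_chart[OF assms(1,2)] frechet_derivative_at[OF assms(3)] by simp

lemma contract_d_cong:
  assumes f: "smooth_at M f x" and W: "openin (mtop M) W" "x \<in> W" "\<And>y. y \<in> W \<Longrightarrow> f y = g y"
  shows "contract_d M X f x = contract_d M X g x"
proof -
  obtain U \<phi> where U: "(U, \<phi>) \<in> charts_at M x"
    using charts_at_exists smooth_at_pts[OF f] by blast
  note U' = charts_atD[OF U]
  have op: "open (\<phi> ` (U \<inter> W))" using chart_of_open_image U' W(1) by blast
  have "((g \<circ> inv_into U \<phi>) has_derivative frechet_derivative (f \<circ> inv_into U \<phi>) (at (\<phi> x))) (at (\<phi> x))"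
    by (rule has_derivative_transform_within_open[OF smooth_at_has_derivative[OF f U] op])
      (use U' W in \<open>auto simp: chart_of_inv\<close>)
  from contract_d_eqI[OF smooth_at_cong[OF f W] U this] contract_d_chart[OF f U] show ?thesis by simp
qed

lemma contract_d_const:
  assumes "x \<in> pts M"
  shows "contract_d M X (\<lambda>y. c) x = 0"
proof -
  obtain U \<phi> where U: "(U, \<phi>) \<in> charts_at M x" using charts_at_exists[OF assms] .
  show ?thesis
    by (rule contract_d_eqI[OF smooth_at_const[OF assms] U, where D = "\<lambda>_. 0"]) (simp add: comp_def)
qed

lemma contract_d_add:
  assumes f: "smooth_at M f x" and g: "smooth_at M g x"
  shows "contract_d M X (\<lambda>y. f y + g y) x = contract_d M X f x + contract_d M X g x"
proof -
  obtain U \<phi> where U: "(U, \<phi>) \<in> charts_at M x"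
    using charts_at_exists smooth_at_pts[OF f] by blast
  have "((\<lambda>y. f y + g y) \<circ> inv_into U \<phi> has_derivative
     (\<lambda>v. frechet_derivative (f \<circ> inv_into U \<phi>) (at (\<phi> x)) v + frechet_derivative (g \<circ> inv_into U \<phi>) (at (\<phi> x)) v))
     (at (\<phi> x))"
    using has_derivative_add[OF smooth_at_has_derivative[OF f U] smooth_at_has_derivative[OF g U]]
    by (simp add: comp_def)
  from contract_d_eqI[OF smooth_at_add[OF f g] U this] show ?thesis
    by (simp add: contract_d_chart[OF f U] contract_d_chart[OF g U])
qed

lemma contract_d_mult:
  assumes f: "smooth_at M f x" and g: "smooth_at M g x"
  shows "contract_d M X (\<lambda>y. f y * g y) x = f x * contract_d M X g x + contract_d M X f x * g x"
proof -
  obtain U \<phi> where U: "(U, \<phi>) \<in> charts_at M x"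
    using charts_at_exists smooth_at_pts[OF f] by blast
  have x: "inv_into U \<phi> (\<phi> x) = x" using charts_atD[OF U] by (simp add: charts_at_inv[OF U])
  have "((\<lambda>y. f y * g y) \<circ> inv_into U \<phi> has_derivative
     (\<lambda>v. f x * frechet_derivative (g \<circ> inv_into U \<phi>) (at (\<phi> x)) v +
          frechet_derivative (f \<circ> inv_into U \<phi>) (at (\<phi> x)) v * g x))
     (at (\<phi> x))"
    using has_derivative_mult[OF smooth_at_has_derivative[OF f U] smooth_at_has_derivative[OF g U]]
    by (simp add: comp_def x)
  from contract_d_eqI[OF smooth_at_mult[OF f g] U this] show ?thesis
    by (simp add: contract_d_chart[OF f U] contract_d_chart[OF g U])
qed

text \<open>In a chart this is the derivative of \<open>f\<close> in the varying direction
  \<open>X\<close>. Expanded in the frame it becomes a sum of components of \<open>X\<close> times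
  derivatives in fixed directions, all of them smooth.\<close>

lemma contract_d_smooth:
  assumes f: "smooth_at M f x"
  shows "smooth_at M (contract_d M X f) x"
proof -
  obtain P :: "'e set" where P: "parseval_frame P" by (rule model_frame)
  have x: "x \<in> pts M" by (rule smooth_at_pts[OF f])
  obtain U \<phi> where U: "(U, \<phi>) \<in> charts_at M x" using charts_at_exists[OF x] .
  note U' = charts_atD[OF U]
  then have cU: "chart_of M U \<phi>" by blast
  obtain S where S: "open S" "\<phi> x \<in> S" "S \<subseteq> \<phi> ` U" "smooth_on S (f \<circ> inv_into U \<phi>)"
    using smooth_atE[OF f U] .
  let ?D = "\<lambda>z. frechet_derivative (f \<circ> inv_into U \<phi>) (at z)"
  have "smooth_at M (\<lambda>y. ?D (\<phi> y) b) x" for b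
    by (rule smooth_at_compose[OF P smooth_at_chart[OF U] S(1,2) smooth_on_frechet_derivative[OF S(4)]])
  then have "smooth_at M (\<lambda>y. \<Sum>b\<in>P. (snd (X y) (U, \<phi>) \<bullet> b) *\<^sub>R ?D (\<phi> y) b) x"
    by (intro smooth_at_sum[OF x] smooth_at_scaleR smooth_at_inner_left X_smooth[OF U])
  then show ?thesis
  proof (rule smooth_at_cong)
    show "openin (mtop M) {y \<in> U. \<phi> y \<in> S}" by (rule chart_of_open_preimage[OF cU S(1)])
    show "x \<in> {y \<in> U. \<phi> y \<in> S}" using U' S by auto
    fix y assume y: "y \<in> {y \<in> U. \<phi> y \<in> S}"
    have Uy: "(U, \<phi>) \<in> charts_at M y" using y U' by (simp add: charts_at_def)
    have fy: "smooth_at M f y" using y U' S by (intro smooth_atI[of U \<phi> M y S]) auto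
    have lin: "linear (?D (\<phi> y))"
      by (rule has_derivative_linear[OF smooth_at_has_derivative[OF fy Uy]])
    have "contract_d M X f y = ?D (\<phi> y) (\<Sum>b\<in>P. (snd (X y) (U, \<phi>) \<bullet> b) *\<^sub>R b)"
      by (simp only: contract_d_chart[OF fy Uy] parseval_frame_sum[OF P])
    also have "\<dots> = (\<Sum>b\<in>P. (snd (X y) (U, \<phi>) \<bullet> b) *\<^sub>R ?D (\<phi> y) b)"
      by (simp only: linear_sum[OF lin] linear_scale[OF lin])
    finally show "(\<Sum>b\<in>P. (snd (X y) (U, \<phi>) \<bullet> b) *\<^sub>R ?D (\<phi> y) b) = contract_d M X f y" by simp
  qed
qed

text \<open>The equation is solved in one chart. \<open>integral_curve\<close> demands the velocity
  in every chart around each point of the curve; the transition law of tangent vectors supplies the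
  others.\<close>

lemma integral_curve_exists:
  assumes x: "x \<in> pts M"
  obtains \<epsilon> \<gamma> where "0 < \<epsilon>" "\<gamma> 0 = x" "integral_curve M X \<epsilon> \<gamma>"
proof -
  obtain P :: "'e set" where P: "parseval_frame P" by (rule model_frame)
  obtain U \<phi> where U: "(U, \<phi>) \<in> charts_at M x" using charts_at_exists[OF x] .
  note U' = charts_atD[OF U]
  then have cU: "chart_of M U \<phi>" by blast
  define F where "F z = snd (X (inv_into U \<phi> z)) (U, \<phi>)" for z
  obtain S where S: "open S" "\<phi> x \<in> S" "S \<subseteq> \<phi> ` U" "smooth_on S F"
    using smooth_atE[OF X_smooth[OF U] U] unfolding F_def comp_def .
  obtain e c where e: "0 < e" and c0: "c 0 = \<phi> x" and
    c: "\<And>t. t \<in> {-e<..<e} \<Longrightarrow> c t \<in> S \<and> (c has_vector_derivative F (c t)) (at t)"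
    using integral_curve_exists_parseval[OF P S(1,2,4)] by metis
  define \<gamma> where "\<gamma> t = inv_into U \<phi> (c t)" for t
  show thesis
  proof (rule that[OF e])
    show "\<gamma> 0 = x" unfolding \<gamma>_def c0 using U' by (simp add: charts_at_inv[OF U])
    show "integral_curve M X e \<gamma>"
      unfolding integral_curve_def
    proof (intro conjI ballI, goal_cases)
      case 1
      have "isCont c t" if "t \<in> {-e<..<e}" for t
        using c[OF that] has_vector_derivative_continuous by blast
      then have "continuous_on {-e<..<e} c" by (intro continuous_at_imp_continuous_on) blast
      then have "continuous_map (top_of_set {-e<..<e}) (top_of_set (\<phi> ` U)) c"
        using c S(3) by (auto simp: continuous_map_in_subtopology)
      from continuous_map_compose[OF this chart_of_inv_continuous[OF cU]]
      show "continuous_map (top_of_set {-e<..<e}) (mtop M) \<gamma>"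
        by (simp add: \<gamma>_def[abs_def] comp_def)
    next
      case (2 t d)
      then have t: "t \<in> {-e<..<e}" by blast
      obtain V \<psi> where d: "d = (V, \<psi>)" and V: "(V, \<psi>) \<in> charts_at M (\<gamma> t)"
        using 2 by (cases d) auto
      have ct: "c t \<in> \<phi> ` U" using c[OF t] S(3) by blast
      then have \<gamma>: "\<phi> (\<gamma> t) = c t" "\<gamma> t \<in> U"
        unfolding \<gamma>_def by (auto simp: f_inv_into_f inv_into_into)
      then have U\<gamma>: "(U, \<phi>) \<in> charts_at M (\<gamma> t)" using U' by (simp add: charts_at_def)
      have "(\<psi> \<circ> inv_into U \<phi> has_derivative frechet_derivative (\<psi> \<circ> inv_into U \<phi>) (at (c t))) (at (c t))"
        using smooth_at_has_derivative[OF smooth_at_chart[OF V] U\<gamma>] \<gamma>(1) by simp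
      then have "(\<psi> \<circ> inv_into U \<phi> has_derivative frechet_derivative (\<psi> \<circ> inv_into U \<phi>) (at (c t)))
          (at (c t) within c ` UNIV)" by (rule has_derivative_at_withinI)
      from vector_derivative_diff_chain_within[OF c[OF t, THEN conjunct2] this]
      have "((\<psi> \<circ> inv_into U \<phi>) \<circ> c has_vector_derivative
          frechet_derivative (\<psi> \<circ> inv_into U \<phi>) (at (c t)) (F (c t))) (at t)" .
      also have "(\<psi> \<circ> inv_into U \<phi>) \<circ> c = \<psi> \<circ> \<gamma>" by (simp add: fun_eq_iff \<gamma>_def)
      also have "frechet_derivative (\<psi> \<circ> inv_into U \<phi>) (at (c t)) (F (c t)) = snd (X (\<gamma> t)) (V, \<psi>)"
        using tangent_space_chart_change[OF X_tangent U\<gamma> V] charts_at_pts[OF V] \<gamma>(1)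
        by (simp add: F_def \<gamma>_def)
      finally show ?case by (simp only: d prod.case)
    qed
  qed
qed

text \<open>The derivative does not depend on the curve, which makes the definite description in
  \<open>lie_derivative_fun\<close> unambiguous; \<open>integral_curve_exists\<close> makes it
  denote.\<close>

lemma integral_curve_derivative:
  assumes f: "smooth_at M f x" and e: "0 < e" and \<gamma>: "\<gamma> 0 = x" "integral_curve M X e \<gamma>"
  shows "((f \<circ> \<gamma>) has_real_derivative contract_d M X f x) (at 0)"
proof -
  obtain U \<phi> where U: "(U, \<phi>) \<in> charts_at M x"
    using charts_at_exists smooth_at_pts[OF f] by blast
  note U' = charts_atD[OF U]
  let ?D = "frechet_derivative (f \<circ> inv_into U \<phi>) (at (\<phi> x))"
  have 0: "0 \<in> {-e<..<e}" using e by simp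
  have vd: "((\<phi> \<circ> \<gamma>) has_vector_derivative snd (X x) (U, \<phi>)) (at 0)"
    using \<gamma> 0 U unfolding integral_curve_def by fastforce
  have "(f \<circ> inv_into U \<phi> has_derivative ?D) (at ((\<phi> \<circ> \<gamma>) 0) within (\<phi> \<circ> \<gamma>) ` UNIV)"
    using smooth_at_has_derivative[OF f U] \<gamma>(1) by (simp add: has_derivative_at_withinI)
  from vector_derivative_diff_chain_within[OF vd this]
  have "((f \<circ> inv_into U \<phi>) \<circ> (\<phi> \<circ> \<gamma>) has_vector_derivative ?D (snd (X x) (U, \<phi>))) (at 0)" .
  \<comment> \<open>Only while the curve stays in \<open>U\<close> is
    \<open>f \<circ> \<gamma>\<close> the composition of the two chart expressions; by continuity
    these times form an open set.\<close>
  moreover have "open {t \<in> {-e<..<e}. \<gamma> t \<in> U}"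
  proof -
    have "openin (top_of_set {-e<..<e}) {t \<in> topspace (top_of_set {-e<..<e}). \<gamma> t \<in> U}"
      using \<gamma>(2) U' by (intro openin_continuous_map_preimage) (auto simp: integral_curve_def chart_of_def)
    then show ?thesis by (simp add: openin_open_eq)
  qed
  moreover have "0 \<in> {t \<in> {-e<..<e}. \<gamma> t \<in> U}" using 0 \<gamma>(1) U' by simp
  moreover have "((f \<circ> inv_into U \<phi>) \<circ> (\<phi> \<circ> \<gamma>)) t = (f \<circ> \<gamma>) t" if "t \<in> {t \<in> {-e<..<e}. \<gamma> t \<in> U}" for t
    using that by (simp add: charts_at_inv[OF U])
  ultimately have "((f \<circ> \<gamma>) has_vector_derivative ?D (snd (X x) (U, \<phi>))) (at 0)"
    by (rule has_vector_derivative_transform_within_open)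
  then show ?thesis
    by (simp add: contract_d_chart[OF f U] has_real_derivative_iff_has_vector_derivative)
qed

lemma lie_derivative_fun_eq:
  assumes "smooth_at M f x"
  shows "lie_derivative_fun M X f x = contract_d M X f x"
  unfolding lie_derivative_fun_def
proof (rule the_equality)
  obtain e \<gamma> where "0 < e" "\<gamma> 0 = x" "integral_curve M X e \<gamma>"
    using integral_curve_exists[OF smooth_at_pts[OF assms]] .
  then show "\<exists>e \<gamma>. 0 < e \<and> \<gamma> 0 = x \<and> integral_curve M X e \<gamma> \<and>
      ((f \<circ> \<gamma>) has_real_derivative contract_d M X f x) (at 0)"
    using integral_curve_derivative[OF assms] by blast
next
  fix d assume "\<exists>e \<gamma>. 0 < e \<and> \<gamma> 0 = x \<and> integral_curve M X e \<gamma> \<and> ((f \<circ> \<gamma>) has_real_derivative d) (at 0)"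
  then show "d = contract_d M X f x"
    using integral_curve_derivative[OF assms] DERIV_unique by blast
qed

end

text \<open>A point of the tangent manifold lies in some tangent space, and its first component
  tells in which one. Smoothness of the components is that of the second half of the tangent
  chart.\<close>

lemma smooth_vector_field_section:
  fixes M :: "('m, 'e::real_inner) manifold"
  assumes "smooth_manifold M" "X \<in> sections (tangent_bundle M)"
  shows "smooth_vector_field M X"
proof -
  interpret smooth_mfd M by unfold_locales fact
  have sm: "smooth_map M (tangent_manifold M) X" and pr: "\<And>x. x \<in> pts M \<Longrightarrow> fst (X x) = x"
    using assms(2) by (auto simp: section_space_def tangent_bundle_def)
  have tan: "X x \<in> vcar (tangent_space M x)" if x: "x \<in> pts M" for x
  proof -
    have "X x \<in> pts (tangent_manifold M)"
      using sm x by (auto simp: smooth_map_def continuous_map_def)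
    then obtain y where y: "X x \<in> vcar (tangent_space M y)"
      by (auto simp: tangent_manifold_def topology_generated_by_topspace tangent_over_def)
    then have "fst (X x) = y" by (auto simp: tangent_space_def)
    then show ?thesis using y pr[OF x] by simp
  qed
  show ?thesis
  proof
    fix c x assume c: "c \<in> charts_at M x"
    obtain U \<phi> where cU: "c = (U, \<phi>)" by (cases c)
    note U = c[unfolded cU]
    note U' = charts_atD[OF U]
    \<comment> \<open>The generating sets of the topology with \<open>O'\<close> equal to
      \<open>UNIV\<close> are the parts of the bundle over the chart domains.\<close>
    have "openin (mtop (tangent_manifold M)) {v \<in> tangent_over M (fst c). tangent_chart c v \<in> UNIV}"
      using U' unfolding tangent_manifold_def cU
      by (auto intro!: topology_generated_by_Basis simp del: UNIV_I)
    then have op: "openin (mtop (tangent_manifold M)) (tangent_over M U)" by (simp add: cU)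
    have mem: "X x \<in> tangent_over M U"
      using tan[OF charts_at_pts[OF U]] U' by (auto simp: tangent_over_def)
    have ch: "(tangent_over M U, tangent_chart c) \<in> charts (tangent_manifold M)"
      using U' by (force simp: tangent_manifold_def cU)
    have "smooth_at M (\<lambda>y. tangent_chart c (X y)) x"
      using smooth_map_smooth_at[OF sm _ _ _ ch op mem] U' by blast
    from smooth_at_linear_image[OF bounded_linear_snd this]
    show "smooth_at M (\<lambda>y. snd (X y) c) x" by (simp add: tangent_chart_def)
  qed (rule tan)
qed


section \<open>Sections of vector bundles\<close>

lemma (in smooth_mfd) smooth_mapI:
  assumes "\<And>x. x \<in> pts M \<Longrightarrow> topcontinuous_at (mtop M) (mtop N) f x"
    and "\<And>x V \<psi>. x \<in> pts M \<Longrightarrow> (V, \<psi>) \<in> charts N \<Longrightarrow> f x \<in> V \<Longrightarrow> smooth_at M (\<lambda>y. \<psi> (f y)) x"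
  shows "smooth_map M N f"
proof -
  have "smooth_on (\<phi> ` (U \<inter> f -` V)) (\<psi> \<circ> f \<circ> inv_into U \<phi>)"
    if U: "(U, \<phi>) \<in> charts M" and V: "(V, \<psi>) \<in> charts N" for U \<phi> V \<psi>
  proof (rule smooth_on_local)
    fix z assume "z \<in> \<phi> ` (U \<inter> f -` V)"
    then obtain y where y: "y \<in> U" "f y \<in> V" "z = \<phi> y" by blast
    then have Uy: "(U, \<phi>) \<in> charts_at M y" using U by (simp add: charts_at_def)
    have "smooth_at M (\<lambda>y. \<psi> (f y)) y"
      by (rule assms(2)[OF charts_at_pts[OF Uy] V y(2)])
    from smooth_atE[OF this Uy]
    show "\<exists>T. open T \<and> z \<in> T \<and> smooth_on T (\<psi> \<circ> f \<circ> inv_into U \<phi>)"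
      unfolding comp_def y(3) by metis
  qed
  moreover have "continuous_map (mtop M) (mtop N) f"
    using assms(1) by (simp add: continuous_map_eq_topcontinuous_at)
  ultimately show ?thesis by (auto simp: smooth_map_def)
qed

lemma chart_of_prod:
  fixes M :: "('m, 'c::real_inner) manifold" and N :: "('n, 'd::real_inner) manifold"
  assumes U: "chart_of M U \<phi>" and V: "chart_of N V \<psi>"
  shows "chart_of (prod_manifold M N) (U \<times> V) (map_prod \<phi> \<psi>)"
proof -
  have prod_euclid: "prod_topology euclidean euclidean = (euclidean :: ('c \<times> 'd) topology)"
    by simp
  have img: "map_prod \<phi> \<psi> ` (U \<times> V) = \<phi> ` U \<times> \<psi> ` V" by (rule map_prod_surj_on) auto
  obtain g h where g: "homeomorphic_maps (subtopology (mtop M) U) (top_of_set (\<phi> ` U)) \<phi> g"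
    and h: "homeomorphic_maps (subtopology (mtop N) V) (top_of_set (\<psi> ` V)) \<psi> h"
    using U V unfolding chart_of_def homeomorphic_map_maps by metis
  have "homeomorphic_maps (prod_topology (subtopology (mtop M) U) (subtopology (mtop N) V))
      (prod_topology (top_of_set (\<phi> ` U)) (top_of_set (\<psi> ` V)))
      (\<lambda>(x, y). (\<phi> x, \<psi> y)) (\<lambda>(x, y). (g x, h y))"
    using g h by (simp only: homeomorphic_maps_prod simp_thms)
  then have "homeomorphic_map (subtopology (prod_topology (mtop M) (mtop N)) (U \<times> V))
      (top_of_set (\<phi> ` U \<times> \<psi> ` V)) (\<lambda>(x, y). (\<phi> x, \<psi> y))"
    unfolding subtopology_Times[symmetric] prod_euclid homeomorphic_map_maps by blast
  moreover have "(\<lambda>(x, y). (\<phi> x, \<psi> y)) = map_prod \<phi> \<psi>" by auto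
  ultimately show ?thesis
    using U V by (simp add: chart_of_def prod_manifold_def img openin_prod_Times_iff open_Times)
qed

lemma chart_of_euclidean: "chart_of euclidean_manifold UNIV (id :: 'a::real_inner \<Rightarrow> 'a)"
  using homeomorphic_map_id[of "euclidean :: 'a topology" euclidean]
  by (simp add: chart_of_def euclidean_manifold_def)

section \<open>Fibres and local trivialisations\<close>

locale smooth_bundle =
  fixes B :: "('m, 'v, 'e::real_inner, 'f::real_inner, 'g::real_inner) vbundle"
  assumes vb: "vector_bundle B"
begin

sublocale smooth_mfd "base B"
  by unfold_locales (use vb in \<open>simp add: vector_bundle_def\<close>)

sublocale T: smooth_mfd "total B"
  by unfold_locales (use vb in \<open>simp add: vector_bundle_def\<close>)

abbreviation base_pts where "base_pts \<equiv> pts (base B)"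
abbreviation lift :: "('v \<Rightarrow> 'f) \<Rightarrow> 'm \<Rightarrow> 'f \<Rightarrow> 'v" where
  "lift \<Phi> x \<equiv> inv_into (vcar (fib B x)) \<Phi>"

lemma fibre_frame:
  obtains P :: "'f set" where "parseval_frame P"
proof -
  have "\<exists>S::'f set. finite S \<and> span S = UNIV"
    using vb unfolding vector_bundle_def by (elim conjE)
  then show thesis by (rule parseval_frame_exists) (rule that)
qed

lemma fib_vs: "x \<in> base_pts \<Longrightarrow> real_vs (fib B x)"
  using vb by (simp add: vector_bundle_def)

lemma fib_car: "x \<in> base_pts \<Longrightarrow> vcar (fib B x) = {a \<in> pts (total B). proj B a = x}"
  using vb by (simp add: vector_bundle_def)

lemma fib_vadd: "x \<in> base_pts \<Longrightarrow> u \<in> vcar (fib B x) \<Longrightarrow> v \<in> vcar (fib B x) \<Longrightarrow> vadd (fib B x) u v \<in> vcar (fib B x)"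
  using fib_vs by (simp add: real_vs_def)

lemma fib_vscale: "x \<in> base_pts \<Longrightarrow> u \<in> vcar (fib B x) \<Longrightarrow> vscale (fib B x) a u \<in> vcar (fib B x)"
  using fib_vs by (simp add: real_vs_def)

lemma fib_vzero: "x \<in> base_pts \<Longrightarrow> vzero (fib B x) \<in> vcar (fib B x)"
  using fib_vs by (simp add: real_vs_def)

lemma trivs_local: "(U, \<Phi>) \<in> trivs B \<Longrightarrow> local_trivialisation B U \<Phi>"
proof -
  have "\<forall>(U, \<Phi>)\<in>trivs B. local_trivialisation B U \<Phi>"
    using vb unfolding vector_bundle_def by (elim conjE)
  then show "(U, \<Phi>) \<in> trivs B \<Longrightarrow> local_trivialisation B U \<Phi>" by blast
qed

lemma trivs_open: "(U, \<Phi>) \<in> trivs B \<Longrightarrow> openin (mtop (base B)) U"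
  using trivs_local by (simp add: local_trivialisation_def)

lemma trivs_pts: "(U, \<Phi>) \<in> trivs B \<Longrightarrow> x \<in> U \<Longrightarrow> x \<in> base_pts"
  using trivs_open openin_subset by blast

lemma trivs_exists:
  assumes "x \<in> base_pts"
  obtains U \<Phi> where "(U, \<Phi>) \<in> trivs B" "x \<in> U"
proof -
  have "x \<in> (\<Union>(U, \<Phi>)\<in>trivs B. U)" using vb assms by (simp add: vector_bundle_def)
  then show thesis using that by auto
qed

lemma triv_add:
  assumes "(U, \<Phi>) \<in> trivs B" "x \<in> U" "u \<in> vcar (fib B x)" "v \<in> vcar (fib B x)"
  shows "\<Phi> (vadd (fib B x) u v) = \<Phi> u + \<Phi> v"
  using trivs_local[OF assms(1)] assms
  by (simp add: local_trivialisation_def vs_linear_def vs_of_type_def)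

lemma triv_scale:
  assumes "(U, \<Phi>) \<in> trivs B" "x \<in> U" "u \<in> vcar (fib B x)"
  shows "\<Phi> (vscale (fib B x) a u) = a *\<^sub>R \<Phi> u"
  using trivs_local[OF assms(1)] assms
  by (simp add: local_trivialisation_def vs_linear_def vs_of_type_def)

lemma triv_zero:
  assumes "(U, \<Phi>) \<in> trivs B" "x \<in> U"
  shows "\<Phi> (vzero (fib B x)) = 0"
proof -
  have x: "x \<in> base_pts" using trivs_pts assms by blast
  then have "vadd (fib B x) (vzero (fib B x)) (vzero (fib B x)) = vzero (fib B x)"
    using fib_vs by (simp add: real_vs_def)
  then show ?thesis using triv_add[OF assms fib_vzero[OF x] fib_vzero[OF x]] by simp
qed

lemma proj_open:
  assumes "(U, \<Phi>) \<in> trivs B"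
  shows "openin (mtop (total B)) {a \<in> pts (total B). proj B a \<in> U}"
proof -
  have "continuous_map (mtop (total B)) (mtop (base B)) (proj B)"
    using vb by (simp add: vector_bundle_def smooth_map_def)
  then show ?thesis using trivs_open[OF assms] by (simp add: continuous_map_def)
qed

lemma pts_total_part:
  "pts (open_submanifold (total B) {a \<in> pts (total B). proj B a \<in> U}) = {a \<in> pts (total B). proj B a \<in> U}"
  by (auto simp: open_submanifold_def)

lemma pts_prod_part:
  assumes "(U, \<Phi>) \<in> trivs B"
  shows "pts (prod_manifold (open_submanifold (base B) U) (euclidean_manifold :: ('f, 'f) manifold)) = U \<times> UNIV"
  using trivs_open[OF assms, THEN openin_subset]
  by (auto simp: open_submanifold_def prod_manifold_def euclidean_manifold_def)

lemma triv_total_bij: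
  assumes "(U, \<Phi>) \<in> trivs B"
  shows "bij_betw (\<lambda>a. (proj B a, \<Phi> a)) {a \<in> pts (total B). proj B a \<in> U} (U \<times> UNIV)"
  using trivs_local[OF assms] unfolding local_trivialisation_def diffeomorphism_def
    pts_total_part pts_prod_part[OF assms] by blast

lemma triv_bij:
  assumes "(U, \<Phi>) \<in> trivs B" "x \<in> U"
  shows "bij_betw \<Phi> (vcar (fib B x)) UNIV"
proof -
  have x: "x \<in> base_pts" using trivs_pts assms by blast
  note bij = triv_total_bij[OF assms(1)]
  have "inj_on \<Phi> (vcar (fib B x))"
  proof (rule inj_onI)
    fix u v assume uv: "u \<in> vcar (fib B x)" "v \<in> vcar (fib B x)" "\<Phi> u = \<Phi> v"
    have "u \<in> {a \<in> pts (total B). proj B a \<in> U}" "v \<in> {a \<in> pts (total B). proj B a \<in> U}"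
      "(proj B u, \<Phi> u) = (proj B v, \<Phi> v)"
      using uv assms(2) by (auto simp: fib_car[OF x])
    then show "u = v" using bij_betw_imp_inj_on[OF bij] by (metis (mono_tags, lifting) inj_onD)
  qed
  moreover have "\<exists>u\<in>vcar (fib B x). \<Phi> u = w" for w
  proof -
    have "(x, w) \<in> (\<lambda>a. (proj B a, \<Phi> a)) ` {a \<in> pts (total B). proj B a \<in> U}"
      unfolding bij_betw_imp_surj_on[OF bij] using assms(2) by simp
    then show ?thesis by (auto simp: fib_car[OF x])
  qed
  ultimately show ?thesis by (auto simp: bij_betw_def image_iff) (metis)
qed

lemma lift_in: "(U, \<Phi>) \<in> trivs B \<Longrightarrow> x \<in> U \<Longrightarrow> lift \<Phi> x w \<in> vcar (fib B x)"
  using bij_betw_imp_surj_on[OF triv_bij] by (metis UNIV_I inv_into_into)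

lemma triv_lift: "(U, \<Phi>) \<in> trivs B \<Longrightarrow> x \<in> U \<Longrightarrow> \<Phi> (lift \<Phi> x w) = w"
  using bij_betw_inv_into_right[OF triv_bij] by blast

lemma lift_triv: "(U, \<Phi>) \<in> trivs B \<Longrightarrow> x \<in> U \<Longrightarrow> v \<in> vcar (fib B x) \<Longrightarrow> lift \<Phi> x (\<Phi> v) = v"
  using bij_betw_inv_into_left[OF triv_bij] by blast

lemma fibre_eqI:
  "(U, \<Phi>) \<in> trivs B \<Longrightarrow> x \<in> U \<Longrightarrow> u \<in> vcar (fib B x) \<Longrightarrow> v \<in> vcar (fib B x) \<Longrightarrow> \<Phi> u = \<Phi> v \<Longrightarrow> u = v"
  using lift_triv by metis

lemma lift_add:
  assumes "(U, \<Phi>) \<in> trivs B" "x \<in> U"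
  shows "lift \<Phi> x (v + w) = vadd (fib B x) (lift \<Phi> x v) (lift \<Phi> x w)"
  by (rule fibre_eqI[OF assms])
    (simp_all add: lift_in[OF assms] fib_vadd[OF trivs_pts[OF assms]] triv_add[OF assms] triv_lift[OF assms])

lemma lift_scale:
  assumes "(U, \<Phi>) \<in> trivs B" "x \<in> U"
  shows "lift \<Phi> x (a *\<^sub>R w) = vscale (fib B x) a (lift \<Phi> x w)"
  by (rule fibre_eqI[OF assms])
    (simp_all add: lift_in[OF assms] fib_vscale[OF trivs_pts[OF assms]] triv_scale[OF assms] triv_lift[OF assms])

lemma vscale_0:
  assumes "x \<in> base_pts" "u \<in> vcar (fib B x)"
  shows "vscale (fib B x) 0 u = vzero (fib B x)"
proof -
  obtain U \<Phi> where U: "(U, \<Phi>) \<in> trivs B" "x \<in> U" using trivs_exists[OF assms(1)] .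
  show ?thesis
    by (rule fibre_eqI[OF U]) (simp_all add: assms fib_vscale fib_vzero triv_scale[OF U] triv_zero[OF U])
qed

text \<open>In a product chart \<open>map_prod \<phi> id\<close> the trivialisation has
  \<open>\<Phi>\<close> itself as its second component.\<close>

lemma triv_smooth_total:
  assumes "(U, \<Phi>) \<in> trivs B" "a \<in> pts (total B)" "proj B a \<in> U"
  shows "smooth_at (total B) \<Phi> a"
proof -
  let ?A = "{a \<in> pts (total B). proj B a \<in> U}"
  let ?R = "prod_manifold (open_submanifold (base B) U) (euclidean_manifold :: ('f, 'f) manifold)"
  have sm: "smooth_map (open_submanifold (total B) ?A) ?R (\<lambda>a. (proj B a, \<Phi> a))"
    using trivs_local[OF assms(1)] by (simp add: local_trivialisation_def diffeomorphism_def)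
  have aA: "a \<in> ?A" using assms by simp
  obtain V \<psi> where V: "(V, \<psi>) \<in> charts_at (total B) a" using T.charts_at_exists[OF assms(2)] .
  obtain W \<phi> where W: "(W, \<phi>) \<in> charts_at (base B) (proj B a)"
    using charts_at_exists[OF trivs_pts[OF assms(1,3)]] .
  note V' = T.charts_atD[OF V] and W' = charts_atD[OF W]
  have c: "(V \<inter> ?A, \<psi>) \<in> charts (open_submanifold (total B) ?A)"
    using V' by (auto simp: open_submanifold_def)
  have cc: "chart_of (open_submanifold (total B) ?A) (V \<inter> ?A) \<psi>"
    using V' chart_of_open_submanifold proj_open[OF assms(1)] by blast
  have d: "((W \<inter> U) \<times> UNIV, map_prod \<phi> id) \<in> charts ?R"
    using W' by (force simp: open_submanifold_def prod_manifold_def euclidean_manifold_def)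
  have "chart_of ?R ((W \<inter> U) \<times> UNIV) (map_prod \<phi> id)"
    using chart_of_prod chart_of_open_submanifold W' trivs_open[OF assms(1)] chart_of_euclidean by blast
  then have o: "openin (mtop ?R) ((W \<inter> U) \<times> UNIV)" by (simp add: chart_of_def)
  have "smooth_at (open_submanifold (total B) ?A) (\<lambda>y. map_prod \<phi> id (proj B y, \<Phi> y)) a"
    using V' W' assms by (intro smooth_map_smooth_at[OF sm c _ cc d o]) auto
  then have "smooth_at (total B) (\<lambda>y. map_prod \<phi> id (proj B y, \<Phi> y)) a"
    using T.smooth_at_open_submanifold[OF proj_open[OF assms(1)] aA] by blast
  from T.smooth_at_linear_image[OF bounded_linear_snd this] show ?thesis by simp
qed

section \<open>Sections in trivialisations\<close>

lemma section_fibre: "s \<in> sections B \<Longrightarrow> x \<in> base_pts \<Longrightarrow> s x \<in> vcar (fib B x)"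
  by (auto simp: fib_car section_space_def smooth_map_def continuous_map_def)

lemma section_extensional: "s \<in> sections B \<Longrightarrow> s \<in> extensional base_pts"
  by (simp add: section_space_def)

lemma section_smooth:
  assumes "s \<in> sections B" "(U, \<Phi>) \<in> trivs B" "x \<in> U"
  shows "smooth_at (base B) (\<lambda>y. \<Phi> (s y)) x"
proof (rule smooth_at_pullback[OF T.smooth_mfd_axioms])
  have x: "x \<in> base_pts" using trivs_pts assms by blast
  then show "x \<in> base_pts" .
  show "smooth_map (base B) (total B) s" using assms(1) by (simp add: section_space_def)
  show "smooth_at (total B) \<Phi> (s x)"
    using section_fibre[OF assms(1) x] assms(2,3) by (intro triv_smooth_total) (auto simp: fib_car[OF x])
qed

text \<open>Locally the section is recovered as \<open>G (y, \<Phi> (s y))\<close> with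
  \<open>G\<close> the smooth inverse of a trivialisation, so continuity and smoothness into the
  total space follow from smoothness of the fibre coordinates.\<close>

lemma sectionI:
  assumes ext: "s \<in> extensional base_pts" and fib: "\<And>x. x \<in> base_pts \<Longrightarrow> s x \<in> vcar (fib B x)"
    and smooth: "\<And>x. x \<in> base_pts \<Longrightarrow> \<exists>(U, \<Phi>)\<in>trivs B. x \<in> U \<and> smooth_at (base B) (\<lambda>y. \<Phi> (s y)) x"
  shows "s \<in> sections B"
proof -
  \<comment> \<open>In charts the composition with \<open>G\<close> passes through the product of
    the two model spaces, which needs a frame of its own.\<close>
  obtain Pe :: "'e set" where Pe: "parseval_frame Pe" by (rule model_frame)
  obtain Pf :: "'f set" where Pf: "parseval_frame Pf" by (rule fibre_frame)
  obtain P :: "('e \<times> 'f) set" where P: "parseval_frame P" using parseval_frame_prod[OF Pe Pf] by blast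
  have main: "topcontinuous_at (mtop (base B)) (mtop (total B)) s x \<and>
    (\<forall>V \<psi>. (V, \<psi>) \<in> charts (total B) \<longrightarrow> s x \<in> V \<longrightarrow> smooth_at (base B) (\<lambda>y. \<psi> (s y)) x)"
    if x: "x \<in> base_pts" for x
  proof -
    obtain U \<Phi> where U: "(U, \<Phi>) \<in> trivs B" "x \<in> U" and sm: "smooth_at (base B) (\<lambda>y. \<Phi> (s y)) x"
      using smooth[OF x] by blast
    let ?A = "{a \<in> pts (total B). proj B a \<in> U}"
    let ?R = "prod_manifold (open_submanifold (base B) U) (euclidean_manifold :: ('f, 'f) manifold)"
    define G where "G = inv_into ?A (\<lambda>a. (proj B a, \<Phi> a))"
    have G: "smooth_map ?R (open_submanifold (total B) ?A) G"
      using trivs_local[OF U(1)]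
      by (simp add: local_trivialisation_def diffeomorphism_def G_def pts_total_part)
    have sA: "s y \<in> ?A" if "y \<in> U" for y
      using fib[OF trivs_pts[OF U(1) that]] that by (auto simp: fib_car[OF trivs_pts[OF U(1) that]])
    have Gs: "G (y, \<Phi> (s y)) = s y" if y: "y \<in> U" for y
    proof -
      have "proj B (s y) = y"
        using fib[OF trivs_pts[OF U(1) y]] by (simp add: fib_car[OF trivs_pts[OF U(1) y]])
      then show ?thesis
        unfolding G_def using bij_betw_inv_into_left[OF triv_total_bij[OF U(1)] sA[OF y]] by simp
    qed
    have oA: "openin (mtop (total B)) ?A" by (rule proj_open[OF U(1)])
    have chR: "chart_of ?R ((W \<inter> U) \<times> UNIV) (map_prod \<phi> id)" if "(W, \<phi>) \<in> charts (base B)" for W \<phi>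
      using chart_of_prod chart_of_open_submanifold charts_chart_of[OF that] trivs_open[OF U(1)]
        chart_of_euclidean by blast
    have "topcontinuous_at (mtop (base B)) (mtop (total B)) s x"
      unfolding topcontinuous_at_def
    proof (intro conjI allI impI, goal_cases)
      case 2
      then show ?case using fib by (auto simp: fib_car)
    next
      case (3 Z)
      have "continuous_map (mtop ?R) (mtop (open_submanifold (total B) ?A)) G"
        using G by (simp add: smooth_map_def)
      moreover have "openin (mtop (open_submanifold (total B) ?A)) (Z \<inter> ?A)"
        using 3 oA by (auto simp: open_submanifold_def openin_subtopology)
      ultimately have "openin (mtop ?R) {p \<in> U \<times> UNIV. G p \<in> Z \<inter> ?A}"
        unfolding continuous_map_def pts_prod_part[OF U(1)] by blast
      then have "openin (prod_topology (subtopology (mtop (base B)) U) euclidean) {p \<in> U \<times> UNIV. G p \<in> Z \<inter> ?A}"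
        by (simp add: prod_manifold_def open_submanifold_def euclidean_manifold_def)
      moreover have "(x, \<Phi> (s x)) \<in> {p \<in> U \<times> UNIV. G p \<in> Z \<inter> ?A}"
        using 3 U(2) Gs sA by auto
      ultimately obtain N1 N2 where N: "openin (subtopology (mtop (base B)) U) N1" "open N2"
        "x \<in> N1" "\<Phi> (s x) \<in> N2" "N1 \<times> N2 \<subseteq> {p \<in> U \<times> UNIV. G p \<in> Z \<inter> ?A}"
        unfolding openin_prod_topology_alt open_openin[symmetric] by (elim allE impE exE conjE) auto
      obtain W where W: "openin (mtop (base B)) W" "x \<in> W" "(\<lambda>y. \<Phi> (s y)) ` W \<subseteq> N2"
        using smooth_at_continuous[OF sm N(2,4)] .
      have "openin (mtop (base B)) N1" using N(1) trivs_open[OF U(1)] openin_trans_full by blast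
      then have "openin (mtop (base B)) (N1 \<inter> W)" using W(1) by blast
      moreover have "s y \<in> Z" if "y \<in> N1 \<inter> W" for y
      proof -
        have "(y, \<Phi> (s y)) \<in> {p \<in> U \<times> UNIV. G p \<in> Z \<inter> ?A}"
          using N(5) W(3) that by blast
        then show ?thesis using Gs by auto
      qed
      ultimately show ?case using N(3) W(2) by blast
    qed (rule x)
    moreover have "smooth_at (base B) (\<lambda>y. \<psi> (s y)) x"
      if V: "(V, \<psi>) \<in> charts (total B)" "s x \<in> V" for V \<psi>
    proof -
      obtain W0 \<phi>0 where W0: "(W0, \<phi>0) \<in> charts_at (base B) x" using charts_at_exists[OF x] .
      note W0' = charts_atD[OF W0]
      have d: "((W0 \<inter> U) \<times> UNIV, map_prod \<phi>0 id) \<in> charts ?R"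
        using W0' by (force simp: open_submanifold_def prod_manifold_def euclidean_manifold_def)
      have c: "(V \<inter> ?A, \<psi>) \<in> charts (open_submanifold (total B) ?A)"
        using V by (auto simp: open_submanifold_def)
      have oc: "openin (mtop (open_submanifold (total B) ?A)) (V \<inter> ?A)"
        using T.charts_chart_of[OF V(1)] oA chart_of_open_submanifold by (auto simp: chart_of_def)
      have mem: "(x, \<Phi> (s x)) \<in> (W0 \<inter> U) \<times> UNIV" "G (x, \<Phi> (s x)) \<in> V \<inter> ?A"
        using W0' U Gs sA V(2) by auto
      have "chart_of ?R ((W0 \<inter> U) \<times> UNIV) (map_prod \<phi>0 id)" using chR W0' by blast
      from smooth_map_smooth_at[OF G d mem(1) this c oc mem(2)]
      have "smooth_at ?R (\<lambda>p. \<psi> (G p)) (x, \<Phi> (s x))" .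
      \<comment> \<open>\<open>smooth_at\<close> returns some chart of the product, possibly another
        than the one over \<open>W0\<close>; it is unpacked to see that it is again built from a
        chart of the base.\<close>
      then obtain Q \<kappa> S where Q: "(Q, \<kappa>) \<in> charts_at ?R (x, \<Phi> (s x))" and S: "open S"
        "\<kappa> (x, \<Phi> (s x)) \<in> S" "smooth_on S ((\<lambda>p. \<psi> (G p)) \<circ> inv_into Q \<kappa>)"
        unfolding smooth_at_def by blast
      from Q obtain W \<phi> where W: "(W, \<phi>) \<in> charts (base B)" "x \<in> W" and QW: "Q = (W \<inter> U) \<times> UNIV"
        "\<kappa> = map_prod \<phi> id"
        by (auto simp: charts_at_def open_submanifold_def prod_manifold_def euclidean_manifold_def)
      have "(W, \<phi>) \<in> charts_at (base B) x" using W by (simp add: charts_at_def)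
      from smooth_at_Pair[OF smooth_at_chart[OF this] sm]
      have "smooth_at (base B) (\<lambda>y. (\<phi> y, \<Phi> (s y))) x" .
      from smooth_at_compose[OF P this S(1) _ S(3)] S(2)
      have "smooth_at (base B) (\<lambda>y. \<psi> (G (inv_into Q \<kappa> (\<phi> y, \<Phi> (s y))))) x"
        by (simp add: QW(2))
      then show ?thesis
      proof (rule smooth_at_cong)
        show "openin (mtop (base B)) (W \<inter> U)"
          using charts_chart_of[OF W(1)] trivs_open[OF U(1)] by (auto simp: chart_of_def)
        fix y assume y: "y \<in> W \<inter> U"
        have "inv_into Q \<kappa> (\<kappa> (y, \<Phi> (s y))) = (y, \<Phi> (s y))"
          unfolding QW by (rule chart_of_inv[OF chR[OF W(1)]]) (use y in simp)
        then show "\<psi> (G (inv_into Q \<kappa> (\<phi> y, \<Phi> (s y)))) = \<psi> (s y)"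
          using Gs y by (simp add: QW(2))
      qed (use W U in simp)
    qed
    ultimately show ?thesis by blast
  qed
  have "smooth_map (base B) (total B) s"
    by (rule smooth_mapI) (use main in blast)+
  then show ?thesis using ext fib by (auto simp: section_space_def fib_car)
qed

section \<open>Algebra of sections, extension and tensoriality\<close>

lemma section_eqI:
  assumes "s \<in> sections B" "t \<in> sections B" "\<And>x. x \<in> base_pts \<Longrightarrow> s x = t x"
  shows "s = t"
  using extensionalityI[OF section_extensional section_extensional] assms by blast

lemma vadd_section:
  assumes "s \<in> sections B" "t \<in> sections B"
  shows "vadd (section_space B) s t \<in> sections B"
proof (rule sectionI)
  show "vadd (section_space B) s t \<in> extensional base_pts" by (simp add: section_space_def)
  fix x assume x: "x \<in> base_pts"
  show "vadd (section_space B) s t x \<in> vcar (fib B x)"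
    using x section_fibre[OF assms(1) x] section_fibre[OF assms(2) x] by (simp add: section_space_def fib_vadd)
  obtain U \<Phi> where U: "(U, \<Phi>) \<in> trivs B" "x \<in> U" using trivs_exists[OF x] .
  have "smooth_at (base B) (\<lambda>y. \<Phi> (s y) + \<Phi> (t y)) x"
    by (intro smooth_at_add section_smooth[OF _ U] assms)
  then have "smooth_at (base B) (\<lambda>y. \<Phi> (vadd (section_space B) s t y)) x"
  proof (rule smooth_at_cong[OF _ trivs_open[OF U(1)] U(2)])
    fix y assume y: "y \<in> U"
    show "\<Phi> (s y) + \<Phi> (t y) = \<Phi> (vadd (section_space B) s t y)"
      using trivs_pts[OF U(1) y] section_fibre assms triv_add[OF U(1) y]
      by (simp add: section_space_def[of B])
  qed
  then show "\<exists>(U, \<Phi>)\<in>trivs B. x \<in> U \<and> smooth_at (base B) (\<lambda>y. \<Phi> (vadd (section_space B) s t y)) x"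
    using U by blast
qed

lemma fun_mult_section:
  assumes "f \<in> smooth_functions (base B)" "s \<in> sections B"
  shows "fun_mult B f s \<in> sections B"
proof (rule sectionI)
  show "fun_mult B f s \<in> extensional base_pts" by (simp add: fun_mult_def)
  fix x assume x: "x \<in> base_pts"
  show "fun_mult B f s x \<in> vcar (fib B x)"
    using x section_fibre[OF assms(2) x] by (simp add: fun_mult_def fib_vscale)
  obtain U \<Phi> where U: "(U, \<Phi>) \<in> trivs B" "x \<in> U" using trivs_exists[OF x] .
  have "smooth_at (base B) (\<lambda>y. f y *\<^sub>R \<Phi> (s y)) x"
    using assms(1) x by (intro smooth_at_scaleR section_smooth[OF assms(2) U]) (simp add: smooth_functions_iff)
  then have "smooth_at (base B) (\<lambda>y. \<Phi> (fun_mult B f s y)) x"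
  proof (rule smooth_at_cong[OF _ trivs_open[OF U(1)] U(2)])
    fix y assume y: "y \<in> U"
    show "f y *\<^sub>R \<Phi> (s y) = \<Phi> (fun_mult B f s y)"
      using trivs_pts[OF U(1) y] section_fibre[OF assms(2)] triv_scale[OF U(1) y]
      by (simp add: fun_mult_def)
  qed
  then show "\<exists>(U, \<Phi>)\<in>trivs B. x \<in> U \<and> smooth_at (base B) (\<lambda>y. \<Phi> (fun_mult B f s y)) x"
    using U by blast
qed

text \<open>The vectors \<open>lift \<Phi> y w\<close> are multiplied by a bump function and
  continued by zero vectors. The bump function is 1 on \<open>N\<close>, and \<open>N\<close> is
  chosen before \<open>w\<close>, so that a whole local frame is available on the same
  neighbourhood.\<close>

lemma local_constant_sections:
  assumes U: "(U, \<Phi>) \<in> trivs B" "x \<in> U"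
  obtains N where "openin (mtop (base B)) N" "x \<in> N" "N \<subseteq> U"
    "\<And>w. \<exists>s\<in>sections B. \<forall>y\<in>N. s y = lift \<Phi> y w"
proof -
  obtain h C N where h: "\<And>y. y \<in> base_pts \<Longrightarrow> smooth_at (base B) h y" "closedin (mtop (base B)) C" "C \<subseteq> U"
    "\<And>y. y \<notin> C \<Longrightarrow> h y = (0::real)" and N: "openin (mtop (base B)) N" "x \<in> N" "N \<subseteq> U" "\<And>y. y \<in> N \<Longrightarrow> h y = 1"
    using bump_function[OF trivs_open[OF U(1)] U(2)] by metis
  show thesis
  proof (rule that[OF N(1-3)])
    fix w
    define s where "s = (\<lambda>y\<in>base_pts. if y \<in> U then vscale (fib B y) (h y) (lift \<Phi> y w) else vzero (fib B y))"
    have s_fib: "s y \<in> vcar (fib B y)" if "y \<in> base_pts" for y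
      using that by (simp add: s_def fib_vscale lift_in[OF U(1)] fib_vzero)
    have "s \<in> sections B"
    proof (rule sectionI[OF _ s_fib])
      show "s \<in> extensional base_pts" by (simp add: s_def)
      fix y assume y: "y \<in> base_pts"
      show "\<exists>(U, \<Phi>)\<in>trivs B. y \<in> U \<and> smooth_at (base B) (\<lambda>z. \<Phi> (s z)) y"
      proof (cases "y \<in> U")
        case True
        have "smooth_at (base B) (\<lambda>z. h z *\<^sub>R w) y" by (intro smooth_at_scaleR h(1) smooth_at_const y)
        then have "smooth_at (base B) (\<lambda>z. \<Phi> (s z)) y"
          by (rule smooth_at_cong[OF _ trivs_open[OF U(1)] True])
            (simp add: s_def trivs_pts[OF U(1)] triv_scale[OF U(1)] lift_in[OF U(1)] triv_lift[OF U(1)])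
        then show ?thesis using U(1) True by blast
      next
        case False
        obtain U' \<Phi>' where U': "(U', \<Phi>') \<in> trivs B" "y \<in> U'" using trivs_exists[OF y] .
        have "openin (mtop (base B)) (U' \<inter> (base_pts - C))"
          using trivs_open[OF U'(1)] h(2) by blast
        then have "smooth_at (base B) (\<lambda>z. \<Phi>' (s z)) y"
        proof (rule smooth_at_cong[OF smooth_at_const[OF y, of 0]])
          show "y \<in> U' \<inter> (base_pts - C)" using U'(2) y False h(3) by blast
          fix z assume z: "z \<in> U' \<inter> (base_pts - C)"
          then have "s z = vzero (fib B z)"
            by (simp add: s_def h(4) vscale_0 lift_in[OF U(1)])
          then show "0 = \<Phi>' (s z)" using z by (simp add: triv_zero[OF U'(1)])
        qed
        then show ?thesis using U' by blast
      qed
    qed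
    moreover have "s y = lift \<Phi> y w" if "y \<in> N" for y
    proof -
      have y: "y \<in> U" "y \<in> base_pts" using that N trivs_pts[OF U(1)] by auto
      then show ?thesis
        using that fib_vs[OF y(2)] lift_in[OF U(1) y(1)] by (simp add: s_def N(4) real_vs_def)
    qed
    ultimately show "\<exists>s\<in>sections B. \<forall>y\<in>N. s y = lift \<Phi> y w" by blast
  qed
qed

lemma section_through:
  assumes "x \<in> base_pts" "v \<in> vcar (fib B x)"
  shows "\<exists>s\<in>sections B. s x = v"
proof -
  obtain U \<Phi> where U: "(U, \<Phi>) \<in> trivs B" "x \<in> U" using trivs_exists[OF assms(1)] .
  obtain N where N: "x \<in> N" "\<And>w. \<exists>s\<in>sections B. \<forall>y\<in>N. s y = lift \<Phi> y w"
    using local_constant_sections[OF U] by metis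
  obtain s where "s \<in> sections B" "s x = lift \<Phi> x (\<Phi> v)" using N by blast
  then show ?thesis using lift_triv[OF U assms(2)] by auto
qed

text \<open>
  Near \<open>x\<close> a section is a combination of a local frame with smooth coefficients; after multiplication
  by a bump function \<open>h\<close> with \<open>h x = 1\<close> this becomes an identity of global sections, to which the
  functional \<open>T\<close> can be applied.
\<close>

lemma tensorial_pointwise:
  fixes T :: "('m \<Rightarrow> 'v) \<Rightarrow> real"
  assumes x: "x \<in> base_pts"
    and add: "\<And>s t. s \<in> sections B \<Longrightarrow> t \<in> sections B \<Longrightarrow> T (vadd (section_space B) s t) = T s + T t"
    and mult: "\<And>f s. f \<in> smooth_functions (base B) \<Longrightarrow> s \<in> sections B \<Longrightarrow> T (fun_mult B f s) = f x * T s"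
    and st: "s \<in> sections B" "t \<in> sections B" "s x = t x"
  shows "T s = T t"
proof -
  obtain P :: "'f set" where P: "parseval_frame P" by (rule fibre_frame)
  obtain U \<Phi> where U: "(U, \<Phi>) \<in> trivs B" "x \<in> U" using trivs_exists[OF x] .
  obtain N where N: "openin (mtop (base B)) N" "x \<in> N" "N \<subseteq> U"
    "\<And>w. \<exists>s\<in>sections B. \<forall>y\<in>N. s y = lift \<Phi> y w"
    using local_constant_sections[OF U] by metis
  obtain E where E: "\<And>w. E w \<in> sections B" "\<And>w y. y \<in> N \<Longrightarrow> E w y = lift \<Phi> y w"
    using N(4) by metis
  obtain h C N' where h: "\<And>y. y \<in> base_pts \<Longrightarrow> smooth_at (base B) h y" "closedin (mtop (base B)) C" "C \<subseteq> N"
    "\<And>y. y \<notin> C \<Longrightarrow> h y = (0::real)" and N': "x \<in> N'" "\<And>y. y \<in> N' \<Longrightarrow> h y = 1"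
    using bump_function[OF N(1,2)] by metis
  \<comment> \<open>The right-hand side mentions \<open>s\<close> only through its value at
    \<open>x\<close>, which gives the claim.\<close>
  have "T s = (\<Sum>b\<in>P. (\<Phi> (s x) \<bullet> b) * T (E b))" if s: "s \<in> sections B" for s
  proof -
    define g where "g b y = (if y \<in> N then h y * (\<Phi> (s y) \<bullet> b) else 0)" for b y
    have g: "g b \<in> smooth_functions (base B)" for b
      unfolding smooth_functions_iff
    proof
      fix y assume y: "y \<in> base_pts"
      show "smooth_at (base B) (g b) y"
      proof (cases "y \<in> N")
        case True
        then have "smooth_at (base B) (\<lambda>y. h y * (\<Phi> (s y) \<bullet> b)) y"
          using N(3) by (intro smooth_at_mult h(1) y smooth_at_inner_left section_smooth[OF s U(1)]) auto
        then show ?thesis by (rule smooth_at_cong[OF _ N(1) True]) (simp add: g_def)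
      next
        case False
        show ?thesis
          by (rule smooth_at_cong[OF smooth_at_const[OF y, of 0], of "base_pts - C"])
            (use h False y in \<open>auto simp: g_def\<close>)
      qed
    qed
    \<comment> \<open>\<open>T\<close> is additive for two sections at a time, so the combination of
      frame sections is built vector by vector, together with its vanishing off \<open>N\<close> and
      the value of \<open>T\<close> on it.\<close>
    have "\<exists>R\<in>sections B. (\<forall>y\<in>N. \<Phi> (R y) = (\<Sum>b\<in>A. g b y *\<^sub>R b)) \<and>
        (\<forall>y\<in>base_pts - N. R y = vzero (fib B y)) \<and> T R = (\<Sum>b\<in>A. g b x * T (E b))" if "finite A" for A
      using that
    proof induction
      case empty
      \<comment> \<open>The empty combination is written as the zero function times
        \<open>s\<close>, for which the hypothesis on multiplication gives the value 0.\<close>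
      have zero: "(\<lambda>_. 0) \<in> smooth_functions (base B)" by (simp add: smooth_functions_iff)
      have "\<Phi> (fun_mult B (\<lambda>_. 0) s y) = 0" if "y \<in> N" for y
      proof -
        have "y \<in> U" using that N(3) by blast
        then show ?thesis
          using trivs_pts[OF U(1)] triv_scale[OF U(1)] section_fibre[OF s] by (simp add: fun_mult_def)
      qed
      moreover have "fun_mult B (\<lambda>_. 0) s y = vzero (fib B y)" if "y \<in> base_pts - N" for y
        using that section_fibre[OF s] by (simp add: fun_mult_def vscale_0)
      ultimately show ?case
        using fun_mult_section[OF zero s] mult[OF zero s] by (intro bexI[of _ "fun_mult B (\<lambda>_. 0) s"]) auto
    next
      case (insert a A)
      then obtain R where R: "R \<in> sections B" "\<And>y. y \<in> N \<Longrightarrow> \<Phi> (R y) = (\<Sum>b\<in>A. g b y *\<^sub>R b)"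
        "\<And>y. y \<in> base_pts - N \<Longrightarrow> R y = vzero (fib B y)" "T R = (\<Sum>b\<in>A. g b x * T (E b))" by blast
      let ?G = "fun_mult B (g a) (E a)"
      have G: "?G \<in> sections B" by (rule fun_mult_section[OF g E(1)])
      let ?R = "vadd (section_space B) R ?G"
      have Rv: "?R y = vadd (fib B y) (R y) (?G y)" if "y \<in> base_pts" for y
        using that by (simp add: section_space_def)
      have "\<Phi> (?R y) = (\<Sum>b\<in>insert a A. g b y *\<^sub>R b)" if y: "y \<in> N" for y
      proof -
        have yU: "y \<in> U" and yX: "y \<in> base_pts" using y N(3) trivs_pts[OF U(1)] by auto
        have "\<Phi> (?G y) = g a y *\<^sub>R a"
          using yX by (simp add: fun_mult_def E(2)[OF y] triv_scale[OF U(1) yU] lift_in[OF U(1) yU] triv_lift[OF U(1) yU])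
        then show ?thesis
          using insert.hyps R(2)[OF y] triv_add[OF U(1) yU section_fibre[OF R(1) yX] section_fibre[OF G yX]]
          by (simp add: Rv[OF yX] add.commute)
      qed
      moreover have "?R y = vzero (fib B y)" if y: "y \<in> base_pts - N" for y
      proof -
        have "?G y = vzero (fib B y)"
          using y section_fibre[OF E(1)] by (simp add: fun_mult_def g_def vscale_0)
        then show ?thesis
          using y R(3)[OF y] fib_vs[of y] by (simp add: Rv real_vs_def)
      qed
      moreover have "T ?R = (\<Sum>b\<in>insert a A. g b x * T (E b))"
        using insert.hyps by (simp add: add[OF R(1) G] mult[OF g E(1)] R(4))
      ultimately show ?case using vadd_section[OF R(1) G] by blast
    qed
    from this[OF parseval_frame_finite[OF P]]
    obtain R where R: "R \<in> sections B" "\<And>y. y \<in> N \<Longrightarrow> \<Phi> (R y) = (\<Sum>b\<in>P. g b y *\<^sub>R b)"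
      "\<And>y. y \<in> base_pts - N \<Longrightarrow> R y = vzero (fib B y)" "T R = (\<Sum>b\<in>P. g b x * T (E b))" by blast
    have hs: "h \<in> smooth_functions (base B)" using h(1) by (simp add: smooth_functions_iff)
    have "R = fun_mult B h s"
    proof (rule section_eqI[OF R(1) fun_mult_section[OF hs s]])
      fix y assume y: "y \<in> base_pts"
      show "R y = fun_mult B h s y"
      proof (cases "y \<in> N")
        case True
        then have yU: "y \<in> U" using N(3) by blast
        have "\<Phi> (R y) = h y *\<^sub>R (\<Sum>b\<in>P. (\<Phi> (s y) \<bullet> b) *\<^sub>R b)"
          using R(2)[OF True] True by (simp add: g_def scaleR_sum_right)
        also have "\<dots> = \<Phi> (fun_mult B h s y)"
          using y by (simp add: parseval_frame_sum[OF P] fun_mult_def triv_scale[OF U(1) yU] section_fibre[OF s])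
        finally show ?thesis
          by (rule fibre_eqI[OF U(1) yU section_fibre[OF R(1) y] section_fibre[OF fun_mult_section[OF hs s] y]])
      next
        case False
        then have "h y = 0" using h(3,4) by blast
        then show ?thesis using R(3) y False section_fibre[OF s y] by (simp add: fun_mult_def vscale_0)
      qed
    qed
    \<comment> \<open>\<open>h x\<close> is 1, so cutting off does not change the value of
      \<open>T\<close>.\<close>
    then have "T R = T s" using mult[OF hs s] N' by simp
    then show ?thesis using R(4) N(2) N' by (simp add: g_def)
  qed
  then show ?thesis using st by simp
qed


section \<open>Forms evaluated on sections\<close>

lemma form_alt: "\<eta> \<in> forms B (int p) \<Longrightarrow> x \<in> base_pts \<Longrightarrow> alt_form (fib B x) p (\<eta> x)"
  by (simp add: forms_def)

lemma form_outside: "\<eta> \<in> forms B p \<Longrightarrow> x \<notin> base_pts \<Longrightarrow> \<eta> x = (\<lambda>vs. 0)"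
  by (auto simp: forms_def split: if_splits)

lemma form_smooth:
  assumes "\<eta> \<in> forms B (int p)" "(U, \<Phi>) \<in> trivs B" "x \<in> U" "length ws = p"
  shows "smooth_at (base B) (\<lambda>y. \<eta> y (map (lift \<Phi> y) ws)) x"
proof -
  have "\<forall>(U, \<Phi>)\<in>trivs B. \<forall>ws. length ws = p \<longrightarrow>
      (\<lambda>x. \<eta> x (map (lift \<Phi> x) ws)) \<in> smooth_functions (open_submanifold (base B) U)"
    using assms(1) by (simp add: forms_def)
  then have "(\<lambda>x. \<eta> x (map (lift \<Phi> x) ws)) \<in> smooth_functions (open_submanifold (base B) U)"
    using assms(2,4) by blast
  then show ?thesis
    using assms(3) by (simp add: smooth_functions_open_submanifold_iff[OF trivs_open[OF assms(2)]])
qed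

lemma form_slot_add:
  assumes "\<eta> \<in> forms B (int p)" "x \<in> base_pts" "length vs = p" "set vs \<subseteq> vcar (fib B x)" "i < p"
    "u \<in> vcar (fib B x)" "v \<in> vcar (fib B x)"
  shows "\<eta> x (vs[i := vadd (fib B x) u v]) = \<eta> x (vs[i := u]) + \<eta> x (vs[i := v])"
  using form_alt[OF assms(1,2)] assms by (simp add: alt_form_def vs_linear_def vs_of_type_def)

lemma form_slot_scale:
  assumes "\<eta> \<in> forms B (int p)" "x \<in> base_pts" "length vs = p" "set vs \<subseteq> vcar (fib B x)" "i < p"
    "u \<in> vcar (fib B x)"
  shows "\<eta> x (vs[i := vscale (fib B x) a u]) = a * \<eta> x (vs[i := u])"
  using form_alt[OF assms(1,2)] assms by (simp add: alt_form_def vs_linear_def vs_of_type_def)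

lemma form_swap:
  assumes "\<eta> \<in> forms B (int p)" "x \<in> base_pts" "length vs = p" "set vs \<subseteq> vcar (fib B x)" "i < p" "j < p" "i \<noteq> j"
  shows "\<eta> x (vs[i := vs ! j, j := vs ! i]) = - \<eta> x vs"
  using form_alt[OF assms(1,2)] assms by (simp add: alt_form_def)

lemma form_junk:
  assumes "\<eta> \<in> forms B (int p)" "x \<in> base_pts" "\<not> (length vs = p \<and> set vs \<subseteq> vcar (fib B x))"
  shows "\<eta> x vs = 0"
  using form_alt[OF assms(1,2)] assms(3) by (simp add: alt_form_def)

text \<open>Smoothness of a form is defined through constant coefficients only. The number
  \<open>n\<close> of leading arguments with varying coefficients is raised one at a time: the frame
  expansion of the new argument and linearity in its slot reduce it to constant ones.\<close>

lemma form_lift_smooth: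
  assumes \<eta>: "\<eta> \<in> forms B (int p)" and U: "(U, \<Phi>) \<in> trivs B" "x \<in> U"
  shows "n \<le> p \<Longrightarrow> length Ws = p \<Longrightarrow> (\<And>i. i < n \<Longrightarrow> smooth_at (base B) (Ws ! i) x) \<Longrightarrow>
    (\<And>i. n \<le> i \<Longrightarrow> i < p \<Longrightarrow> \<exists>w. Ws ! i = (\<lambda>_. w)) \<Longrightarrow>
    smooth_at (base B) (\<lambda>y. \<eta> y (map (\<lambda>W. lift \<Phi> y (W y)) Ws)) x"
proof (induction n arbitrary: Ws)
  case 0
  \<comment> \<open>With no varying argument all functions in \<open>Ws\<close> are constant, so
    they may be frozen at \<open>x\<close>.\<close>
  have const: "W y = W x" if "W \<in> set Ws" for W y
    using that "0.prems"(2,4) by (force simp: in_set_conv_nth)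
  have "map (\<lambda>W. lift \<Phi> y (W y)) Ws = map (lift \<Phi> y) (map (\<lambda>W. W x) Ws)" for y
    using const[of _ y] by (auto intro!: arg_cong[where f = "lift \<Phi> y"])
  then show ?case using form_smooth[OF \<eta> U, of "map (\<lambda>W. W x) Ws"] "0.prems"(2) by (simp only: length_map)
next
  case (Suc n)
  obtain P :: "'f set" where P: "parseval_frame P" by (rule fibre_frame)
  let ?L = "\<lambda>Ws y. map (\<lambda>W. lift \<Phi> y (W y)) Ws"
  have n: "n < p" using Suc.prems by simp
  have "smooth_at (base B) (\<lambda>y. \<eta> y (?L (Ws[n := \<lambda>_. b]) y)) x" for b
  proof (rule Suc.IH)
    show "\<exists>w. Ws[n := \<lambda>_. b] ! i = (\<lambda>_. w)" if "n \<le> i" "i < p" for i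
      using that Suc.prems(2,4) by (cases "i = n") auto
  qed (use Suc.prems in auto)
  then have "smooth_at (base B) (\<lambda>y. \<Sum>b\<in>P. (Ws ! n) y \<bullet> b * \<eta> y (?L (Ws[n := \<lambda>_. b]) y)) x"
    using Suc.prems(3)[of n] trivs_pts[OF U]
    by (intro smooth_at_sum smooth_at_mult smooth_at_inner_left) auto
  then show ?case
  proof (rule smooth_at_cong[OF _ trivs_open[OF U(1)] U(2)])
    fix y assume y: "y \<in> U"
    have yX: "y \<in> base_pts" using trivs_pts[OF U(1) y] .
    define k where "k w = \<eta> y ((?L Ws y)[n := lift \<Phi> y w])" for w
    have L: "length (?L Ws y) = p" "set (?L Ws y) \<subseteq> vcar (fib B y)"
      using Suc.prems(2) lift_in[OF U(1) y] by auto
    have lin: "linear k"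
      using form_slot_add[OF \<eta> yX L n lift_in[OF U(1) y] lift_in[OF U(1) y]]
        form_slot_scale[OF \<eta> yX L n lift_in[OF U(1) y]]
      by (intro linearI) (simp_all add: k_def lift_add[OF U(1) y] lift_scale[OF U(1) y])
    have "(?L Ws y)[n := lift \<Phi> y ((Ws ! n) y)] = ?L Ws y"
      using n Suc.prems(2) by (intro list_update_same_conv[THEN iffD2]) auto
    then have "\<eta> y (?L Ws y) = k ((Ws ! n) y)" by (simp only: k_def)
    also have "\<dots> = k (\<Sum>b\<in>P. ((Ws ! n) y \<bullet> b) *\<^sub>R b)" by (simp only: parseval_frame_sum[OF P])
    also have "\<dots> = (\<Sum>b\<in>P. (Ws ! n) y \<bullet> b * k b)"
      by (simp add: linear_sum[OF lin] linear_scale[OF lin])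
    finally show "(\<Sum>b\<in>P. (Ws ! n) y \<bullet> b * \<eta> y (?L (Ws[n := \<lambda>_. b]) y)) = \<eta> y (?L Ws y)"
      by (simp add: k_def map_update)
  qed
qed

lemma eval_form_smooth:
  assumes \<eta>: "\<eta> \<in> forms B (int p)" and Vs: "length Vs = p" "set Vs \<subseteq> sections B" and x: "x \<in> base_pts"
  shows "smooth_at (base B) (eval_form \<eta> Vs) x"
proof -
  obtain U \<Phi> where U: "(U, \<Phi>) \<in> trivs B" "x \<in> U" using trivs_exists[OF x] .
  let ?Ws = "map (\<lambda>V y. \<Phi> (V y)) Vs"
  have "smooth_at (base B) (?Ws ! i) x" if "i < p" for i
  proof -
    have "Vs ! i \<in> sections B" using that Vs nth_mem by blast
    from section_smooth[OF this U] show ?thesis using that Vs(1) by simp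
  qed
  then have "smooth_at (base B) (\<lambda>y. \<eta> y (map (\<lambda>W. lift \<Phi> y (W y)) ?Ws)) x"
    using Vs(1) by (intro form_lift_smooth[OF \<eta> U, of p]) auto
  then show ?thesis
  proof (rule smooth_at_cong[OF _ trivs_open[OF U(1)] U(2)])
    fix y assume y: "y \<in> U"
    have "map (\<lambda>W. lift \<Phi> y (W y)) ?Ws = map (\<lambda>W. W y) Vs"
      using Vs(2) section_fibre[OF _ trivs_pts[OF U(1) y]] by (auto intro!: lift_triv[OF U(1) y])
    then show "\<eta> y (map (\<lambda>W. lift \<Phi> y (W y)) ?Ws) = eval_form \<eta> Vs y" by (simp only: eval_form_def)
  qed
qed

lemma eval_form_slot:
  "eval_form \<eta> (Vs[i := s]) y = \<eta> y ((map (\<lambda>W. W y) Vs)[i := s y])"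
  by (simp add: eval_form_def map_update)

lemma eval_points_in_fibre: "set Vs \<subseteq> sections B \<Longrightarrow> y \<in> base_pts \<Longrightarrow> set (map (\<lambda>W. W y) Vs) \<subseteq> vcar (fib B y)"
  using section_fibre by auto

lemma eval_form_add:
  assumes "\<eta> \<in> forms B (int p)" "length Vs = p" "set Vs \<subseteq> sections B" "i < p" "y \<in> base_pts"
    "s \<in> sections B" "t \<in> sections B"
  shows "eval_form \<eta> (Vs[i := vadd (section_space B) s t]) y = eval_form \<eta> (Vs[i := s]) y + eval_form \<eta> (Vs[i := t]) y"
proof -
  have "vadd (section_space B) s t y = vadd (fib B y) (s y) (t y)"
    using assms(5) by (simp add: section_space_def)
  then show ?thesis
    unfolding eval_form_slot
    using form_slot_add[OF assms(1,5) _ eval_points_in_fibre[OF assms(3,5)] assms(4)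
        section_fibre[OF assms(6,5)] section_fibre[OF assms(7,5)]] assms(2) by simp
qed

lemma eval_form_mult:
  assumes "\<eta> \<in> forms B (int p)" "length Vs = p" "set Vs \<subseteq> sections B" "i < p" "y \<in> base_pts" "s \<in> sections B"
  shows "eval_form \<eta> (Vs[i := fun_mult B f s]) y = f y * eval_form \<eta> (Vs[i := s]) y"
proof -
  have "fun_mult B f s y = vscale (fib B y) (f y) (s y)"
    using assms(5) by (simp add: fun_mult_def)
  then show ?thesis
    unfolding eval_form_slot
    using form_slot_scale[OF assms(1,5) _ eval_points_in_fibre[OF assms(3,5)] assms(4)
        section_fibre[OF assms(6,5)]] assms(2) by simp
qed

lemma eval_form_swap:
  assumes "\<eta> \<in> forms B (int p)" "length Vs = p" "set Vs \<subseteq> sections B" "i < p" "j < p" "i \<noteq> j" "y \<in> base_pts"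
  shows "eval_form \<eta> (Vs[i := Vs ! j, j := Vs ! i]) y = - eval_form \<eta> Vs y"
  using form_swap[OF assms(1,7) _ eval_points_in_fibre[OF assms(3,7)] assms(4,5,6)] assms(2,4,5)
  by (simp add: eval_form_def map_update)

end


section \<open>The Lie derivative of forms\<close>

locale algebroid_section =
  fixes B :: "('m, 'v, 'e::real_inner, 'f::real_inner, 'g::real_inner) vbundle"
    and \<rho> :: "'v \<Rightarrow> ('m, 'e) tangent"
    and br :: "('m \<Rightarrow> 'v) \<Rightarrow> ('m \<Rightarrow> 'v) \<Rightarrow> 'm \<Rightarrow> 'v"
    and V :: "'m \<Rightarrow> 'v"
  assumes algebroid: "lie_algebroid B \<rho> br" and V: "V \<in> sections B"
begin

sublocale smooth_bundle B
  by unfold_locales (use algebroid in \<open>simp add: lie_algebroid_def\<close>)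

abbreviation A where "A \<equiv> compose (pts (base B)) \<rho> V"

sublocale A: smooth_vector_field "base B" A
proof (rule smooth_vector_field_section[OF mfd])
  have "lie_hom (section_space B) br (section_space (tangent_bundle (base B))) (vf_bracket (base B))
      (compose (pts (base B)) \<rho>)"
    using algebroid unfolding lie_algebroid_def by (elim conjE)
  then show "A \<in> sections (tangent_bundle (base B))"
    using V by (auto simp: lie_hom_def vs_linear_def)
qed

lemma bracket_linear: "vs_linear (section_space B) (section_space B) (br V)"
proof -
  have "lie_algebra (section_space B) br"
    using algebroid unfolding lie_algebroid_def by (elim conjE)
  then have "\<forall>x\<in>sections B. vs_linear (section_space B) (section_space B) (\<lambda>y. br x y)"
    unfolding lie_algebra_def by (elim conjE)
  then show ?thesis using V by blast
qed

lemma bracket_section: "s \<in> sections B \<Longrightarrow> br V s \<in> sections B"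
  using bracket_linear by (auto simp: vs_linear_def)

lemma bracket_add: "s \<in> sections B \<Longrightarrow> t \<in> sections B \<Longrightarrow>
    br V (vadd (section_space B) s t) = vadd (section_space B) (br V s) (br V t)"
  using bracket_linear by (simp add: vs_linear_def)

lemma bracket_mult:
  assumes "f \<in> smooth_functions (base B)" "s \<in> sections B"
  shows "br V (fun_mult B f s) =
    vadd (section_space B) (fun_mult B f (br V s)) (fun_mult B (contract_d (base B) A f) s)"
proof -
  have "\<forall>s\<in>sections B. \<forall>t\<in>sections B. \<forall>f\<in>smooth_functions (base B).
        br s (fun_mult B f t) =
        vadd (section_space B) (fun_mult B f (br s t))
          (fun_mult B (contract_d (base B) (compose (pts (base B)) \<rho> s) f) t)"
    using algebroid unfolding lie_algebroid_def by (elim conjE)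
  then show ?thesis using V assms by blast
qed

text \<open>The right-hand side of (ii) as an operation on sections. For the empty list the sum is
  empty, so degree 0 and property (i) are covered as well.\<close>

definition lie_eval :: "('m \<Rightarrow> 'v list \<Rightarrow> real) \<Rightarrow> ('m \<Rightarrow> 'v) list \<Rightarrow> 'm \<Rightarrow> real" where
  "lie_eval \<eta> Vs x =
     contract_d (base B) A (eval_form \<eta> Vs) x -
     (\<Sum>i<length Vs. eval_form \<eta> (Vs[i := br V (Vs ! i)]) x)"

lemma set_update_sections: "set Vs \<subseteq> sections B \<Longrightarrow> s \<in> sections B \<Longrightarrow> set (Vs[i := s]) \<subseteq> sections B"
  using set_update_subset_insert by fastforce

text \<open>The section in slot \<open>i\<close> enters under the derivative, inside its own
  bracket, and as a plain argument of the remaining terms. Separating the three lets additivity and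
  the Leibniz rule be checked term by term.\<close>

lemma lie_eval_slot:
  assumes "i < length Vs"
  shows "lie_eval \<eta> (Vs[i := s]) x =
    contract_d (base B) A (eval_form \<eta> (Vs[i := s])) x - eval_form \<eta> (Vs[i := br V s]) x -
    (\<Sum>j\<in>{..<length Vs} - {i}. eval_form \<eta> ((Vs[j := br V (Vs ! j)])[i := s]) x)"
proof -
  have "(\<Sum>j<length Vs. eval_form \<eta> ((Vs[i := s])[j := br V ((Vs[i := s]) ! j)]) x) =
    eval_form \<eta> ((Vs[i := s])[i := br V ((Vs[i := s]) ! i)]) x +
    (\<Sum>j\<in>{..<length Vs} - {i}. eval_form \<eta> ((Vs[i := s])[j := br V ((Vs[i := s]) ! j)]) x)"
    using assms by (intro sum.remove) auto
  also have "(\<Sum>j\<in>{..<length Vs} - {i}. eval_form \<eta> ((Vs[i := s])[j := br V ((Vs[i := s]) ! j)]) x) =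
    (\<Sum>j\<in>{..<length Vs} - {i}. eval_form \<eta> ((Vs[j := br V (Vs ! j)])[i := s]) x)"
    by (rule sum.cong) (auto simp: list_update_swap)
  finally show ?thesis using assms by (simp add: lie_eval_def)
qed

context
  fixes \<eta> :: "'m \<Rightarrow> 'v list \<Rightarrow> real" and p :: nat
  assumes \<eta>: "\<eta> \<in> forms B (int p)"
begin

lemma lie_eval_add:
  assumes Vs: "length Vs = p" "set Vs \<subseteq> sections B" and i: "i < p" and x: "x \<in> base_pts"
    and s: "s \<in> sections B" and t: "t \<in> sections B"
  shows "lie_eval \<eta> (Vs[i := vadd (section_space B) s t]) x = lie_eval \<eta> (Vs[i := s]) x + lie_eval \<eta> (Vs[i := t]) x"
proof -
  have op: "openin (mtop (base B)) base_pts" by simp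
  have sm: "smooth_at (base B) (eval_form \<eta> (Vs[i := r])) x" if "r \<in> sections B" for r
    using Vs x that by (intro eval_form_smooth[OF \<eta>] set_update_sections) auto
  have "contract_d (base B) A (eval_form \<eta> (Vs[i := vadd (section_space B) s t])) x =
      contract_d (base B) A (\<lambda>y. eval_form \<eta> (Vs[i := s]) y + eval_form \<eta> (Vs[i := t]) y) x"
    by (rule A.contract_d_cong[OF sm[OF vadd_section[OF s t]] op x])
      (rule eval_form_add[OF \<eta> Vs i _ s t])
  also have "\<dots> = contract_d (base B) A (eval_form \<eta> (Vs[i := s])) x + contract_d (base B) A (eval_form \<eta> (Vs[i := t])) x"
    by (rule A.contract_d_add[OF sm[OF s] sm[OF t]])
  finally have 1: "contract_d (base B) A (eval_form \<eta> (Vs[i := vadd (section_space B) s t])) x = \<dots>" .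
  have 2: "eval_form \<eta> (Vs[i := br V (vadd (section_space B) s t)]) x =
      eval_form \<eta> (Vs[i := br V s]) x + eval_form \<eta> (Vs[i := br V t]) x"
    unfolding bracket_add[OF s t]
    by (rule eval_form_add[OF \<eta> Vs i x bracket_section[OF s] bracket_section[OF t]])
  have 3: "eval_form \<eta> ((Vs[j := br V (Vs ! j)])[i := vadd (section_space B) s t]) x =
      eval_form \<eta> ((Vs[j := br V (Vs ! j)])[i := s]) x + eval_form \<eta> ((Vs[j := br V (Vs ! j)])[i := t]) x"
    if "j \<in> {..<length Vs} - {i}" for j
  proof -
    have "Vs ! j \<in> sections B" using that Vs(2) by (auto simp: subset_iff)
    then show ?thesis
      using Vs by (intro eval_form_add[OF \<eta> _ _ i x s t] set_update_sections bracket_section) auto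
  qed
  show ?thesis
    using i Vs(1) by (simp add: lie_eval_slot 1 2 3 sum.distrib)
qed

lemma lie_eval_mult:
  assumes Vs: "length Vs = p" "set Vs \<subseteq> sections B" and i: "i < p" and x: "x \<in> base_pts"
    and f: "f \<in> smooth_functions (base B)" and s: "s \<in> sections B"
  shows "lie_eval \<eta> (Vs[i := fun_mult B f s]) x = f x * lie_eval \<eta> (Vs[i := s]) x"
proof -
  have op: "openin (mtop (base B)) base_pts" by simp
  have sm: "smooth_at (base B) (eval_form \<eta> (Vs[i := r])) x" if "r \<in> sections B" for r
    using Vs x that by (intro eval_form_smooth[OF \<eta>] set_update_sections) auto
  have fx: "smooth_at (base B) f x" using f x by (simp add: smooth_functions_iff)
  have Af: "contract_d (base B) A f \<in> smooth_functions (base B)"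
    using f A.contract_d_smooth by (simp add: smooth_functions_iff)
  have "contract_d (base B) A (eval_form \<eta> (Vs[i := fun_mult B f s])) x =
      contract_d (base B) A (\<lambda>y. f y * eval_form \<eta> (Vs[i := s]) y) x"
    by (rule A.contract_d_cong[OF sm[OF fun_mult_section[OF f s]] op x])
      (rule eval_form_mult[OF \<eta> Vs i _ s])
  also have "\<dots> = f x * contract_d (base B) A (eval_form \<eta> (Vs[i := s])) x + contract_d (base B) A f x * eval_form \<eta> (Vs[i := s]) x"
    by (rule A.contract_d_mult[OF fx sm[OF s]])
  finally have 1: "contract_d (base B) A (eval_form \<eta> (Vs[i := fun_mult B f s])) x = \<dots>" .
  have 2: "eval_form \<eta> (Vs[i := br V (fun_mult B f s)]) x =
      f x * eval_form \<eta> (Vs[i := br V s]) x + contract_d (base B) A f x * eval_form \<eta> (Vs[i := s]) x"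
    unfolding bracket_mult[OF f s]
      eval_form_add[OF \<eta> Vs i x fun_mult_section[OF f bracket_section[OF s]] fun_mult_section[OF Af s]]
      eval_form_mult[OF \<eta> Vs i x s] eval_form_mult[OF \<eta> Vs i x bracket_section[OF s]] ..
  have 3: "eval_form \<eta> ((Vs[j := br V (Vs ! j)])[i := fun_mult B f s]) x =
      f x * eval_form \<eta> ((Vs[j := br V (Vs ! j)])[i := s]) x"
    if "j \<in> {..<length Vs} - {i}" for j
  proof -
    have "Vs ! j \<in> sections B" using that Vs(2) by (auto simp: subset_iff)
    then show ?thesis
      using Vs by (intro eval_form_mult[OF \<eta> _ _ i x s] set_update_sections bracket_section) auto
  qed
  show ?thesis
    using i Vs(1) by (simp add: lie_eval_slot 1 2 3 sum_distrib_left right_diff_distrib)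
qed

lemma lie_eval_slot_pointwise:
  assumes "length Vs = p" "set Vs \<subseteq> sections B" "i < p" "x \<in> base_pts"
    and "s \<in> sections B" "t \<in> sections B" "s x = t x"
  shows "lie_eval \<eta> (Vs[i := s]) x = lie_eval \<eta> (Vs[i := t]) x"
  by (rule tensorial_pointwise[OF assms(4), where T = "\<lambda>s. lie_eval \<eta> (Vs[i := s]) x"])
    (use assms lie_eval_add lie_eval_mult in auto)

text \<open>\<open>lie_eval_slot_pointwise\<close> changes one argument at a time, so the two lists
  are interpolated by \<open>take n Ws @ drop n Vs\<close>.\<close>

lemma lie_eval_pointwise:
  assumes Vs: "length Vs = p" "set Vs \<subseteq> sections B" and Ws: "length Ws = p" "set Ws \<subseteq> sections B"
    and x: "x \<in> base_pts" and eq: "\<And>i. i < p \<Longrightarrow> (Vs ! i) x = (Ws ! i) x"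
  shows "lie_eval \<eta> Vs x = lie_eval \<eta> Ws x"
proof -
  have "lie_eval \<eta> (take n Ws @ drop n Vs) x = lie_eval \<eta> Vs x" if "n \<le> p" for n
    using that
  proof (induction n)
    case (Suc n)
    let ?L = "take n Ws @ drop n Vs"
    have n: "n < p" using Suc.prems by simp
    have L: "length ?L = p" "set ?L \<subseteq> sections B"
      using Vs Ws n set_take_subset[of n Ws] set_drop_subset[of n Vs] by auto
    have "take (Suc n) Ws @ drop (Suc n) Vs = ?L[n := Ws ! n]" "?L = ?L[n := Vs ! n]"
      using n Vs(1) Ws(1)
      by (auto simp: list_update_append take_Suc_conv_app_nth Cons_nth_drop_Suc[symmetric])
    moreover have "lie_eval \<eta> (?L[n := Ws ! n]) x = lie_eval \<eta> (?L[n := Vs ! n]) x"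
    proof (rule lie_eval_slot_pointwise[OF L n x])
      show "Ws ! n \<in> sections B" "Vs ! n \<in> sections B"
        using n Vs Ws nth_mem[of n Ws] nth_mem[of n Vs] by auto
    qed (simp add: eq[OF n])
    ultimately show ?case using Suc.IH n by simp
  qed simp
  from this[of p] show ?thesis using Vs(1) Ws(1) by simp
qed

text \<open>Each bracket term of the exchanged list is the exchange of a bracket term of
  \<open>Vs\<close>, at the position moved by the transposition \<open>\<pi>\<close>. Reindexing the
  sum by \<open>\<pi>\<close> leaves one sign in front.\<close>

lemma lie_eval_swap:
  assumes Vs: "length Vs = p" "set Vs \<subseteq> sections B" and ij: "i < p" "j < p" "i \<noteq> j" and x: "x \<in> base_pts"
  shows "lie_eval \<eta> (Vs[i := Vs ! j, j := Vs ! i]) x = - lie_eval \<eta> Vs x"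
proof -
  define sw where "sw Us = Us[i := Us ! j, j := Us ! i]" for Us :: "('m \<Rightarrow> 'v) list"
  define \<pi> where "\<pi> k = (if k = i then j else if k = j then i else k)" for k
  have op: "openin (mtop (base B)) base_pts" by simp
  have swap: "eval_form \<eta> (sw Us) y = (- 1) * eval_form \<eta> Us y"
    if "length Us = p" "set Us \<subseteq> sections B" "y \<in> base_pts" for Us y
    unfolding sw_def using eval_form_swap[OF \<eta> that(1,2) ij that(3)] by simp
  have sec: "Vs ! k \<in> sections B" if "k < p" for k using that Vs nth_mem[of k Vs] by auto
  have sw_sec: "set (sw Vs) \<subseteq> sections B"
    unfolding sw_def by (intro set_update_sections Vs sec ij)
  have sw_len: "length (sw Us) = length Us" for Us by (simp add: sw_def)
  have "contract_d (base B) A (eval_form \<eta> (sw Vs)) x = contract_d (base B) A (\<lambda>y. (- 1) * eval_form \<eta> Vs y) x"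
    by (rule A.contract_d_cong[OF eval_form_smooth[OF \<eta> _ sw_sec x] op x])
      (use Vs swap in \<open>auto simp: sw_len\<close>)
  \<comment> \<open>The sign is a constant factor, so the product rule applies, and the derivative
    of the constant is 0.\<close>
  also have "\<dots> = - contract_d (base B) A (eval_form \<eta> Vs) x"
    using A.contract_d_mult[OF smooth_at_const[OF x] eval_form_smooth[OF \<eta> Vs x], of "- 1"]
      A.contract_d_const[OF x, of "- 1"] by simp
  finally have 1: "contract_d (base B) A (eval_form \<eta> (sw Vs)) x = - contract_d (base B) A (eval_form \<eta> Vs) x" .
  have "(\<Sum>k<p. eval_form \<eta> ((sw Vs)[k := br V (sw Vs ! k)]) x) =
      (\<Sum>k<p. - eval_form \<eta> (Vs[k := br V (Vs ! k)]) x)"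
  proof (rule sum.reindex_bij_witness[of _ \<pi> \<pi>])
    fix k assume k: "k \<in> {..<p}"
    show "\<pi> (\<pi> k) = k" "\<pi> k \<in> {..<p}" using k ij by (auto simp: \<pi>_def)
    have "(sw Vs)[k := br V (sw Vs ! k)] = sw (Vs[\<pi> k := br V (Vs ! \<pi> k)])"
      unfolding sw_def using k ij Vs(1)
      by (auto simp: \<pi>_def list_eq_iff_nth_eq nth_list_update)
    moreover have "set (Vs[\<pi> k := br V (Vs ! \<pi> k)]) \<subseteq> sections B"
      using k ij by (intro set_update_sections Vs bracket_section sec) (auto simp: \<pi>_def)
    ultimately show "- eval_form \<eta> (Vs[\<pi> k := br V (Vs ! \<pi> k)]) x = eval_form \<eta> ((sw Vs)[k := br V (sw Vs ! k)]) x"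
      using swap[of "Vs[\<pi> k := br V (Vs ! \<pi> k)]" x] Vs(1) x by simp
  qed (use ij in \<open>auto simp: \<pi>_def\<close>)
  then show ?thesis
    using Vs(1) by (simp add: sw_def[symmetric] lie_eval_def 1 sum_negf sw_len)
qed

lemma lie_eval_smooth:
  assumes Vs: "length Vs = p" "set Vs \<subseteq> sections B" and x: "x \<in> base_pts"
  shows "smooth_at (base B) (lie_eval \<eta> Vs) x"
  unfolding lie_eval_def[abs_def]
proof (intro smooth_at_diff smooth_at_sum x A.contract_d_smooth)
  show "smooth_at (base B) (eval_form \<eta> Vs) x" by (rule eval_form_smooth[OF \<eta> Vs x])
  fix i assume "i \<in> {..<length Vs}"
  then have "Vs ! i \<in> sections B" using Vs by (auto simp: subset_iff)
  then show "smooth_at (base B) (eval_form \<eta> (Vs[i := br V (Vs ! i)])) x"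
    using Vs by (intro eval_form_smooth[OF \<eta> _ _ x] set_update_sections bracket_section) auto
qed

end

section \<open>From operations on sections to forms on the fibres\<close>

definition section_at :: "'m \<Rightarrow> 'v \<Rightarrow> 'm \<Rightarrow> 'v" where
  "section_at x v = (SOME s. s \<in> sections B \<and> s x = v)"

lemma section_at:
  assumes "x \<in> base_pts" "v \<in> vcar (fib B x)"
  shows "section_at x v \<in> sections B" "section_at x v x = v"
proof -
  have "\<exists>s. s \<in> sections B \<and> s x = v" using section_through[OF assms] by blast
  then have "section_at x v \<in> sections B \<and> section_at x v x = v" unfolding section_at_def by (rule someI_ex)
  then show "section_at x v \<in> sections B" "section_at x v x = v" by auto
qed

lemma section_at_list:
  assumes "x \<in> base_pts" "set vs \<subseteq> vcar (fib B x)"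
  shows "set (map (section_at x) vs) \<subseteq> sections B" "map (\<lambda>W. W x) (map (section_at x) vs) = vs"
  using assms section_at by (auto simp: subset_iff intro!: map_idI)

text \<open>The extensions \<open>section_at\<close> are chosen independently at each point, with no
  regularity in \<open>x\<close>. The value 0 elsewhere is the convention of \<open>forms\<close>
  and \<open>alt_form\<close>.\<close>

definition lie_form :: "nat \<Rightarrow> ('m \<Rightarrow> 'v list \<Rightarrow> real) \<Rightarrow> 'm \<Rightarrow> 'v list \<Rightarrow> real" where
  "lie_form p \<eta> x vs =
     (if x \<in> base_pts \<and> length vs = p \<and> set vs \<subseteq> vcar (fib B x) then lie_eval \<eta> (map (section_at x) vs) x else 0)"

text \<open>\<open>lie_eval_pointwise\<close> makes the choice of extensions harmless: the given
  sections have the same values at \<open>x\<close> as the chosen ones.\<close>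

lemma eval_lie_form:
  assumes \<eta>: "\<eta> \<in> forms B (int p)" and Vs: "length Vs = p" "set Vs \<subseteq> sections B" and x: "x \<in> base_pts"
  shows "eval_form (lie_form p \<eta>) Vs x = lie_eval \<eta> Vs x"
proof -
  let ?vs = "map (\<lambda>W. W x) Vs"
  have vs: "set ?vs \<subseteq> vcar (fib B x)" by (rule eval_points_in_fibre[OF Vs(2) x])
  have "lie_eval \<eta> (map (section_at x) ?vs) x = lie_eval \<eta> Vs x"
  proof (rule lie_eval_pointwise[OF \<eta> _ section_at_list(1)[OF x vs] Vs x])
    fix i assume i: "i < p"
    have "(Vs ! i) x \<in> vcar (fib B x)" using i Vs section_fibre[OF _ x] by (auto simp: subset_iff)
    then show "(map (section_at x) ?vs ! i) x = (Vs ! i) x" using i Vs(1) section_at[OF x] by simp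
  qed (simp add: Vs)
  then show ?thesis using x Vs(1) vs by (simp add: eval_form_def lie_form_def)
qed

lemma alt_form_lie_form:
  assumes \<eta>: "\<eta> \<in> forms B (int p)" and x: "x \<in> base_pts"
  shows "alt_form (fib B x) p (lie_form p \<eta> x)"
  unfolding alt_form_def
proof (intro conjI allI impI)
  fix vs assume "\<not> (length vs = p \<and> set vs \<subseteq> vcar (fib B x))"
  then show "lie_form p \<eta> x vs = 0" by (auto simp: lie_form_def)
next
  fix vs i assume vs: "length vs = p \<and> set vs \<subseteq> vcar (fib B x)" and i: "i < p"
  let ?Vs = "map (section_at x) vs"
  have Vs: "length ?Vs = p" "set ?Vs \<subseteq> sections B" using vs section_at_list[OF x] by auto
  \<comment> \<open>The chosen extension of a sum of vectors need not be the sum of their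
    extensions. Allowing an arbitrary section \<open>s\<close> in slot \<open>i\<close> lets sums
    and multiples of sections stand for those of vectors.\<close>
  have val: "lie_form p \<eta> x (vs[i := s x]) = lie_eval \<eta> (?Vs[i := s]) x" if s: "s \<in> sections B" for s
  proof -
    have "eval_form (lie_form p \<eta>) (?Vs[i := s]) x = lie_eval \<eta> (?Vs[i := s]) x"
      by (rule eval_lie_form[OF \<eta> _ set_update_sections[OF Vs(2) s] x]) (simp add: vs)
    then show ?thesis unfolding eval_form_slot using section_at_list(2)[OF x, of vs] vs by simp
  qed
  show "vs_linear (fib B x) vs_of_type (\<lambda>u. lie_form p \<eta> x (vs[i := u]))"
    unfolding vs_linear_def
  proof (intro conjI ballI allI)
    fix u v assume u: "u \<in> vcar (fib B x)" and v: "v \<in> vcar (fib B x)"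
    note eu = section_at[OF x u] and ev = section_at[OF x v]
    let ?s = "vadd (section_space B) (section_at x u) (section_at x v)"
    have "?s x = vadd (fib B x) u v" using x eu ev by (simp add: section_space_def)
    then have "lie_form p \<eta> x (vs[i := vadd (fib B x) u v]) = lie_eval \<eta> (?Vs[i := ?s]) x"
      using val[OF vadd_section[OF eu(1) ev(1)]] by simp
    also have "\<dots> = lie_eval \<eta> (?Vs[i := section_at x u]) x + lie_eval \<eta> (?Vs[i := section_at x v]) x"
      by (rule lie_eval_add[OF \<eta> Vs i x eu(1) ev(1)])
    finally show "lie_form p \<eta> x (vs[i := vadd (fib B x) u v]) =
        vadd vs_of_type (lie_form p \<eta> x (vs[i := u])) (lie_form p \<eta> x (vs[i := v]))"
      using val[OF eu(1)] val[OF ev(1)] eu(2) ev(2) by (simp add: vs_of_type_def)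
  next
    fix a u assume u: "u \<in> vcar (fib B x)"
    note eu = section_at[OF x u]
    have c: "(\<lambda>_. a) \<in> smooth_functions (base B)" by (simp add: smooth_functions_iff)
    let ?s = "fun_mult B (\<lambda>_. a) (section_at x u)"
    have "?s x = vscale (fib B x) a u" using x eu by (simp add: fun_mult_def)
    then have "lie_form p \<eta> x (vs[i := vscale (fib B x) a u]) = lie_eval \<eta> (?Vs[i := ?s]) x"
      using val[OF fun_mult_section[OF c eu(1)]] by simp
    also have "\<dots> = a * lie_eval \<eta> (?Vs[i := section_at x u]) x"
      by (rule lie_eval_mult[OF \<eta> Vs i x c eu(1)])
    finally show "lie_form p \<eta> x (vs[i := vscale (fib B x) a u]) =
        vscale vs_of_type a (lie_form p \<eta> x (vs[i := u]))"
      using val[OF eu(1)] eu(2) by (simp add: vs_of_type_def)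
  qed (simp add: vs_of_type_def)
next
  fix vs i j assume vs: "length vs = p \<and> set vs \<subseteq> vcar (fib B x)" and ij: "i < p" "j < p" "i \<noteq> j"
  let ?Vs = "map (section_at x) vs"
  have Vs: "length ?Vs = p" "set ?Vs \<subseteq> sections B" using vs section_at_list[OF x] by auto
  have sec: "?Vs ! k \<in> sections B" if "k < p" for k using Vs that nth_mem[of k ?Vs] by auto
  have "map (\<lambda>W. W x) (?Vs[i := ?Vs ! j, j := ?Vs ! i]) = vs[i := vs ! j, j := vs ! i]"
  proof -
    have "vs ! k \<in> vcar (fib B x)" if "k < p" for k using that vs nth_mem[of k vs] by auto
    then show ?thesis
      using section_at_list(2)[OF x, of vs] vs ij section_at(2)[OF x] by (simp add: map_update)
  qed
  moreover have "eval_form (lie_form p \<eta>) (?Vs[i := ?Vs ! j, j := ?Vs ! i]) x =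
      lie_eval \<eta> (?Vs[i := ?Vs ! j, j := ?Vs ! i]) x"
    by (intro eval_lie_form[OF \<eta> _ _ x] set_update_sections Vs sec ij) (simp add: vs)
  moreover have "\<dots> = - lie_eval \<eta> ?Vs x" by (rule lie_eval_swap[OF \<eta> Vs ij x])
  ultimately show "lie_form p \<eta> x (vs[i := vs ! j, j := vs ! i]) = - lie_form p \<eta> x vs"
    using x vs by (simp add: eval_form_def lie_form_def[of p \<eta> x vs])
qed

text \<open>Near \<open>x\<close> the constant coefficients are realised by global sections. By
  \<open>eval_lie_form\<close> the coefficient function is there \<open>lie_eval\<close> of one
  fixed list of sections, free of the pointwise choices.\<close>

lemma lie_form_smooth:
  assumes \<eta>: "\<eta> \<in> forms B (int p)" and U: "(U, \<Phi>) \<in> trivs B" "x \<in> U" and ws: "length ws = p"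
  shows "smooth_at (base B) (\<lambda>y. lie_form p \<eta> y (map (lift \<Phi> y) ws)) x"
proof -
  obtain N where N: "openin (mtop (base B)) N" "x \<in> N" "N \<subseteq> U"
    "\<And>w. \<exists>s\<in>sections B. \<forall>y\<in>N. s y = lift \<Phi> y w"
    using local_constant_sections[OF U] by metis
  obtain E where E: "\<And>w. E w \<in> sections B" "\<And>w y. y \<in> N \<Longrightarrow> E w y = lift \<Phi> y w"
    using N(4) by metis
  have Es: "length (map E ws) = p" "set (map E ws) \<subseteq> sections B" using ws E(1) by auto
  show ?thesis
  proof (rule smooth_at_cong[OF lie_eval_smooth[OF \<eta> Es trivs_pts[OF U]] N(1,2)])
    fix y assume y: "y \<in> N"
    then have "y \<in> base_pts" using N(3) trivs_pts[OF U(1)] by blast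
    from eval_lie_form[OF \<eta> Es this]
    show "lie_eval \<eta> (map E ws) y = lie_form p \<eta> y (map (lift \<Phi> y) ws)"
      using E(2)[OF y] by (simp add: eval_form_def comp_def)
  qed
qed

lemma lie_form_in_forms:
  assumes \<eta>: "\<eta> \<in> forms B (int p)"
  shows "lie_form p \<eta> \<in> forms B (int p)"
proof -
  have "(\<lambda>y. lie_form p \<eta> y (map (lift \<Phi> y) ws)) \<in> smooth_functions (open_submanifold (base B) U)"
    if U: "(U, \<Phi>) \<in> trivs B" and ws: "length ws = p" for U \<Phi> ws
    unfolding smooth_functions_open_submanifold_iff[OF trivs_open[OF U]]
    using lie_form_smooth[OF \<eta> U _ ws] by blast
  moreover have "lie_form p \<eta> x = (\<lambda>vs. 0)" if "x \<notin> base_pts" for x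
    using that by (simp add: lie_form_def fun_eq_iff)
  ultimately show ?thesis
    using alt_form_lie_form[OF \<eta>] by (auto simp: forms_def)
qed

lemma eval_form_smooth_function:
  "\<eta> \<in> forms B (int p) \<Longrightarrow> length Vs = p \<Longrightarrow> set Vs \<subseteq> sections B \<Longrightarrow> eval_form \<eta> Vs \<in> smooth_functions (base B)"
  by (simp add: smooth_functions_iff eval_form_smooth)

lemma lie_eval_linear:
  assumes \<eta>: "\<eta> \<in> forms B (int p)" and \<theta>: "\<theta> \<in> forms B (int p)"
    and Vs: "length Vs = p" "set Vs \<subseteq> sections B" and x: "x \<in> base_pts"
  shows "lie_eval (\<lambda>x vs. \<eta> x vs + \<theta> x vs) Vs x = lie_eval \<eta> Vs x + lie_eval \<theta> Vs x"
    and "lie_eval (\<lambda>x vs. a * \<eta> x vs) Vs x = a * lie_eval \<eta> Vs x"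
proof -
  note sm = eval_form_smooth[OF \<eta> Vs x] eval_form_smooth[OF \<theta> Vs x]
  have e: "eval_form (\<lambda>x vs. \<eta> x vs + \<theta> x vs) Us = (\<lambda>y. eval_form \<eta> Us y + eval_form \<theta> Us y)"
    "eval_form (\<lambda>x vs. a * \<eta> x vs) Us = (\<lambda>y. a * eval_form \<eta> Us y)" for Us
    by (auto simp: eval_form_def)
  show "lie_eval (\<lambda>x vs. \<eta> x vs + \<theta> x vs) Vs x = lie_eval \<eta> Vs x + lie_eval \<theta> Vs x"
    by (simp add: lie_eval_def e A.contract_d_add[OF sm] sum.distrib)
  show "lie_eval (\<lambda>x vs. a * \<eta> x vs) Vs x = a * lie_eval \<eta> Vs x"
    using A.contract_d_mult[OF smooth_at_const[OF x] sm(1), of a] A.contract_d_const[OF x, of a]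
    by (simp add: lie_eval_def e sum_distrib_left right_diff_distrib)
qed

lemma lie_form_add:
  assumes "\<eta> \<in> forms B (int p)" "\<theta> \<in> forms B (int p)"
  shows "lie_form p (\<lambda>x vs. \<eta> x vs + \<theta> x vs) = (\<lambda>x vs. lie_form p \<eta> x vs + lie_form p \<theta> x vs)"
  using lie_eval_linear(1)[OF assms _ section_at_list(1)] by (auto simp: lie_form_def fun_eq_iff)

lemma lie_form_scale:
  assumes "\<eta> \<in> forms B (int p)"
  shows "lie_form p (\<lambda>x vs. a * \<eta> x vs) = (\<lambda>x vs. a * lie_form p \<eta> x vs)"
  using lie_eval_linear(2)[OF assms assms _ section_at_list(1)] by (auto simp: lie_form_def fun_eq_iff)

section \<open>The graded space of forms and its endomorphisms\<close>

lemma zero_in_forms: "(\<lambda>x vs. 0) \<in> forms B p"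
proof (cases "p < 0")
  case False
  have "(\<lambda>_. 0) \<in> smooth_functions (open_submanifold (base B) U)" if "(U, \<Phi>) \<in> trivs B" for U \<Phi>
    using trivs_pts[OF that] by (simp add: smooth_functions_open_submanifold_iff[OF trivs_open[OF that]])
  then show ?thesis using False by (auto simp: forms_def alt_form_def vs_linear_def vs_of_type_def)
qed (simp add: forms_def)

lemma lie_form_zero: "lie_form p (\<lambda>x vs. 0) = (\<lambda>x vs. 0)"
  using lie_form_scale[OF zero_in_forms, of p 0] by simp

lemma fun_form_in_forms:
  assumes f: "f \<in> smooth_functions (base B)"
  shows "fun_form B f \<in> forms B 0"
proof -
  have "(\<lambda>x. fun_form B f x []) \<in> smooth_functions (open_submanifold (base B) U)" if U: "(U, \<Phi>) \<in> trivs B" for U \<Phi>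
    unfolding smooth_functions_open_submanifold_iff[OF trivs_open[OF U]]
  proof
    fix x assume x: "x \<in> U"
    have "smooth_at (base B) f x" using f trivs_pts[OF U x] by (simp add: smooth_functions_iff)
    then show "smooth_at (base B) (\<lambda>x. fun_form B f x []) x"
      by (rule smooth_at_cong[OF _ trivs_open[OF U] x]) (simp add: fun_form_def trivs_pts[OF U])
  qed
  then show ?thesis by (auto simp: forms_def alt_form_def fun_form_def)
qed

text \<open>Property (i) speaks of \<open>fun_form\<close> only; since every form of degree 0 arises
  this way, it determines the endomorphism in degree 0.\<close>

lemma form_0_eq_fun_form:
  assumes "\<eta> \<in> forms B 0"
  shows "\<eta> = fun_form B (eval_form \<eta> [])" "eval_form \<eta> [] \<in> smooth_functions (base B)"
proof -
  have \<eta>: "\<eta> \<in> forms B (int 0)" using assms by simp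
  show "eval_form \<eta> [] \<in> smooth_functions (base B)" by (rule eval_form_smooth_function[OF \<eta>]) auto
  have "\<eta> x vs = fun_form B (eval_form \<eta> []) x vs" for x vs
  proof (cases "x \<in> base_pts \<and> vs = []")
    case False
    then have "\<eta> x vs = 0"
      using form_outside[OF assms] form_junk[OF \<eta>, of x vs] by (cases "x \<in> base_pts") auto
    then show ?thesis using False by (auto simp: fun_form_def)
  qed (simp add: fun_form_def eval_form_def)
  then show "\<eta> = fun_form B (eval_form \<eta> [])" by blast
qed

lemma lie_form_fun_form:
  assumes f: "f \<in> smooth_functions (base B)"
  shows "lie_form 0 (fun_form B f) = fun_form B (contract_d (base B) A f)"
proof -
  \<comment> \<open>\<open>fun_form\<close> is 0 outside the base, so the two functions are only
    known to agree on base points; these form an open set, which is enough for the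
    derivative.\<close>
  have "contract_d (base B) A (eval_form (fun_form B f) []) x = contract_d (base B) A f x" if x: "x \<in> base_pts" for x
    by (rule A.contract_d_cong[symmetric, where W = base_pts])
      (use f x in \<open>auto simp: smooth_functions_iff eval_form_def fun_form_def\<close>)
  then show ?thesis by (auto simp: lie_form_def lie_eval_def fun_form_def fun_eq_iff)
qed

text \<open>Below degree 0 the zero form is put in by hand, since \<open>nat\<close> sends every
  negative degree to 0.\<close>

definition lie_derivative ::
  "(int \<Rightarrow> 'm \<Rightarrow> 'v list \<Rightarrow> real) \<Rightarrow> int \<Rightarrow> 'm \<Rightarrow> 'v list \<Rightarrow> real" where
  "lie_derivative = (\<lambda>\<omega>\<in>vcar (form_space B). \<lambda>p. if p < 0 then (\<lambda>x vs. 0) else lie_form (nat p) (\<omega> p))"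

lemma in_degree_form_space: "\<eta> \<in> forms B p \<Longrightarrow> in_degree p \<eta> \<in> vcar (form_space B)"
  using zero_in_forms by (auto simp: form_space_def in_degree_def intro: finite_subset[of _ "{p}"])

lemma lie_derivative_in_degree:
  assumes "\<eta> \<in> forms B (int p)"
  shows "lie_derivative (in_degree (int p) \<eta>) = in_degree (int p) (lie_form p \<eta>)"
  using in_degree_form_space[OF assms]
  by (auto simp: lie_derivative_def in_degree_def lie_form_zero)

lemma forms_lincomb:
  assumes "\<eta> \<in> forms B p" "\<theta> \<in> forms B p"
  shows "(\<lambda>x vs. a * \<eta> x vs + b * \<theta> x vs) \<in> forms B p"
proof (cases "p < 0")
  case False
  then obtain q where q: "p = int q" by (metis int_nat_eq not_less)
  note \<eta> = assms(1)[unfolded q] and \<theta> = assms(2)[unfolded q]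
  have "(\<lambda>y. a * \<eta> y (map (lift \<Phi> y) ws) + b * \<theta> y (map (lift \<Phi> y) ws))
      \<in> smooth_functions (open_submanifold (base B) U)"
    if U: "(U, \<Phi>) \<in> trivs B" and ws: "length ws = q" for U \<Phi> ws
    unfolding smooth_functions_open_submanifold_iff[OF trivs_open[OF U]]
    using form_smooth[OF \<eta> U _ ws] form_smooth[OF \<theta> U _ ws] trivs_pts[OF U]
    by (intro ballI smooth_at_add smooth_at_mult smooth_at_const) auto
  moreover have "alt_form (fib B x) q (\<lambda>vs. a * \<eta> x vs + b * \<theta> x vs)" if x: "x \<in> base_pts" for x
    using form_alt[OF \<eta> x] form_alt[OF \<theta> x]
    by (auto simp: alt_form_def vs_linear_def vs_of_type_def algebra_simps)
  moreover have "(\<lambda>vs. a * \<eta> x vs + b * \<theta> x vs) = (\<lambda>vs. 0)" if "x \<notin> base_pts" for x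
    using that form_outside[OF \<eta>] form_outside[OF \<theta>] by simp
  ultimately show ?thesis by (auto simp: forms_def q)
qed (use assms in \<open>simp add: forms_def\<close>)

lemma form_space_vs:
  assumes "\<omega> \<in> vcar (form_space B)" "\<omega>' \<in> vcar (form_space B)"
  shows "vadd (form_space B) \<omega> \<omega>' \<in> vcar (form_space B)" "vscale (form_space B) a \<omega> \<in> vcar (form_space B)"
proof -
  have fin: "finite ({p. \<omega> p \<noteq> (\<lambda>x vs. 0)} \<union> {p. \<omega>' p \<noteq> (\<lambda>x vs. 0)})"
    using assms by (simp add: form_space_def)
  have mem: "\<omega> p \<in> forms B p" "\<omega>' p \<in> forms B p" for p using assms by (simp_all add: form_space_def)
  show "vadd (form_space B) \<omega> \<omega>' \<in> vcar (form_space B)"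
    using forms_lincomb[OF mem, where a = 1 and b = 1] by (auto simp: form_space_def intro: finite_subset[OF _ fin])
  show "vscale (form_space B) a \<omega> \<in> vcar (form_space B)"
    using forms_lincomb[OF mem(1) mem(1), where a = a and b = 0] by (auto simp: form_space_def intro: finite_subset[OF _ fin])
qed

lemma lie_derivative_form_space:
  assumes "\<omega> \<in> vcar (form_space B)"
  shows "lie_derivative \<omega> \<in> vcar (form_space B)"
proof -
  have "lie_form (nat p) (\<omega> p) \<in> forms B p" if "\<not> p < 0" for p
    using lie_form_in_forms[of "\<omega> p" "nat p"] that assms by (simp add: form_space_def)
  then have "lie_derivative \<omega> p \<in> forms B p" for p
    using assms zero_in_forms by (simp add: lie_derivative_def)
  moreover have "finite {p. lie_derivative \<omega> p \<noteq> (\<lambda>x vs. 0)}"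
  proof (rule finite_subset)
    show "{p. lie_derivative \<omega> p \<noteq> (\<lambda>x vs. 0)} \<subseteq> {p. \<omega> p \<noteq> (\<lambda>x vs. 0)}"
      using assms lie_form_zero by (auto simp: lie_derivative_def)
    show "finite {p. \<omega> p \<noteq> (\<lambda>x vs. 0)}" using assms by (simp add: form_space_def)
  qed
  ultimately show ?thesis by (simp add: form_space_def)
qed

lemma graded_endomorphism_lie_derivative: "graded_endomorphism B 0 lie_derivative"
  unfolding graded_endomorphism_def vs_linear_def
proof (intro conjI ballI allI)
  show "lie_derivative \<in> extensional (vcar (form_space B))" by (simp add: lie_derivative_def)
  show "lie_derivative \<in> vcar (form_space B) \<rightarrow> vcar (form_space B)"
    using lie_derivative_form_space by blast
next
  fix \<omega> \<omega>' assume \<omega>: "\<omega> \<in> vcar (form_space B)" and \<omega>': "\<omega>' \<in> vcar (form_space B)"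
  have "lie_form (nat p) (\<lambda>x vs. \<omega> p x vs + \<omega>' p x vs) =
      (\<lambda>x vs. lie_form (nat p) (\<omega> p) x vs + lie_form (nat p) (\<omega>' p) x vs)" if "\<not> p < 0" for p
    using that \<omega> \<omega>' by (intro lie_form_add) (auto simp: form_space_def)
  then show "lie_derivative (vadd (form_space B) \<omega> \<omega>') = vadd (form_space B) (lie_derivative \<omega>) (lie_derivative \<omega>')"
    using form_space_vs(1)[OF \<omega> \<omega>'] \<omega> \<omega>' by (auto simp: lie_derivative_def form_space_def[of B] fun_eq_iff)
next
  fix a \<omega> assume \<omega>: "\<omega> \<in> vcar (form_space B)"
  have "lie_form (nat p) (\<lambda>x vs. a * \<omega> p x vs) = (\<lambda>x vs. a * lie_form (nat p) (\<omega> p) x vs)" if "\<not> p < 0" for p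
    using that \<omega> by (intro lie_form_scale) (auto simp: form_space_def)
  then show "lie_derivative (vscale (form_space B) a \<omega>) = vscale (form_space B) a (lie_derivative \<omega>)"
    using form_space_vs(2)[OF \<omega> \<omega>] \<omega> by (auto simp: lie_derivative_def form_space_def[of B] fun_eq_iff)
next
  fix p :: int
  show "lie_derivative ` in_degree p ` forms B p \<subseteq> in_degree (p + 0) ` forms B (p + 0)"
  proof (cases "p < 0")
    case True
    have "lie_derivative (in_degree p (\<lambda>x vs. 0)) = in_degree p (\<lambda>x vs. 0)"
      using in_degree_form_space[OF zero_in_forms, of p]
      by (auto simp: lie_derivative_def in_degree_def lie_form_zero)
    then show ?thesis using True by (simp add: forms_def)
  next
    case False
    then obtain q where "p = int q" by (metis int_nat_eq not_less)
    then show ?thesis using lie_derivative_in_degree lie_form_in_forms by auto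
  qed
qed

section \<open>Characterisation and uniqueness\<close>

lemma graded_endomorphismD:
  assumes "graded_endomorphism B d L" "\<eta> \<in> forms B p"
  shows "\<exists>\<theta>\<in>forms B (p + d). L (in_degree p \<eta>) = in_degree (p + d) \<theta>"
proof -
  have "L ` in_degree p ` forms B p \<subseteq> in_degree (p + d) ` forms B (p + d)"
    using assms(1) by (simp add: graded_endomorphism_def)
  then have "L (in_degree p \<eta>) \<in> in_degree (p + d) ` forms B (p + d)"
    using assms(2) by (simp add: image_subset_iff)
  then show ?thesis by (simp add: image_iff)
qed

text \<open>An element of the space is the sum of its finitely many nonzero components. The
  induction runs over a finite set containing their degrees and peels off one degree by
  additivity.\<close>

lemma graded_endomorphism_eqI:
  assumes L: "graded_endomorphism B d L" and K: "graded_endomorphism B d K"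
    and eq: "\<And>p \<eta>. \<eta> \<in> forms B p \<Longrightarrow> L (in_degree p \<eta>) = K (in_degree p \<eta>)"
  shows "L = K"
proof (rule extensionalityI)
  show "L \<in> extensional (vcar (form_space B))" "K \<in> extensional (vcar (form_space B))"
    using L K by (auto simp: graded_endomorphism_def)
  have add: "J (vadd (form_space B) \<omega> \<omega>') = vadd (form_space B) (J \<omega>) (J \<omega>')"
    if "graded_endomorphism B d J" "\<omega> \<in> vcar (form_space B)" "\<omega>' \<in> vcar (form_space B)" for J \<omega> \<omega>'
    using that by (simp add: graded_endomorphism_def vs_linear_def)
  have *: "L \<omega> = K \<omega>" if "finite S" "\<omega> \<in> vcar (form_space B)" "{p. \<omega> p \<noteq> (\<lambda>x vs. 0)} \<subseteq> S" for S \<omega>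
    using that
  proof (induction S arbitrary: \<omega>)
    case empty
    then have "\<omega> = in_degree 0 (\<lambda>x vs. 0)" by (auto simp: in_degree_def fun_eq_iff)
    then show ?case using eq[OF zero_in_forms] by simp
  next
    case (insert q S)
    define \<omega>' where "\<omega>' = fun_upd \<omega> q (\<lambda>x vs. 0)"
    have q: "\<omega> q \<in> forms B q" using insert.prems(1) by (simp add: form_space_def)
    have "finite {p. \<omega> p \<noteq> (\<lambda>x vs. 0)}" using insert.prems(1) by (simp add: form_space_def)
    then have "finite {p. \<omega>' p \<noteq> (\<lambda>x vs. 0)}" by (rule rev_finite_subset) (auto simp: \<omega>'_def)
    then have \<omega>': "\<omega>' \<in> vcar (form_space B)"
      using insert.prems(1) zero_in_forms by (simp add: form_space_def) (simp add: \<omega>'_def)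
    have split: "\<omega> = vadd (form_space B) (in_degree q (\<omega> q)) \<omega>'"
      by (auto simp: \<omega>'_def form_space_def in_degree_def fun_eq_iff)
    have "L \<omega>' = K \<omega>'" using insert.prems(2) by (intro insert.IH[OF \<omega>']) (auto simp: \<omega>'_def)
    then show ?case
      using add[OF L in_degree_form_space[OF q] \<omega>'] add[OF K in_degree_form_space[OF q] \<omega>'] eq[OF q] split
      by metis
  qed
  then show "L \<omega> = K \<omega>" if "\<omega> \<in> vcar (form_space B)" for \<omega>
    using that by (intro *[OF _ _ subset_refl]) (simp_all add: form_space_def)
qed

text \<open>Word for word the property in the theorem. In (ii) the derivative of the function
  \<open>eval_form \<eta> Vs\<close> is again taken by \<open>L\<close>, through degree 0.\<close>

definition is_lie_derivative ::
  "((int \<Rightarrow> 'm \<Rightarrow> 'v list \<Rightarrow> real) \<Rightarrow> int \<Rightarrow> 'm \<Rightarrow> 'v list \<Rightarrow> real) \<Rightarrow> bool" where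
  "is_lie_derivative L \<longleftrightarrow> graded_endomorphism B 0 L \<and>
    (\<forall>f\<in>smooth_functions (base B).
       L (in_degree 0 (fun_form B f)) =
         in_degree 0 (fun_form B (contract_d (base B) (compose (pts (base B)) \<rho> V) f)) \<and>
       L (in_degree 0 (fun_form B f)) =
         in_degree 0 (fun_form B (lie_derivative_fun (base B) (compose (pts (base B)) \<rho> V) f))) \<and>
    (\<forall>p::nat. p > 0 \<longrightarrow> (\<forall>\<eta>\<in>forms B (int p). \<forall>Vs. length Vs = p \<and> set Vs \<subseteq> sections B \<longrightarrow>
       (\<forall>x\<in>pts (base B).
          eval_form (L (in_degree (int p) \<eta>) (int p)) Vs x =
            eval_form (L (in_degree 0 (fun_form B (eval_form \<eta> Vs))) 0) [] x -
            (\<Sum>i<p. eval_form \<eta> (Vs[i := br V (Vs ! i)]) x))))"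

lemma lie_derivative_fun_form:
  assumes f: "f \<in> smooth_functions (base B)"
  shows "lie_derivative (in_degree 0 (fun_form B f)) = in_degree 0 (fun_form B (contract_d (base B) A f))"
  using lie_derivative_in_degree[of "fun_form B f" 0] fun_form_in_forms[OF f] lie_form_fun_form[OF f] by simp

lemma is_lie_derivative_lie_derivative: "is_lie_derivative lie_derivative"
  unfolding is_lie_derivative_def
proof (intro conjI ballI allI impI)
  show "graded_endomorphism B 0 lie_derivative" by (rule graded_endomorphism_lie_derivative)
  fix f assume f: "f \<in> smooth_functions (base B)"
  show L: "lie_derivative (in_degree 0 (fun_form B f)) = in_degree 0 (fun_form B (contract_d (base B) A f))"
    by (rule lie_derivative_fun_form[OF f])
  have "fun_form B (contract_d (base B) A f) = fun_form B (lie_derivative_fun (base B) A f)"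
    using f A.lie_derivative_fun_eq by (auto simp: fun_form_def fun_eq_iff smooth_functions_iff)
  then show "lie_derivative (in_degree 0 (fun_form B f)) = in_degree 0 (fun_form B (lie_derivative_fun (base B) A f))"
    by (simp add: L)
next
  fix p :: nat and \<eta> Vs x
  assume \<eta>: "\<eta> \<in> forms B (int p)" and Vs: "length Vs = p \<and> set Vs \<subseteq> sections B" and x: "x \<in> base_pts"
  have "eval_form \<eta> Vs \<in> smooth_functions (base B)" using eval_form_smooth_function[OF \<eta>] Vs by blast
  from lie_derivative_fun_form[OF this]
  have "eval_form (lie_derivative (in_degree 0 (fun_form B (eval_form \<eta> Vs))) 0) [] x =
      contract_d (base B) A (eval_form \<eta> Vs) x"
    using x by (simp add: eval_form_def[where Vs = "[]"] in_degree_def fun_form_def)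
  moreover have "lie_derivative (in_degree (int p) \<eta>) (int p) = lie_form p \<eta>"
    unfolding lie_derivative_in_degree[OF \<eta>] by (simp add: in_degree_def)
  then have "eval_form (lie_derivative (in_degree (int p) \<eta>) (int p)) Vs x = lie_eval \<eta> Vs x"
    using eval_lie_form[OF \<eta> _ _ x, of Vs] Vs by simp
  ultimately show "eval_form (lie_derivative (in_degree (int p) \<eta>) (int p)) Vs x =
      eval_form (lie_derivative (in_degree 0 (fun_form B (eval_form \<eta> Vs))) 0) [] x -
      (\<Sum>i<p. eval_form \<eta> (Vs[i := br V (Vs ! i)]) x)"
    using Vs by (simp add: lie_eval_def)
qed

text \<open>The right-hand side of (ii) involves the endomorphism only on functions, where (i)
  prescribes it. The values on lists of sections therefore agree, and those on lists of vectors are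
  among them.\<close>

lemma is_lie_derivative_unique:
  assumes L: "is_lie_derivative L" and K: "is_lie_derivative K"
  shows "L = K"
proof (rule graded_endomorphism_eqI[where d = 0])
  show grL: "graded_endomorphism B 0 L" and grK: "graded_endomorphism B 0 K"
    using L K by (auto simp: is_lie_derivative_def)
  have on_functions: "L (in_degree 0 (fun_form B f)) = K (in_degree 0 (fun_form B f))"
    if "f \<in> smooth_functions (base B)" for f
    using L K that by (simp add: is_lie_derivative_def)
  fix p \<eta> assume \<eta>: "\<eta> \<in> forms B p"
  consider "p < 0" | "p = 0" | q where "p = int q" "q > 0"
    by (metis linorder_neqE_linordered_idom zero_less_imp_eq_int)
  then show "L (in_degree p \<eta>) = K (in_degree p \<eta>)"
  proof cases
    case 1
    then have "\<eta> = (\<lambda>x vs. 0)" using \<eta> by (simp add: forms_def)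
    \<comment> \<open>The zero forms of all degrees embed as the same element, so a negative degree
      is covered by (i) for the zero function.\<close>
    then have "in_degree p \<eta> = in_degree 0 (fun_form B (\<lambda>_. 0))"
      by (auto simp: in_degree_def fun_form_def fun_eq_iff)
    then show ?thesis using on_functions by (simp add: smooth_functions_iff)
  next
    case 2
    then show ?thesis using form_0_eq_fun_form[of \<eta>] \<eta> on_functions by metis
  next
    case 3
    note \<eta>q = \<eta>[unfolded 3(1)]
    \<comment> \<open>Formula (ii) sees only the component of degree \<open>p\<close>; homogeneity
      of degree 0 guarantees that the others vanish.\<close>
    obtain \<theta> \<kappa> where \<theta>: "\<theta> \<in> forms B p" "L (in_degree p \<eta>) = in_degree p \<theta>"
      and \<kappa>: "\<kappa> \<in> forms B p" "K (in_degree p \<eta>) = in_degree p \<kappa>"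
      using graded_endomorphismD[OF grL \<eta>] graded_endomorphismD[OF grK \<eta>] by auto
    have eval: "eval_form \<theta> Vs x = eval_form \<kappa> Vs x"
      if Vs: "length Vs = q" "set Vs \<subseteq> sections B" and x: "x \<in> base_pts" for Vs x
    proof -
      have formula: "eval_form (J (in_degree p \<eta>) p) Vs x =
          eval_form (J (in_degree 0 (fun_form B (eval_form \<eta> Vs))) 0) [] x -
          (\<Sum>i<q. eval_form \<eta> (Vs[i := br V (Vs ! i)]) x)" if "is_lie_derivative J" for J
        using that \<eta>q Vs x 3(2) unfolding is_lie_derivative_def 3(1) by blast
      show ?thesis
        using formula[OF L] formula[OF K] on_functions[OF eval_form_smooth_function[OF \<eta>q Vs]] \<theta>(2) \<kappa>(2)
        by (simp add: in_degree_def)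
    qed
    have "\<theta> x vs = \<kappa> x vs" for x vs
    proof -
      consider "x \<notin> base_pts" | "x \<in> base_pts" "\<not> (length vs = q \<and> set vs \<subseteq> vcar (fib B x))"
        | "x \<in> base_pts" "length vs = q" "set vs \<subseteq> vcar (fib B x)" by blast
      then show ?thesis
      proof cases
        case 1
        then show ?thesis using form_outside[OF \<theta>(1)] form_outside[OF \<kappa>(1)] by simp
      next
        case 2
        then show ?thesis using form_junk[OF \<theta>(1)[unfolded 3(1)]] form_junk[OF \<kappa>(1)[unfolded 3(1)]] by simp
      next
        case 3
        from eval[of "map (section_at x) vs" x] section_at_list[OF 3(1,3)] 3 show ?thesis by (simp only: eval_form_def length_map)
      qed
    qed
    then show ?thesis using \<theta>(2) \<kappa>(2) by (metis ext)
  qed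
qed

end

theorem proposition4p1p1:
  fixes B :: "('m, 'v, 'e::real_inner, 'f::real_inner, 'g::real_inner) vbundle"
    and \<rho> :: "'v \<Rightarrow> ('m, 'e) tangent"
    and br :: "('m \<Rightarrow> 'v) \<Rightarrow> ('m \<Rightarrow> 'v) \<Rightarrow> 'm \<Rightarrow> 'v"
    and V :: "'m \<Rightarrow> 'v"
  assumes "lie_algebroid B \<rho> br"
    and "V \<in> sections B"
  shows "\<exists>!L. graded_endomorphism B 0 L \<and>
    (\<forall>f\<in>smooth_functions (base B).
       L (in_degree 0 (fun_form B f)) =
         in_degree 0 (fun_form B (contract_d (base B) (compose (pts (base B)) \<rho> V) f)) \<and>
       L (in_degree 0 (fun_form B f)) =
         in_degree 0 (fun_form B (lie_derivative_fun (base B) (compose (pts (base B)) \<rho> V) f))) \<and>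
    (\<forall>p::nat. p > 0 \<longrightarrow> (\<forall>\<eta>\<in>forms B (int p). \<forall>Vs. length Vs = p \<and> set Vs \<subseteq> sections B \<longrightarrow>
       (\<forall>x\<in>pts (base B).
          eval_form (L (in_degree (int p) \<eta>) (int p)) Vs x =
            eval_form (L (in_degree 0 (fun_form B (eval_form \<eta> Vs))) 0) [] x -
            (\<Sum>i<p. eval_form \<eta> (Vs[i := br V (Vs ! i)]) x))))"
proof -
  interpret algebroid_section B \<rho> br V by unfold_locales (fact assms)+
  have "\<exists>!L. is_lie_derivative L"
    using is_lie_derivative_lie_derivative is_lie_derivative_unique by blast
  then show ?thesis unfolding is_lie_derivative_def .
qed

end
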